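(* Let $G=(T\cup N,E)$ be an instance of element connectivity with $n$ vertices and $m$ edges, let $R\subseteq T$ with $|R|\ge 2$, and let $w:N\cup E\to\mathbb{R}_{>0}\cup\{\infty\}$ assign positive (possibly infinite) weights to each non-terminal vertex and edge. Let $k=|R|$. Then one can compute $\kappa'(R)$ with constant probability in time $$O\Big(\Big(T_{ec}(m,n)\log k+\max_{m_1,\dots,m_n}\Big\{\sum_{i=1}^n T_{ec}(m_i,n):m_1+\cdots+m_n\le 2m\Big\}\Big)\log n\Big).$$
   Context: An instance of element connectivity is an undirected graph $G=(V,E)$ with vertex set partitioned into terminals $T$ and non-terminals $N=V\setminus T$; the elements are $E\cup N$. For terminals $s\ne t$, $\kappa'(s,t)$ is the minimum total weight of a set of elements whose removal disconnects $s$ from $t$, and $\kappa'(R)=\min_{s,t\in R,s\ne t}\kappa'(s,t)$. $T_{ec}(m,n)$ is the running time for computing a minimum weight element $(S,T)$-cut (equivalently a minimum $(s,t)$-cut in an edge-weighted directed graph) with $m$ edges and $n$ vertices. *)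

theory Defs
  imports "HOL-Probability.Probability_Mass_Function"
begin

section \<open>Element connectivity\<close>

record 'v egraph =
  verts :: "'v set"
  edges :: "'v set set"
  terminals :: "'v set"

definition nonterminals :: "'v egraph \<Rightarrow> 'v set" where
  "nonterminals G = verts G - terminals G"

(* Finite simple undirected graph. Edges between terminals are allowed. *)
definition egraph :: "'v egraph \<Rightarrow> bool" where
  "egraph G \<longleftrightarrow> finite (verts G) \<and> terminals G \<subseteq> verts G \<and>
     (\<forall>e\<in>edges G. e \<subseteq> verts G \<and> card e = 2)"

(* Elements are tagged: Inl v is the vertex v, Inr e is the edge e. *)
type_synonym 'v element = "'v + 'v set"

definition elements :: "'v egraph \<Rightarrow> 'v element set" where
  "elements G = Inl ` nonterminals G \<union> Inr ` edges G"

definition positive_weights :: "'v egraph \<Rightarrow> ('v element \<Rightarrow> ereal) \<Rightarrow> bool" where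
  "positive_weights G w \<longleftrightarrow> (\<forall>x\<in>elements G. 0 < w x)"

definition remaining_adj :: "'v egraph \<Rightarrow> 'v element set \<Rightarrow> ('v \<times> 'v) set" where
  "remaining_adj G X =
     {(u, v). {u, v} \<in> edges G \<and> Inr {u, v} \<notin> X \<and> Inl u \<notin> X \<and> Inl v \<notin> X}"

definition element_cut :: "'v egraph \<Rightarrow> 'v set \<Rightarrow> 'v set \<Rightarrow> 'v element set \<Rightarrow> bool" where
  "element_cut G A B X \<longleftrightarrow> X \<subseteq> elements G \<and>
     (\<forall>a\<in>A. \<forall>b\<in>B. (a, b) \<notin> (remaining_adj G X)\<^sup>*)"

definition min_element_cut ::
  "'v egraph \<Rightarrow> ('v element \<Rightarrow> ereal) \<Rightarrow> 'v set \<Rightarrow> 'v set \<Rightarrow> 'v element set \<Rightarrow> bool" where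
  "min_element_cut G w A B X \<longleftrightarrow> element_cut G A B X \<and>
     (\<forall>Y. element_cut G A B Y \<longrightarrow> sum w X \<le> sum w Y)"

definition kappa :: "'v egraph \<Rightarrow> ('v element \<Rightarrow> ereal) \<Rightarrow> 'v \<Rightarrow> 'v \<Rightarrow> ereal" where
  "kappa G w s t = Min {sum w X | X. element_cut G {s} {t} X}"

definition kappa_set :: "'v egraph \<Rightarrow> ('v element \<Rightarrow> ereal) \<Rightarrow> 'v set \<Rightarrow> ereal" where
  "kappa_set G w R = Min {kappa G w s t | s t. s \<in> R \<and> t \<in> R \<and> s \<noteq> t}"

(* The minima above range over finite nonempty sets. *)

lemma finite_elements: "egraph G \<Longrightarrow> finite (elements G)"
  unfolding egraph_def elements_def nonterminals_def
  by (metis (no_types, lifting) Pow_iff finite_Diff finite_Pow_iff finite_UnI finite_imageI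
      finite_subset subsetI)

lemma finite_element_cut_weights: "egraph G \<Longrightarrow> finite {sum w X | X. element_cut G A B X}"
  by (rule finite_subset[where B = "sum w ` Pow (elements G)"])
     (auto simp: element_cut_def finite_elements)

lemma element_cut_all_edges: "A \<inter> B = {} \<Longrightarrow> element_cut G A B (Inr ` edges G)"
proof -
  assume "A \<inter> B = {}"
  moreover have "remaining_adj G (Inr ` edges G) = {}"
    by (auto simp: remaining_adj_def)
  ultimately show ?thesis
    by (auto simp: element_cut_def elements_def)
qed

section \<open>Machine model\<close>

(* A unit-cost real RAM given as structured programs: the Cook-Reckhow integer RAM (addition,
   subtraction, comparison, indirect addressing), arithmetic and comparison on extended reals, and
   fair coin flips. There is no conversion between the two sorts and the only real constants are
   0, 1 and infinity. Memory consists of arrays named by numerals fixed in the program text;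
   a scalar variable is cell 0 of an array. *)

record state =
  nmem :: "nat \<Rightarrow> nat \<Rightarrow> nat"
  rmem :: "nat \<Rightarrow> nat \<Rightarrow> ereal"

datatype nexp = NConst nat | NCell nat nexp | NAdd nexp nexp | NSub nexp nexp

datatype rexp = RZero | ROne | RInf | RCell nat nexp
  | RAdd rexp rexp | RSub rexp rexp | RMul rexp rexp | RDiv rexp rexp

datatype bexp = NLess nexp nexp | RLess rexp rexp | BNot bexp | BAnd bexp bexp

datatype com =
    Skip
  | NAssign nat nexp nexp    (* array, index, value *)
  | RAssign nat nexp rexp
  | Flip nat nexp
  | Seq com com
  | Cond bexp com com
  | While bexp com

primrec nval :: "nexp \<Rightarrow> state \<Rightarrow> nat" where
  "nval (NConst n) s = n"
| "nval (NCell a e) s = nmem s a (nval e s)"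
| "nval (NAdd e1 e2) s = nval e1 s + nval e2 s"
| "nval (NSub e1 e2) s = nval e1 s - nval e2 s"

primrec rval :: "rexp \<Rightarrow> state \<Rightarrow> ereal" where
  "rval RZero s = 0"
| "rval ROne s = 1"
| "rval RInf s = \<infinity>"
| "rval (RCell a e) s = rmem s a (nval e s)"
| "rval (RAdd e1 e2) s = rval e1 s + rval e2 s"
| "rval (RSub e1 e2) s = rval e1 s - rval e2 s"
| "rval (RMul e1 e2) s = rval e1 s * rval e2 s"
| "rval (RDiv e1 e2) s = rval e1 s / rval e2 s"

primrec bval :: "bexp \<Rightarrow> state \<Rightarrow> bool" where
  "bval (NLess e1 e2) s \<longleftrightarrow> nval e1 s < nval e2 s"
| "bval (RLess e1 e2) s \<longleftrightarrow> rval e1 s < rval e2 s"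
| "bval (BNot b) s \<longleftrightarrow> \<not> bval b s"
| "bval (BAnd b1 b2) s \<longleftrightarrow> bval b1 s \<and> bval b2 s"

definition nwrite :: "nat \<Rightarrow> nat \<Rightarrow> nat \<Rightarrow> state \<Rightarrow> state" where
  "nwrite a i x s = s\<lparr>nmem := (nmem s)(a := (nmem s a)(i := x))\<rparr>"

definition rwrite :: "nat \<Rightarrow> nat \<Rightarrow> ereal \<Rightarrow> state \<Rightarrow> state" where
  "rwrite a i x s = s\<lparr>rmem := (rmem s)(a := (rmem s a)(i := x))\<rparr>"

(* Skip is the halted program, on which a step does nothing. Each step evaluates boundedly many
   expressions from the fixed program text and so stands for O(1) elementary operations. *)

primrec step :: "com \<Rightarrow> state \<Rightarrow> (com \<times> state) pmf" where
  "step Skip s = return_pmf (Skip, s)"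
| "step (NAssign a i e) s = return_pmf (Skip, nwrite a (nval i s) (nval e s) s)"
| "step (RAssign a i e) s = return_pmf (Skip, rwrite a (nval i s) (rval e s) s)"
| "step (Flip a i) s =
     map_pmf (\<lambda>b. (Skip, nwrite a (nval i s) (of_bool b) s)) (bernoulli_pmf (1 / 2))"
| "step (Seq c1 c2) s =
     (if c1 = Skip then return_pmf (c2, s)
      else map_pmf (\<lambda>(c1', s'). (Seq c1' c2, s')) (step c1 s))"
| "step (Cond b c1 c2) s = return_pmf (if bval b s then c1 else c2, s)"
| "step (While b c) s = return_pmf (if bval b s then Seq c (While b c) else Skip, s)"

primrec run :: "nat \<Rightarrow> com \<Rightarrow> state \<Rightarrow> (com \<times> state) pmf" where
  "run 0 c s = return_pmf (c, s)"
| "run (Suc t) c s = bind_pmf (step c s) (\<lambda>(c', s'). run t c' s')"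

definition halts_within :: "nat \<Rightarrow> com \<Rightarrow> state \<Rightarrow> bool" where
  "halts_within t c s \<longleftrightarrow> (\<forall>(c', s') \<in> set_pmf (run t c s). c' = Skip)"

section \<open>Input and output conventions\<close>

(* Integer arrays *)
abbreviation (input) "aSize \<equiv> 0 :: nat"      (* cell 0: number of vertices, cell 1: of edges *)
abbreviation (input) "aTail \<equiv> 1 :: nat"
abbreviation (input) "aHead \<equiv> 2 :: nat"
abbreviation (input) "aTerminal \<equiv> 3 :: nat"
abbreviation (input) "aLabel \<equiv> 4 :: nat"
abbreviation (input) "aCutVertex \<equiv> 5 :: nat"
abbreviation (input) "aCutEdge \<equiv> 6 :: nat"
(* Real arrays *)
abbreviation (input) "aVertexWeight \<equiv> 0 :: nat"
abbreviation (input) "aEdgeWeight \<equiv> 1 :: nat"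
abbreviation (input) "aResult \<equiv> 2 :: nat"

definition edge_at :: "state \<Rightarrow> nat \<Rightarrow> nat set" where
  "edge_at s i = {nmem s aTail i, nmem s aHead i}"

(* The vertices are 0, ..., n - 1, and the edges are listed without repetition (as there are
   card (edges G) entries) in arbitrary order and orientation. Nothing is assumed about the
   rest of the memory; in particular it need not be initialised. *)
definition graph_input :: "nat egraph \<Rightarrow> (nat element \<Rightarrow> ereal) \<Rightarrow> state \<Rightarrow> bool" where
  "graph_input G w s \<longleftrightarrow>
     verts G = {..<card (verts G)} \<and>
     nmem s aSize 0 = card (verts G) \<and>
     nmem s aSize 1 = card (edges G) \<and>
     edges G = edge_at s ` {..<card (edges G)} \<and>
     (\<forall>v\<in>verts G. nmem s aTerminal v = of_bool (v \<in> terminals G)) \<and>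
     (\<forall>v\<in>nonterminals G. rmem s aVertexWeight v = w (Inl v)) \<and>
     (\<forall>i<card (edges G). rmem s aEdgeWeight i = w (Inr (edge_at s i)))"

definition sides_input :: "nat egraph \<Rightarrow> nat set \<Rightarrow> nat set \<Rightarrow> state \<Rightarrow> bool" where
  "sides_input G A B s \<longleftrightarrow>
     (\<forall>v\<in>verts G. nmem s aLabel v = (if v \<in> A then 1 else if v \<in> B then 2 else 0))"

definition subset_input :: "nat egraph \<Rightarrow> nat set \<Rightarrow> state \<Rightarrow> bool" where
  "subset_input G R s \<longleftrightarrow> (\<forall>v\<in>verts G. nmem s aLabel v = of_bool (v \<in> R))"

(* The cut is returned as an indicator array over vertices and edges, the latter in the order of
   the input state s. *)
definition cut_output :: "nat egraph \<Rightarrow> nat element set \<Rightarrow> state \<Rightarrow> state \<Rightarrow> bool" where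
  "cut_output G X s s' \<longleftrightarrow>
     (\<forall>v\<in>verts G. nmem s' aCutVertex v = of_bool (Inl v \<in> X)) \<and>
     (\<forall>i<card (edges G). nmem s' aCutEdge i = of_bool (Inr (edge_at s i) \<in> X))"

(* P computes minimum weight element (A,B)-cuts, for disjoint nonempty sets A, B of terminals, and
   Tec m n bounds its running time on graphs with m edges and n vertices. P may flip coins, but
   must always be correct and on time. Writing the output into uninitialised memory takes m + n
   steps, so no separate assumption that Tec is at least linear is needed. *)
definition element_cut_solver :: "com \<Rightarrow> (nat \<Rightarrow> nat \<Rightarrow> nat) \<Rightarrow> bool" where
  "element_cut_solver P Tec \<longleftrightarrow>
     (\<forall>G w A B s.
        egraph G \<and> positive_weights G w \<and>
        A \<subseteq> terminals G \<and> B \<subseteq> terminals G \<and> A \<noteq> {} \<and> B \<noteq> {} \<and> A \<inter> B = {} \<and>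
        graph_input G w s \<and> sides_input G A B s \<longrightarrow>
        (\<forall>(c', s') \<in> set_pmf (run (Tec (card (edges G)) (card (verts G))) P s).
           c' = Skip \<and> (\<exists>X. min_element_cut G w A B X \<and> cut_output G X s s')))"

(* The maximum of Tec m_1 n + ... + Tec m_n n subject to m_1 + ... + m_n \<le> 2m. *)
definition max_split_time :: "(nat \<Rightarrow> nat \<Rightarrow> nat) \<Rightarrow> nat \<Rightarrow> nat \<Rightarrow> nat" where
  "max_split_time Tec m n =
     Max {(\<Sum>i=1..n. Tec (ms i) n) | ms. (\<Sum>i=1..n. ms i) \<le> 2 * m}"

lemma finite_split_times:
  fixes m n :: nat
  shows "finite {(\<Sum>i=1..n. Tec (ms i) n) | ms. (\<Sum>i=1..n. ms i) \<le> 2 * m}"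
proof (rule finite_subset)
  show "{(\<Sum>i=1..n. Tec (ms i) n) | ms. (\<Sum>i=1..n. ms i) \<le> 2 * m}
      \<subseteq> (\<lambda>ms. \<Sum>i=1..n. Tec (ms i) n) ` ({1..n} \<rightarrow>\<^sub>E {..2 * m})"
  proof clarify
    fix ms :: "nat \<Rightarrow> nat"
    assume le: "(\<Sum>i=1..n. ms i) \<le> 2 * m"
    have "ms i \<le> 2 * m" if "i \<in> {1..n}" for i
      using member_le_sum[OF that, of ms] le by simp
    then have "restrict ms {1..n} \<in> {1..n} \<rightarrow>\<^sub>E {..2 * m}"
      by auto
    then show "(\<Sum>i=1..n. Tec (ms i) n)
        \<in> (\<lambda>ms. \<Sum>i=1..n. Tec (ms i) n) ` ({1..n} \<rightarrow>\<^sub>E {..2 * m})"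
      by (intro image_eqI[where x = "restrict ms {1..n}"]) auto
  qed
qed (intro finite_imageI finite_PiE; simp)

end

theory Submission
  imports Defs
begin

text \<open>
  A cheapest cut separating two terminals of \<open>R\<close> splits \<open>R\<close> into two parts. Let \<open>c\<close> be the size of
  the smaller one. If every terminal is sampled with probability \<open>q\<close> where \<open>1/4 \<le> c * q \<le> 1/2\<close>, then
  with constant probability exactly one terminal \<open>r\<close> of the smaller part and at least one of the
  other part are sampled, and the cut isolates \<open>r\<close> from the other sampled terminals. All powers
  \<open>q = 1/2^j\<close> are tried.

  For a sample \<open>S\<close>, all minimum isolating cuts are found as follows. About \<open>log k\<close> minimum cuts, one
  for each bit of the ranks of the terminals in \<open>S\<close>, separate all pairs. By submodularity of the
  boundary of bisets, a minimum isolating cut of \<open>r\<close> may be chosen inside the component \<open>U r\<close> of \<open>r\<close> that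
  remains after deleting these cuts. It is a minimum cut of an instance that consists of the edges
  meeting \<open>U r\<close> and one further edge for every adjacent nonterminal outside all components. An
  edge of the graph is charged at most twice for all these instances.

  A solver has to write its output into uninitialised memory, so \<open>Tec m n \<ge> m + n\<close>, and the
  maximum over the splits is at least \<open>n * Tec 0 n \<ge> n^2\<close>. Hence work in \<open>O(n^2)\<close> for each sample, and in
  \<open>O(m + n)\<close> for each of the cuts, is within the time bound.
\<close>

section \<open>Reasoning about programs\<close>

text \<open>A cut deletes vertices as well as edges, so its source side S alone does not determine
  it. A biset S \<subseteq> T also records the deleted nonterminals T - S; such pairs are closed
  under intersection, union and complement, as uncrossing requires. The error is one-sided. The best
  value so far is always infinity or the capped weight of an actual cut between two terminals of R,
  so an unlucky sample can only leave it too large, and one good sample suffices. Hence the samples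
  for different q need not be independent: a single pass of coin flips gives each terminal a
  geometrically distributed level, and the sample for q = 1/2^j consists of the terminals of level
  at least j. Accordingly, all the cut computations are verified for every coin outcome at once
  (\<open>wp\<close>), and expectations (\<open>lexp\<close>) only carry the success probability of
  the sampling pass to the end of the run. The number of samples and the number of separating cuts
  per sample are both about log k. The factor log n of the bound arises by weakening log k to log n
  for the former.\<close>

definition wp :: "nat \<Rightarrow> com \<Rightarrow> (state \<Rightarrow> bool) \<Rightarrow> state \<Rightarrow> bool" where
  "wp t c Q s \<longleftrightarrow> (\<forall>(c', s') \<in> set_pmf (run t c s). c' = Skip \<and> Q s')"

lemma run_Skip [simp]: "run t Skip s = return_pmf (Skip, s)"
  by (induction t) (auto simp: bind_return_pmf)

lemma wp_Suc: "wp (Suc t) c Q s \<longleftrightarrow> (\<forall>(c', s') \<in> set_pmf (step c s). wp t c' Q s')"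
  by (fastforce simp: wp_def)

lemma wp_Skip [simp]: "wp t Skip Q s \<longleftrightarrow> Q s"
  by (simp add: wp_def)

lemma wp_0: "wp 0 c Q s \<longleftrightarrow> c = Skip \<and> Q s"
  by (auto simp: wp_def)

lemma wp_conseq: "wp t c Q s \<Longrightarrow> (\<And>s'. Q s' \<Longrightarrow> Q' s') \<Longrightarrow> wp t c Q' s"
  by (fastforce simp: wp_def)

text \<open>A halted program stays halted, so the step count in \<open>wp\<close> is an upper bound
  valid for all coin outcomes and not an exact time.\<close>

lemma wp_time_mono: "wp t c Q s \<Longrightarrow> t \<le> t' \<Longrightarrow> wp t' c Q s"
proof (induction t arbitrary: c s t')
  case 0
  then show ?case by (auto simp: wp_0)
next
  case (Suc t)
  then obtain u where "t' = Suc u" "t \<le> u"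
    by (cases t') auto
  with Suc show ?case by (fastforce simp: wp_Suc)
qed

lemma wp_weaken: "wp t c Q s \<Longrightarrow> t \<le> t' \<Longrightarrow> (\<And>s'. Q s' \<Longrightarrow> Q' s') \<Longrightarrow> wp t' c Q' s"
  by (blast intro: wp_time_mono wp_conseq)

text \<open>The additional step discards the \<open>Skip\<close> that \<open>c1\<close> leaves
  behind. The postcondition of \<open>c1\<close> is itself a timed statement about
  \<open>c2\<close>; intermediate states are handed on in this way.\<close>

lemma wp_Seq:
  "wp t1 c1 (\<lambda>s'. wp t2 c2 Q s') s \<Longrightarrow> t1 + t2 + 1 \<le> t \<Longrightarrow> wp t (Seq c1 c2) Q s"
proof -
  have "wp t1 c1 (\<lambda>s'. wp t2 c2 Q s') s \<Longrightarrow> wp (Suc (t1 + t2)) (Seq c1 c2) Q s"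
  proof (induction t1 arbitrary: c1 s)
    case 0
    then show ?case by (auto simp: wp_0 wp_Suc)
  next
    case (Suc t1)
    show ?case
    proof (cases "c1 = Skip")
      case True
      with Suc.prems show ?thesis
        by (auto simp: wp_Suc[of "Suc (t1 + t2)"] intro: wp_time_mono)
    next
      case False
      with Suc.prems Suc.IH show ?thesis
        by (fastforce simp: wp_Suc[of "Suc (t1 + t2)"] wp_Suc[of t1 c1])
    qed
  qed
  then show "wp t1 c1 (\<lambda>s'. wp t2 c2 Q s') s \<Longrightarrow> t1 + t2 + 1 \<le> t \<Longrightarrow> wp t (Seq c1 c2) Q s"
    by (auto intro: wp_time_mono)
qed

lemma wp_NAssign: "Q (nwrite a (nval i s) (nval e s) s) \<Longrightarrow> 1 \<le> t \<Longrightarrow> wp t (NAssign a i e) Q s"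
  by (rule wp_time_mono[of 1]) (auto simp: wp_Suc[of 0, simplified] wp_0)

lemma wp_RAssign: "Q (rwrite a (nval i s) (rval e s) s) \<Longrightarrow> 1 \<le> t \<Longrightarrow> wp t (RAssign a i e) Q s"
  by (rule wp_time_mono[of 1]) (auto simp: wp_Suc[of 0, simplified] wp_0)

lemma wp_Flip:
  "(\<And>b. Q (nwrite a (nval i s) (of_bool b) s)) \<Longrightarrow> 1 \<le> t \<Longrightarrow> wp t (Flip a i) Q s"
  by (rule wp_time_mono[of 1]) (auto simp: wp_Suc[of 0, simplified] wp_0)

lemma wp_Cond:
  "wp t1 (if bval b s then c1 else c2) Q s \<Longrightarrow> t1 + 1 \<le> t \<Longrightarrow> wp t (Cond b c1 c2) Q s"
  by (rule wp_time_mono[of "Suc t1"]) (auto simp: wp_Suc)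

lemma wp_While_False: "\<not> bval b s \<Longrightarrow> Q s \<Longrightarrow> 1 \<le> t \<Longrightarrow> wp t (While b c) Q s"
  by (rule wp_time_mono[of 1]) (auto simp: wp_Suc[of 0, simplified])

lemma wp_While_True:
  "bval b s \<Longrightarrow> wp t1 (Seq c (While b c)) Q s \<Longrightarrow> t1 + 1 \<le> t \<Longrightarrow> wp t (While b c) Q s"
  by (rule wp_time_mono[of "Suc t1"]) (auto simp: wp_Suc[of t1 "While b c"])

section \<open>Frame conditions: the arrays that a program text cannot change\<close>

primrec nwr :: "com \<Rightarrow> nat set" where
  "nwr Skip = {}"
| "nwr (NAssign a i e) = {a}"
| "nwr (RAssign a i e) = {}"
| "nwr (Flip a i) = {a}"
| "nwr (Seq c1 c2) = nwr c1 \<union> nwr c2"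
| "nwr (Cond b c1 c2) = nwr c1 \<union> nwr c2"
| "nwr (While b c) = nwr c"

primrec rwr :: "com \<Rightarrow> nat set" where
  "rwr Skip = {}"
| "rwr (NAssign a i e) = {}"
| "rwr (RAssign a i e) = {a}"
| "rwr (Flip a i) = {}"
| "rwr (Seq c1 c2) = rwr c1 \<union> rwr c2"
| "rwr (Cond b c1 c2) = rwr c1 \<union> rwr c2"
| "rwr (While b c) = rwr c"

lemma finite_nwr: "finite (nwr c)" and finite_rwr: "finite (rwr c)"
  by (induction c) auto

definition same :: "nat set \<Rightarrow> nat set \<Rightarrow> state \<Rightarrow> state \<Rightarrow> bool" where
  "same X Y s s' \<longleftrightarrow> (\<forall>a. a \<notin> X \<longrightarrow> nmem s' a = nmem s a) \<and> (\<forall>a. a \<notin> Y \<longrightarrow> rmem s' a = rmem s a)"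

lemma same_refl [simp]: "same X Y s s"
  by (simp add: same_def)

lemma same_trans: "same X Y s s' \<Longrightarrow> same X' Y' s' s'' \<Longrightarrow> X \<subseteq> Z \<Longrightarrow> X' \<subseteq> Z \<Longrightarrow> Y \<subseteq> W \<Longrightarrow> Y' \<subseteq> W \<Longrightarrow> same Z W s s''"
  unfolding same_def by (metis subsetD)

lemma same_nmem: "same X Y s s' \<Longrightarrow> a \<notin> X \<Longrightarrow> nmem s' a = nmem s a"
  by (simp add: same_def)

lemma same_rmem: "same X Y s s' \<Longrightarrow> a \<notin> Y \<Longrightarrow> rmem s' a = rmem s a"
  by (simp add: same_def)

lemma nmem_nwrite [simp]:
  "nmem (nwrite a i x s) b = (if a = b then (nmem s b)(i := x) else nmem s b)"
  by (simp add: nwrite_def)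

lemma rmem_nwrite [simp]: "rmem (nwrite a i x s) = rmem s"
  by (simp add: nwrite_def)

lemma rmem_rwrite [simp]:
  "rmem (rwrite a i x s) b = (if a = b then (rmem s b)(i := x) else rmem s b)"
  by (simp add: rwrite_def)

lemma nmem_rwrite [simp]: "nmem (rwrite a i x s) = nmem s"
  by (simp add: rwrite_def)

text \<open>The remaining program has to be controlled together with the state: it writes only
  arrays that \<open>c\<close> may write, and this carries the claim along a run.\<close>

lemma step_frame:
  "(c', s') \<in> set_pmf (step c s) \<Longrightarrow>
   nwr c' \<subseteq> nwr c \<and> rwr c' \<subseteq> rwr c \<and> same (nwr c) (rwr c) s s'"
proof (induction c arbitrary: c' s')
  case (Seq c1 c2)
  then show ?case
    by (auto split: if_splits simp: same_def) blast+
qed (auto simp: same_def split: if_splits)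

lemma run_frame:
  "(c', s') \<in> set_pmf (run t c s) \<Longrightarrow>
   nwr c' \<subseteq> nwr c \<and> rwr c' \<subseteq> rwr c \<and> same (nwr c) (rwr c) s s'"
proof (induction t arbitrary: c s)
  case (Suc t)
  then obtain c1 s1 where 1: "(c1, s1) \<in> set_pmf (step c s)" "(c', s') \<in> set_pmf (run t c1 s1)"
    by auto
  from step_frame[OF 1(1)] Suc.IH[OF 1(2)] show ?case
    by (auto intro: same_trans)
qed auto

lemma wp_frame: "wp t c Q s \<Longrightarrow> wp t c (\<lambda>s'. Q s' \<and> same (nwr c) (rwr c) s s') s"
  using run_frame by (fastforce simp: wp_def)

text \<open>Code without loops and coin flips acts as a function on states, which the simplifier can
  evaluate. The values at \<open>Flip\<close> and \<open>While\<close> are dummies, excluded by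
  \<open>straight\<close> wherever \<open>ex\<close> is used.\<close>

primrec ex :: "com \<Rightarrow> state \<Rightarrow> state" where
  "ex Skip s = s"
| "ex (NAssign a i e) s = nwrite a (nval i s) (nval e s) s"
| "ex (RAssign a i e) s = rwrite a (nval i s) (rval e s) s"
| "ex (Flip a i) s = s"
| "ex (Seq c1 c2) s = ex c2 (ex c1 s)"
| "ex (Cond b c1 c2) s = (if bval b s then ex c1 s else ex c2 s)"
| "ex (While b c) s = s"

primrec straight :: "com \<Rightarrow> bool" where
  "straight Skip = True"
| "straight (NAssign a i e) = True"
| "straight (RAssign a i e) = True"
| "straight (Flip a i) = False"
| "straight (Seq c1 c2) = (straight c1 \<and> straight c2)"
| "straight (Cond b c1 c2) = (straight c1 \<and> straight c2)"
| "straight (While b c) = False"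

primrec tm :: "com \<Rightarrow> nat" where
  "tm Skip = 0"
| "tm (NAssign a i e) = 1"
| "tm (RAssign a i e) = 1"
| "tm (Flip a i) = 1"
| "tm (Seq c1 c2) = tm c1 + tm c2 + 1"
| "tm (Cond b c1 c2) = max (tm c1) (tm c2) + 1"
| "tm (While b c) = 0"

lemma wp_straight: "straight c \<Longrightarrow> Q (ex c s) \<Longrightarrow> tm c \<le> t \<Longrightarrow> wp t c Q s"
proof (induction c arbitrary: Q s t)
  case (Seq c1 c2)
  then show ?case
    by (intro wp_Seq[of "tm c1" _ "tm c2"]) auto
next
  case (Cond b c1 c2)
  then show ?case
    by (intro wp_Cond[of "max (tm c1) (tm c2)"]) auto
qed (auto intro: wp_NAssign wp_RAssign)

abbreviation var :: "nat \<Rightarrow> nexp" where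
  "var a \<equiv> NCell a (NConst 0)"

abbreviation setv :: "nat \<Rightarrow> nexp \<Rightarrow> com" where
  "setv a e \<equiv> NAssign a (NConst 0) e"

section \<open>Counting loops and their running time\<close>

definition For :: "nat \<Rightarrow> nat \<Rightarrow> com \<Rightarrow> com" where
  "For x lm body =
     Seq (setv x (NConst 0))
       (While (NLess (var x) (var lm)) (Seq body (setv x (NAdd (var x) (NConst 1)))))"

lemma nwr_For [simp]: "nwr (For x lm body) = insert x (nwr body)"
  and rwr_For [simp]: "rwr (For x lm body) = rwr body"
  by (auto simp: For_def)

lemma wp_For_potential:
  assumes fresh: "x \<notin> nwr body" "lm \<notin> nwr body" "x \<noteq> lm"
    and N: "nmem s0 lm 0 = N"
    and init: "I 0 s0"
    and indep: "\<And>i s v. I i s \<Longrightarrow> I i (nwrite x 0 v s) \<and> B i (nwrite x 0 v s) = B i s"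
    and body: "\<And>i s. i < N \<Longrightarrow> nmem s x 0 = i \<Longrightarrow> same (insert x (nwr body)) (rwr body) s0 s \<Longrightarrow> I i s
      \<Longrightarrow> \<exists>t. wp t body (\<lambda>s'. I (Suc i) s' \<and> t + 4 + B (Suc i) s' \<le> B i s) s"
    and time: "B 0 s0 + 3 \<le> T"
  shows "wp T (For x lm body) (I N) s0"
proof -
  let ?inc = "setv x (NAdd (var x) (NConst 1))"
  let ?W = "While (NLess (var x) (var lm)) (Seq body ?inc)"
  let ?same = "same (insert x (nwr body)) (rwr body)"
  have loop: "wp (B i s + 1) ?W (I N) s"
    if "?same s0 s" "nmem s x 0 = i" "i \<le> N" "I i s" for i s
    using that
  proof (induction "N - i" arbitrary: i s)
    case 0
    then have "i = N" by simp
    moreover have "nmem s lm = nmem s0 lm"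
      using 0 fresh by (auto intro: same_nmem)
    ultimately show ?case
      using 0 N by (intro wp_While_False) auto
  next
    case (Suc d)
    then have "i < N" by simp
    have lm: "nmem s lm = nmem s0 lm"
      using Suc.prems fresh by (auto intro: same_nmem)
    obtain t where t: "wp t body (\<lambda>s'. I (Suc i) s' \<and> t + 4 + B (Suc i) s' \<le> B i s) s"
      using body[OF \<open>i < N\<close>] Suc.prems by blast
    \<comment> \<open>The inequality is known only for states after the body. Some such state
      exists, since the support of a distribution is nonempty, and this gives a bound before the
      body runs.\<close>
    have t4: "t + 4 \<le> B i s"
    proof -
      obtain z where "z \<in> set_pmf (run t body s)"
        using set_pmf_not_empty by fast
      with t show ?thesis by (auto simp: wp_def)
    qed
    have next_it: "wp (B i s - t - 3) ?W (I N) (nwrite x 0 (Suc i) s')"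
      if "I (Suc i) s' \<and> t + 4 + B (Suc i) s' \<le> B i s" "same (nwr body) (rwr body) s s'" for s'
    proof -
      let ?s = "nwrite x 0 (Suc i) s'"
      have "?same s0 ?s"
        using Suc.prems(1) that(2) by (auto simp: same_def)
      moreover have "I (Suc i) ?s" "B (Suc i) ?s = B (Suc i) s'"
        using indep that(1) by auto
      ultimately have "wp (B (Suc i) s' + 1) ?W (I N) ?s"
        using Suc.hyps(1)[of "Suc i" ?s] Suc.hyps(2) \<open>i < N\<close> by simp
      then show ?thesis
        using that(1) by (auto intro: wp_time_mono)
    qed
    have "wp (t + 2) (Seq body ?inc) (\<lambda>s'. wp (B i s - t - 3) ?W (I N) s') s"
    proof (rule wp_Seq[where ?t1.0 = t and ?t2.0 = 1])
      show "wp t body (\<lambda>s'. wp 1 ?inc (\<lambda>s'. wp (B i s - t - 3) ?W (I N) s') s') s"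
      proof (rule wp_conseq[OF wp_frame[OF t]])
        fix s' assume *: "(I (Suc i) s' \<and> t + 4 + B (Suc i) s' \<le> B i s) \<and> same (nwr body) (rwr body) s s'"
        then have "nmem s' x = nmem s x"
          using fresh by (auto intro: same_nmem)
        with * show "wp 1 ?inc (\<lambda>s'. wp (B i s - t - 3) ?W (I N) s') s'"
          using next_it Suc.prems by (intro wp_NAssign) auto
      qed
    qed simp
    then show ?case
      using t4 Suc.prems lm N \<open>i < N\<close>
      by (intro wp_While_True[OF _ wp_Seq[where ?t1.0 = "t + 2" and ?t2.0 = "B i s - t - 3" and t = "B i s"]]) auto
  qed
  have "wp (B 0 s0 + 1) ?W (I N) (nwrite x 0 0 s0)"
    using loop[of "nwrite x 0 0 s0" 0] indep[OF init, of 0] by (auto simp: same_def)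
  then show ?thesis
    unfolding For_def using time
    by (intro wp_Seq[where ?t1.0 = 1 and ?t2.0 = "B 0 s0 + 1"] wp_NAssign) auto
qed

text \<open>The potential is the time still to be spent on the iterations from \<open>i\<close>
  on.\<close>

lemma wp_For:
  assumes fresh: "x \<notin> nwr body" "lm \<notin> nwr body" "x \<noteq> lm"
    and N: "nmem s0 lm 0 = N"
    and init: "I 0 s0"
    and indep: "\<And>i s v. I i s \<Longrightarrow> I i (nwrite x 0 v s)"
    and body: "\<And>i s. i < N \<Longrightarrow> nmem s x 0 = i \<Longrightarrow> same (insert x (nwr body)) (rwr body) s0 s \<Longrightarrow> I i s
      \<Longrightarrow> wp (T i) body (I (Suc i)) s"
    and time: "(\<Sum>i<N. T i + 4) + 3 \<le> T'"
  shows "wp T' (For x lm body) (I N) s0"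
proof (rule wp_For_potential[where B = "\<lambda>i s. \<Sum>j\<in>{i..<N}. T j + 4", OF fresh N])
  show "I 0 s0" by fact
  show "(\<Sum>j\<in>{0..<N}. T j + 4) + 3 \<le> T'"
    using time by (simp add: lessThan_atLeast0)
  fix i s assume *: "i < N" "nmem s x 0 = i" "same (insert x (nwr body)) (rwr body) s0 s" "I i s"
  then have "(\<Sum>j\<in>{i..<N}. T j + 4) = T i + 4 + (\<Sum>j\<in>{Suc i..<N}. T j + 4)"
    by (simp add: sum.atLeast_Suc_lessThan)
  then show "\<exists>t. wp t body (\<lambda>s'. I (Suc i) s' \<and> t + 4 + (\<Sum>j\<in>{Suc i..<N}. T j + 4) \<le> (\<Sum>j\<in>{i..<N}. T j + 4)) s"
    using body[OF *] by (intro exI[of _ "T i"]) simp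
qed (use indep in auto)

lemma wp_For_const:
  assumes "x \<notin> nwr body" "lm \<notin> nwr body" "x \<noteq> lm"
    and "nmem s0 lm 0 = N"
    and "I 0 s0"
    and "\<And>i s v. I i s \<Longrightarrow> I i (nwrite x 0 v s)"
    and "\<And>i s. i < N \<Longrightarrow> nmem s x 0 = i \<Longrightarrow> same (insert x (nwr body)) (rwr body) s0 s \<Longrightarrow> I i s
      \<Longrightarrow> wp T body (I (Suc i)) s"
    and "N * (T + 4) + 3 \<le> T'"
  shows "wp T' (For x lm body) (I N) s0"
  using assms by (intro wp_For[where T = "\<lambda>_. T"]) auto

lemma wp_For_straight:
  assumes "straight body"
    and "x \<notin> nwr body" "lm \<notin> nwr body" "x \<noteq> lm"
    and "nmem s0 lm 0 = N"
    and "I 0 s0"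
    and "\<And>i s v. I i s \<Longrightarrow> I i (nwrite x 0 v s)"
    and "\<And>i s. i < N \<Longrightarrow> nmem s x 0 = i \<Longrightarrow> same (insert x (nwr body)) (rwr body) s0 s \<Longrightarrow> I i s
      \<Longrightarrow> I (Suc i) (ex body s)"
    and "N * (tm body + 4) + 3 \<le> T'"
  shows "wp T' (For x lm body) (I N) s0"
  using assms by (intro wp_For_const[where T = "tm body"] wp_straight) auto

section \<open>Lower bounds for expectations over the coin flips\<close>

definition lexp :: "nat \<Rightarrow> com \<Rightarrow> (state \<Rightarrow> ennreal) \<Rightarrow> state \<Rightarrow> ennreal" where
  "lexp t c f s = (\<integral>\<^sup>+ (c', s'). (if c' = Skip then f s' else 0) \<partial>measure_pmf (run t c s))"

lemma lexp_0: "lexp 0 c f s = (if c = Skip then f s else 0)"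
  by (simp add: lexp_def)

lemma lexp_Skip [simp]: "lexp t Skip f s = f s"
  by (simp add: lexp_def)

lemma lexp_Suc: "lexp (Suc t) c f s = (\<integral>\<^sup>+ (c', s'). lexp t c' f s' \<partial>measure_pmf (step c s))"
  by (simp add: lexp_def case_prod_unfold nn_integral_bind_pmf)

lemma lexp_mono: "(\<And>s'. f s' \<le> g s') \<Longrightarrow> lexp t c f s \<le> lexp t c g s"
  unfolding lexp_def by (intro nn_integral_mono) auto

text \<open>Runs that have not halted contribute 0, so a longer time limit can only replace zeros by
  values of \<open>f\<close>. A lower bound on \<open>lexp\<close> therefore covers halting and the
  outcome at once.\<close>

lemma lexp_Suc_time: "lexp t c f s \<le> lexp (Suc t) c f s"
proof (induction t arbitrary: c s)
  case 0
  then show ?case by (auto simp: lexp_0)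
next
  case (Suc t)
  then show ?case
    unfolding lexp_Suc[of _ c] by (intro nn_integral_mono) auto
qed

lemma lexp_time_mono: "t \<le> t' \<Longrightarrow> lexp t c f s \<le> lexp t' c f s"
  by (rule lift_Suc_mono_le[of "\<lambda>t. lexp t c f s"]) (rule lexp_Suc_time)

lemma lexp_frame: "lexp t c f s = lexp t c (\<lambda>s'. if same (nwr c) (rwr c) s s' then f s' else 0) s"
  unfolding lexp_def
  by (intro nn_integral_cong_AE) (auto simp: AE_measure_pmf_iff dest!: run_frame)

text \<open>An inequality only, since \<open>c2\<close> has more than \<open>t2\<close> steps left
  whenever \<open>c1\<close> halts early.\<close>

lemma lexp_Seq: "lexp t1 c1 (\<lambda>s'. lexp t2 c2 f s') s \<le> lexp (Suc (t1 + t2)) (Seq c1 c2) f s"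
proof (induction t1 arbitrary: c1 s)
  case 0
  then show ?case by (auto simp: lexp_0 lexp_Suc)
next
  case (Suc t1)
  show ?case
  proof (cases "c1 = Skip")
    case True
    have "lexp t2 c2 f s \<le> lexp (Suc (t1 + t2)) c2 f s"
      by (rule lexp_time_mono) simp
    with True show ?thesis
      by (simp add: lexp_Suc[of "Suc (t1 + t2)"])
  next
    case False
    then have "lexp (Suc (Suc t1 + t2)) (Seq c1 c2) f s
        = (\<integral>\<^sup>+ (c1', s'). lexp (Suc (t1 + t2)) (Seq c1' c2) f s' \<partial>measure_pmf (step c1 s))"
      by (simp add: lexp_Suc[of "Suc (t1 + t2)"] case_prod_unfold)
    also have "\<dots> \<ge> (\<integral>\<^sup>+ (c1', s'). lexp t1 c1' (\<lambda>s'. lexp t2 c2 f s') s' \<partial>measure_pmf (step c1 s))"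
      using Suc.IH by (intro nn_integral_mono) auto
    finally show ?thesis by (simp add: lexp_Suc[of t1])
  qed
qed

lemma lexp_ge_of_wp: "wp t c Q s \<Longrightarrow> (\<And>s'. Q s' \<Longrightarrow> x \<le> f s') \<Longrightarrow> x \<le> lexp t c f s"
proof -
  assume a: "wp t c Q s" "\<And>s'. Q s' \<Longrightarrow> x \<le> f s'"
  have "x = (\<integral>\<^sup>+ _. x \<partial>measure_pmf (run t c s))"
    by simp
  also have "\<dots> \<le> lexp t c f s"
    unfolding lexp_def using a
    by (intro nn_integral_mono_AE) (auto simp: AE_measure_pmf_iff wp_def)
  finally show ?thesis .
qed

lemma lexp_Flip:
  "1 \<le> t \<Longrightarrow> (f (nwrite a (nval i s) 1 s) + f (nwrite a (nval i s) 0 s)) / 2 \<le> lexp t (Flip a i) f s"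
proof -
  assume t: "1 \<le> t"
  have "(f (nwrite a (nval i s) 1 s) + f (nwrite a (nval i s) 0 s)) / 2 = lexp (Suc 0) (Flip a i) f s"
    by (simp add: lexp_Suc lexp_0 nn_integral_bernoulli_pmf ennreal_divide_eq_top_iff
        divide_ennreal_def field_simps distrib_left ennreal_inverse_1)
  also have "\<dots> \<le> lexp t (Flip a i) f s"
    using t by (intro lexp_time_mono) simp
  finally show ?thesis .
qed

section \<open>Isolating element cuts\<close>

text \<open>The cut that keeps \<open>S\<close> on one side: delete the vertices of
  \<open>T - S\<close> and the edges from \<open>S\<close> to the outside of \<open>T\<close>. Edges
  between \<open>S\<close> and \<open>T - S\<close> vanish with their deleted end and are not paid
  for.\<close>

definition boundary :: "'v egraph \<Rightarrow> 'v set \<Rightarrow> 'v set \<Rightarrow> 'v element set" where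
  "boundary G S T = Inl ` (T - S) \<union> Inr ` {e \<in> edges G. e \<inter> S \<noteq> {} \<and> \<not> e \<subseteq> T}"

definition biset :: "'v egraph \<Rightarrow> 'v set \<Rightarrow> 'v set \<Rightarrow> bool" where
  "biset G S T \<longleftrightarrow> S \<subseteq> T \<and> T \<subseteq> verts G \<and> T - S \<subseteq> nonterminals G"

lemma Inl_boundary [simp]: "Inl v \<in> boundary G S T \<longleftrightarrow> v \<in> T - S"
  and Inr_boundary [simp]: "Inr e \<in> boundary G S T \<longleftrightarrow> e \<in> edges G \<and> e \<inter> S \<noteq> {} \<and> \<not> e \<subseteq> T"
  by (auto simp: boundary_def)

lemma boundary_elements: "biset G S T \<Longrightarrow> boundary G S T \<subseteq> elements G"
  by (auto simp: biset_def boundary_def elements_def)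

lemma biset_compl: "biset G S T \<Longrightarrow> biset G (verts G - T) (verts G - S)"
  by (auto simp: biset_def)

text \<open>Seen from the other side, the kept vertices are those outside \<open>T\<close> and the
  deleted ones are again \<open>T - S\<close>. An edge meets \<open>S\<close> and leaves
  \<open>T\<close> exactly if it meets the complement of \<open>T\<close> and leaves the complement
  of \<open>S\<close>.\<close>

lemma boundary_compl:
  assumes "egraph G" "biset G S T"
  shows "boundary G (verts G - T) (verts G - S) = boundary G S T"
proof -
  have "e \<subseteq> verts G" if "e \<in> edges G" for e
    using assms that by (auto simp: egraph_def)
  then show ?thesis
    using assms(2) unfolding boundary_def biset_def by blast
qed

lemma biset_Int: "biset G S T \<Longrightarrow> biset G S' T' \<Longrightarrow> biset G (S \<inter> S') (T \<inter> T')"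
  and biset_Un: "biset G S T \<Longrightarrow> biset G S' T' \<Longrightarrow> biset G (S \<union> S') (T \<union> T')"
  unfolding biset_def by blast+

lemma sym_remaining_adj: "sym (remaining_adj G X)"
  by (auto simp: sym_def remaining_adj_def insert_commute)

lemma reach_sym: "(u, v) \<in> (remaining_adj G X)\<^sup>* \<Longrightarrow> (v, u) \<in> (remaining_adj G X)\<^sup>*"
  by (rule symD[OF sym_rtrancl[OF sym_remaining_adj]])

lemma remaining_adj_antimono: "X \<subseteq> Y \<Longrightarrow> remaining_adj G Y \<subseteq> remaining_adj G X"
  by (auto simp: remaining_adj_def)

lemma reach_antimono:
  "(u, v) \<in> (remaining_adj G Y)\<^sup>* \<Longrightarrow> X \<subseteq> Y \<Longrightarrow> (u, v) \<in> (remaining_adj G X)\<^sup>*"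
  using rtrancl_mono[OF remaining_adj_antimono] by blast

lemma reach_closed:
  assumes "(u, v) \<in> (remaining_adj G X)\<^sup>*" "u \<in> S"
    and "\<And>a b. a \<in> S \<Longrightarrow> (a, b) \<in> remaining_adj G X \<Longrightarrow> b \<in> S"
  shows "v \<in> S"
  using assms(1,2) by (induction) (auto intro: assms(3))

lemma reach_verts:
  assumes "egraph G" "(u, v) \<in> (remaining_adj G X)\<^sup>*" "u \<in> verts G"
  shows "v \<in> verts G"
  using assms(2,3) by (rule reach_closed) (use assms(1) in \<open>auto simp: remaining_adj_def egraph_def\<close>)

lemma reach_not_removed:
  assumes "(u, v) \<in> (remaining_adj G X)\<^sup>*" "Inl u \<notin> X"
  shows "Inl v \<notin> X"
  using assms by (cases rule: rtranclE) (auto simp: remaining_adj_def)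

text \<open>A step out of \<open>S\<close> ends in \<open>T - S\<close>, where the vertex is
  removed, or outside \<open>T\<close>, where the edge is removed.\<close>

lemma boundary_reach:
  assumes "(u, v) \<in> (remaining_adj G X)\<^sup>*" "boundary G S T \<subseteq> X" "u \<in> S"
  shows "v \<in> S"
  using assms(1,3)
proof (rule reach_closed)
  fix a b assume ab: "a \<in> S" "(a, b) \<in> remaining_adj G X"
  then have "Inl b \<notin> X" "Inr {a, b} \<notin> X"
    by (auto simp: remaining_adj_def)
  then have "Inl b \<notin> boundary G S T" "Inr {a, b} \<notin> boundary G S T"
    using assms(2) by blast+
  with ab show "b \<in> S"
    by (auto simp: remaining_adj_def)
qed

lemma boundary_element_cut:
  assumes "biset G S T" "A \<subseteq> S" "B \<inter> T = {}"
  shows "element_cut G A B (boundary G S T)"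
proof -
  have "b \<in> S" if "a \<in> A" "(a, b) \<in> (remaining_adj G (boundary G S T))\<^sup>*" for a b
    using boundary_reach[OF that(2)] that(1) assms(2) by blast
  then show ?thesis
    using boundary_elements[OF assms(1)] assms(1,3) by (fastforce simp: element_cut_def biset_def)
qed

text \<open>Take for \<open>S\<close> what is still reachable from \<open>A\<close>, and add all
  deleted vertices to obtain \<open>T\<close>. An edge from \<open>S\<close> to the outside of
  \<open>T\<close> was deleted, as otherwise its far end would be reachable.\<close>

lemma element_cut_biset:
  assumes G: "egraph G" and cut: "element_cut G A B X" and A: "A \<subseteq> terminals G" and B: "B \<subseteq> terminals G"
  obtains S T where "biset G S T" "boundary G S T \<subseteq> X" "A \<subseteq> S" "B \<inter> T = {}"
proof
  define S where "S = (remaining_adj G X)\<^sup>* `` A"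
  define T where "T = S \<union> {v. Inl v \<in> X}"
  have X: "X \<subseteq> elements G" and sep: "\<And>a b. a \<in> A \<Longrightarrow> b \<in> B \<Longrightarrow> (a, b) \<notin> (remaining_adj G X)\<^sup>*"
    using cut by (auto simp: element_cut_def)
  have XN: "v \<in> nonterminals G" if "Inl v \<in> X" for v
    using X that by (auto simp: elements_def)
  have AV: "A \<subseteq> verts G"
    using G A by (auto simp: egraph_def)
  show "biset G S T"
    using XN AV reach_verts[OF G] by (auto simp: biset_def T_def S_def nonterminals_def)
  show "A \<subseteq> S"
    by (auto simp: S_def)
  show "B \<inter> T = {}"
    using sep XN B by (auto simp: T_def S_def nonterminals_def)
  show "boundary G S T \<subseteq> X"
  proof
    fix x assume x: "x \<in> boundary G S T"
    show "x \<in> X"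
    proof (cases x)
      case (Inl v)
      with x show ?thesis by (auto simp: T_def)
    next
      case (Inr e)
      with x have e: "e \<in> edges G" "e \<inter> S \<noteq> {}" "\<not> e \<subseteq> T" by auto
      then obtain u v where uv: "u \<in> e" "u \<in> S" "v \<in> e" "v \<notin> T" by auto
      then have "u \<noteq> v" by (auto simp: T_def)
      moreover have "card e = 2" using e G by (auto simp: egraph_def)
      ultimately have "e = {u, v}"
        using uv by (auto simp: card_2_iff)
      moreover obtain a where a: "a \<in> A" "(a, u) \<in> (remaining_adj G X)\<^sup>*"
        using uv by (auto simp: S_def)
      moreover have "Inl u \<notin> X"
        using reach_not_removed[OF a(2)] XN a(1) A by (auto simp: nonterminals_def)
      moreover have "Inl v \<notin> X" "v \<notin> S"
        using uv by (auto simp: T_def)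
      ultimately have "Inr e \<in> X"
        using e unfolding S_def remaining_adj_def
        by (auto dest: rtrancl_into_rtrancl)
      with Inr show ?thesis by simp
    qed
  qed
qed

text \<open>Counted elementwise: an element in one boundary on the left lies in one on the right,
  and an element in both on the left lies in both on the right. Since weights are nonnegative, this
  gives the inequality.\<close>

lemma sum_boundary_submodular:
  fixes w :: "'v element \<Rightarrow> real"
  assumes G: "egraph G" and pos: "\<And>x. x \<in> elements G \<Longrightarrow> 0 < w x"
    and b: "biset G S T" "biset G S' T'"
  shows "sum w (boundary G (S \<inter> S') (T \<inter> T')) + sum w (boundary G (S \<union> S') (T \<union> T'))
    \<le> sum w (boundary G S T) + sum w (boundary G S' T')"
proof -
  let ?I = "boundary G (S \<inter> S') (T \<inter> T')" and ?U = "boundary G (S \<union> S') (T \<union> T')"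
  let ?P = "boundary G S T" and ?Q = "boundary G S' T'"
  have sub: "?I \<subseteq> elements G" "?U \<subseteq> elements G" "?P \<subseteq> elements G" "?Q \<subseteq> elements G"
    using b biset_Int[OF b] biset_Un[OF b] by (simp_all add: boundary_elements)
  have fin: "finite ?I" "finite ?U" "finite ?P" "finite ?Q"
    using sub finite_elements[OF G] by (auto intro: finite_subset)
  have ST: "S \<subseteq> T" "S' \<subseteq> T'" using b by (auto simp: biset_def)
  have "?I \<union> ?U \<subseteq> ?P \<union> ?Q" "?I \<inter> ?U \<subseteq> ?P \<inter> ?Q"
    using ST unfolding boundary_def by blast+
  moreover have nonneg: "0 \<le> w x" if "x \<in> ?P \<union> ?Q" for x
    using pos[of x] sub that by fastforce
  ultimately have "sum w (?I \<union> ?U) + sum w (?I \<inter> ?U) \<le> sum w (?P \<union> ?Q) + sum w (?P \<inter> ?Q)"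
    using fin by (intro add_mono sum_mono2) auto
  then show ?thesis
    using fin by (simp add: sum.union_inter)
qed

lemma min_element_cut_biset:
  fixes w :: "'v element \<Rightarrow> real"
  assumes G: "egraph G" and pos: "\<And>x. x \<in> elements G \<Longrightarrow> 0 < w x"
    and cut: "min_element_cut G w A B X" and A: "A \<subseteq> terminals G" and B: "B \<subseteq> terminals G"
  obtains S T where "biset G S T" "boundary G S T = X" "A \<subseteq> S" "B \<inter> T = {}"
    "\<And>S' T'. biset G S' T' \<Longrightarrow> A \<subseteq> S' \<Longrightarrow> B \<inter> T' = {} \<Longrightarrow> sum w X \<le> sum w (boundary G S' T')"
proof -
  have ec: "element_cut G A B X" using cut by (simp add: min_element_cut_def)
  obtain S T where ST: "biset G S T" "boundary G S T \<subseteq> X" "A \<subseteq> S" "B \<inter> T = {}"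
    using element_cut_biset[OF G ec A B] .
  have min: "sum w X \<le> sum w (boundary G S' T')"
    if "biset G S' T'" "A \<subseteq> S'" "B \<inter> T' = {}" for S' T'
    using cut boundary_element_cut[OF that] by (auto simp: min_element_cut_def)
  have "boundary G S T = X"
  proof (rule ccontr)
    assume "boundary G S T \<noteq> X"
    with ST(2) obtain x where x: "x \<in> X" "x \<notin> boundary G S T" by auto
    have X: "X \<subseteq> elements G" using ec by (simp add: element_cut_def)
    then have "sum w (boundary G S T) < sum w X"
      using x ST(2) finite_elements[OF G] pos
      by (intro sum_strict_mono2[where b = x]) (auto intro: finite_subset order.strict_implies_order)
    with min[OF ST(1,3,4)] show False by simp
  qed
  with ST min that show ?thesis by blast
qed

text \<open>The last clause constrains \<open>T\<close> and not just \<open>S\<close>: the vertices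
  of \<open>T - S\<close> are to be deleted in a small instance in which the components of the other
  terminals cannot be deleted.\<close>

definition avoiding :: "'v egraph \<Rightarrow> ('v element \<Rightarrow> real) \<Rightarrow> 'v set \<Rightarrow> ('v \<times> 'v) set \<Rightarrow> 'v element set
    \<Rightarrow> 'v \<Rightarrow> real \<Rightarrow> 'v set \<Rightarrow> 'v set \<Rightarrow> bool" where
  "avoiding G w R D Y r c S T \<longleftrightarrow> biset G S T \<and> S \<inter> R = {r} \<and> sum w (boundary G S T) \<le> c \<and>
    (\<forall>v\<in>S. Inl v \<notin> Y) \<and> (\<forall>e. Inr e \<in> Y \<longrightarrow> \<not> e \<subseteq> S) \<and>
    (\<forall>v\<in>T. \<forall>r'\<in>R. (r, r') \<in> D \<longrightarrow> (r', v) \<notin> (remaining_adj G Y)\<^sup>*)"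

text \<open>The invariant of the rounds of an isolating cut computation on the terminals \<open>R\<close>, where
  \<open>Y\<close> is the union of the cuts found so far and \<open>D\<close> contains the pairs of terminals that
  they separate: a cheapest isolating cut may be chosen such that \<open>Y\<close> contains nothing inside it.\<close>

definition isolating :: "'v egraph \<Rightarrow> ('v element \<Rightarrow> real) \<Rightarrow> 'v set \<Rightarrow> ('v \<times> 'v) set \<Rightarrow> 'v element set \<Rightarrow> bool" where
  "isolating G w R D Y \<longleftrightarrow> Y \<subseteq> elements G \<and>
    (\<forall>r\<in>R. \<forall>r'\<in>R. (r, r') \<in> D \<longrightarrow> (r, r') \<notin> (remaining_adj G Y)\<^sup>*) \<and>
    (\<forall>r\<in>R. \<forall>S T. biset G S T \<longrightarrow> S \<inter> R = {r} \<longrightarrow>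
      (\<exists>S' T'. avoiding G w R D Y r (sum w (boundary G S T)) S' T'))"

lemma isolating_empty: "isolating G w R {} {}"
proof -
  have "avoiding G w R {} {} r (sum w (boundary G S T)) S T" if "biset G S T" "S \<inter> R = {r}" for r S T
    using that by (simp add: avoiding_def)
  then show ?thesis
    unfolding isolating_def by blast
qed

lemma isolating_mono:
  assumes iso: "isolating G w R D Y" and D: "D' \<inter> R \<times> R \<subseteq> D"
  shows "isolating G w R D' Y"
proof -
  have D: "(r, r') \<in> D" if "r \<in> R" "r' \<in> R" "(r, r') \<in> D'" for r r'
    using D that by blast
  have mono: "avoiding G w R D' Y r c S T" if "avoiding G w R D Y r c S T" "r \<in> R" for r c S T
    using that D unfolding avoiding_def by simp
  show ?thesis
    unfolding isolating_def
  proof (intro conjI ballI allI impI)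
    show "Y \<subseteq> elements G"
      using iso by (simp add: isolating_def)
    fix r assume r: "r \<in> R"
    show "(r, r') \<notin> (remaining_adj G Y)\<^sup>*" if "r' \<in> R" "(r, r') \<in> D'" for r'
      using iso D[OF r that] r that(1) by (simp add: isolating_def)
    fix S T assume "biset G S T" "S \<inter> R = {r}"
    then have "\<exists>S' T'. avoiding G w R D Y r (sum w (boundary G S T)) S' T'"
      using iso r by (simp add: isolating_def)
    with mono[OF _ r] show "\<exists>S' T'. avoiding G w R D' Y r (sum w (boundary G S T)) S' T'"
      by blast
  qed
qed

text \<open>Intersect a biset that avoids \<open>Y\<close> with the source side of the new minimum
  cut \<open>X\<close>. The union of the two still separates \<open>A\<close> from \<open>B\<close>
  and so costs at least as much as \<open>X\<close>; by submodularity the intersection costs no more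
  than the given biset. As \<open>X\<close> is the boundary of (\<open>Sx\<close>,
  \<open>Tx\<close>), it has no vertex and no whole edge inside \<open>Sx\<close>.\<close>

lemma isolating_half_step:
  fixes w :: "'v element \<Rightarrow> real"
  assumes G: "egraph G" and pos: "\<And>x. x \<in> elements G \<Longrightarrow> 0 < w x"
    and R: "R \<subseteq> terminals G"
    and iso: "isolating G w R D Y"
    and cut: "biset G Sx Tx" "boundary G Sx Tx = X" "A \<subseteq> Sx" "B \<inter> Tx = {}"
      "\<And>S' T'. biset G S' T' \<Longrightarrow> A \<subseteq> S' \<Longrightarrow> B \<inter> T' = {} \<Longrightarrow> sum w X \<le> sum w (boundary G S' T')"
    and AB: "A \<union> B = R" "A \<inter> B = {}"
    and r: "r \<in> A" and ST: "biset G S T" "S \<inter> R = {r}"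
  shows "\<exists>S' T'. avoiding G w R (D \<union> A \<times> B \<union> B \<times> A) (Y \<union> X) r (sum w (boundary G S T)) S' T'"
proof -
  have "r \<in> R" using r AB by auto
  then obtain S1 T1 where "avoiding G w R D Y r (sum w (boundary G S T)) S1 T1"
    using iso ST unfolding isolating_def by blast
  then have 1: "biset G S1 T1" "S1 \<inter> R = {r}"
      "sum w (boundary G S1 T1) \<le> sum w (boundary G S T)"
      "\<forall>v\<in>S1. Inl v \<notin> Y" "\<forall>e. Inr e \<in> Y \<longrightarrow> \<not> e \<subseteq> S1"
      "\<And>v r'. v \<in> T1 \<Longrightarrow> r' \<in> R \<Longrightarrow> (r, r') \<in> D \<Longrightarrow> (r', v) \<notin> (remaining_adj G Y)\<^sup>*"
    unfolding avoiding_def by blast+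
  have T1R: "T1 \<inter> R = {r}"
    using 1(1,2) R by (auto simp: biset_def nonterminals_def)
  define S2 T2 where "S2 = S1 \<inter> Sx" and "T2 = T1 \<inter> Tx"
  \<comment> \<open>The union contains \<open>A\<close>, and its larger set misses \<open>B\<close>
    because \<open>T1\<close> contains no terminal of \<open>R\<close> except \<open>r\<close>,
    which is in \<open>A\<close>.\<close>
  have "sum w X \<le> sum w (boundary G (S1 \<union> Sx) (T1 \<union> Tx))"
    using cut(1,3,4) 1(1) T1R AB r by (intro cut(5) biset_Un) auto
  with sum_boundary_submodular[where w = w, OF G pos 1(1) cut(1)] cut(2) 1(3)
  have le: "sum w (boundary G S2 T2) \<le> sum w (boundary G S T)"
    by (simp add: S2_def T2_def)
  have sep: "(r', v) \<notin> (remaining_adj G (Y \<union> X))\<^sup>*"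
    if v: "v \<in> T2" and r': "r' \<in> R" "(r, r') \<in> D \<union> A \<times> B \<union> B \<times> A" for v r'
  proof
    assume reach: "(r', v) \<in> (remaining_adj G (Y \<union> X))\<^sup>*"
    show False
    proof (cases "(r, r') \<in> D")
      case True
      with 1(6) v r' reach_antimono[OF reach] show False by (auto simp: T2_def)
    next
      case False
      with r' r AB have "r' \<in> B" by auto
      have Rv: "R \<subseteq> verts G" using R G by (auto simp: egraph_def)
      \<comment> \<open>What a terminal of \<open>B\<close> reaches after deleting \<open>X\<close>
        stays outside \<open>Tx\<close>, by the complementary biset; but \<open>v\<close> lies in
        \<open>Tx\<close>.\<close>
      have "v \<in> verts G - Tx"
      proof (rule boundary_reach[OF reach])
        show "boundary G (verts G - Tx) (verts G - Sx) \<subseteq> Y \<union> X"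
          using boundary_compl[OF G cut(1)] cut(2) by auto
        show "r' \<in> verts G - Tx" using \<open>r' \<in> B\<close> cut(4) AB Rv by auto
      qed
      with v show False by (auto simp: T2_def)
    qed
  qed
  have "S2 \<inter> R = {r}" using 1(2) cut(3) r by (auto simp: S2_def)
  moreover have "\<forall>v\<in>S2. Inl v \<notin> Y \<union> X"
    using 1(4) unfolding S2_def by (auto simp flip: cut(2))
  moreover have "\<forall>e. Inr e \<in> Y \<union> X \<longrightarrow> \<not> e \<subseteq> S2"
    using 1(5) cut(1) unfolding S2_def biset_def by (auto simp flip: cut(2))
  moreover have "biset G S2 T2"
    using biset_Int[OF 1(1) cut(1)] by (simp add: S2_def T2_def)
  ultimately have "avoiding G w R (D \<union> A \<times> B \<union> B \<times> A) (Y \<union> X) r (sum w (boundary G S T)) S2 T2"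
    using le sep unfolding avoiding_def by simp
  then show ?thesis by blast
qed

text \<open>For terminals in \<open>B\<close> the half step is applied to the complementary biset,
  which has the same boundary and is also cheapest for the exchanged sides.\<close>

lemma isolating_step:
  fixes w :: "'v element \<Rightarrow> real"
  assumes G: "egraph G" and pos: "\<And>x. x \<in> elements G \<Longrightarrow> 0 < w x"
    and R: "R \<subseteq> terminals G" and AB: "A \<union> B = R" "A \<inter> B = {}"
    and iso: "isolating G w R D Y" and cut: "min_element_cut G w A B X"
  shows "isolating G w R (D \<union> A \<times> B \<union> B \<times> A) (Y \<union> X)"
proof -
  have AT: "A \<subseteq> terminals G" "B \<subseteq> terminals G" using AB R by auto
  have AV: "A \<subseteq> verts G" "B \<subseteq> verts G" using AT G by (auto simp: egraph_def)
  obtain S T where ST: "biset G S T" "boundary G S T = X" "A \<subseteq> S" "B \<inter> T = {}"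
    "\<And>S' T'. biset G S' T' \<Longrightarrow> A \<subseteq> S' \<Longrightarrow> B \<inter> T' = {} \<Longrightarrow> sum w X \<le> sum w (boundary G S' T')"
    using min_element_cut_biset[OF G pos cut AT] by blast
  have ST': "boundary G (verts G - T) (verts G - S) = X" "B \<subseteq> verts G - T" "A \<inter> (verts G - S) = {}"
    using boundary_compl[OF G ST(1)] ST AV by auto
  have min': "sum w X \<le> sum w (boundary G S' T')"
    if "biset G S' T'" "B \<subseteq> S'" "A \<inter> T' = {}" for S' T'
    using ST(5)[OF biset_compl[OF that(1)]] boundary_compl[OF G that(1)] that AV by fastforce
  have elem: "Y \<union> X \<subseteq> elements G"
    using iso cut by (auto simp: isolating_def min_element_cut_def element_cut_def)
  have sepX: "(r, r') \<notin> (remaining_adj G X)\<^sup>*" if "r \<in> A" "r' \<in> B" for r r'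
    using cut that by (auto simp: min_element_cut_def element_cut_def)
  have sepY: "(r, r') \<notin> (remaining_adj G Y)\<^sup>*" if "r \<in> R" "r' \<in> R" "(r, r') \<in> D" for r r'
    using iso that by (auto simp: isolating_def)
  have "(r, r') \<notin> (remaining_adj G (Y \<union> X))\<^sup>*"
    if "r \<in> R" "r' \<in> R" "(r, r') \<in> D \<union> A \<times> B \<union> B \<times> A" for r r'
  proof
    assume reach: "(r, r') \<in> (remaining_adj G (Y \<union> X))\<^sup>*"
    have "(r, r') \<in> (remaining_adj G Y)\<^sup>*" "(r, r') \<in> (remaining_adj G X)\<^sup>*"
      "(r', r) \<in> (remaining_adj G X)\<^sup>*"
      using reach_antimono[OF reach] reach_antimono[OF reach_sym[OF reach]] by auto
    with that sepX sepY show False by auto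
  qed
  moreover have "\<exists>S' T'. avoiding G w R (D \<union> A \<times> B \<union> B \<times> A) (Y \<union> X) r (sum w (boundary G S0 T0)) S' T'"
    if r: "r \<in> R" and b: "biset G S0 T0" "S0 \<inter> R = {r}" for r S0 T0
  proof (cases "r \<in> A")
    case True
    then show ?thesis
      using isolating_half_step[OF G pos R iso ST AB _ b] by blast
  next
    case False
    then have "r \<in> B" using r AB by auto
    moreover have BA: "B \<union> A = R" "B \<inter> A = {}" using AB by auto
    ultimately have "\<exists>S' T'. avoiding G w R (D \<union> B \<times> A \<union> A \<times> B) (Y \<union> X) r (sum w (boundary G S0 T0)) S' T'"
      using isolating_half_step[OF G pos R iso biset_compl[OF ST(1)] ST' min' BA _ b] by blast
    then show ?thesis by (simp add: Un_ac)
  qed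
  ultimately show ?thesis
    using elem unfolding isolating_def by simp
qed

section \<open>The small instance belonging to one terminal\<close>

definition comp_of :: "'v egraph \<Rightarrow> 'v element set \<Rightarrow> 'v \<Rightarrow> 'v set" where
  "comp_of G Y r = (remaining_adj G Y)\<^sup>* `` {r}"

text \<open>These are the nonterminals in \<open>Y\<close> together with those left in components
  that contain no terminal of \<open>R\<close>.\<close>

definition free_nonterminals :: "'v egraph \<Rightarrow> 'v set \<Rightarrow> 'v element set \<Rightarrow> 'v set" where
  "free_nonterminals G R Y = nonterminals G - (\<Union>r\<in>R. comp_of G Y r)"

definition rim :: "'v egraph \<Rightarrow> 'v set \<Rightarrow> 'v element set \<Rightarrow> 'v \<Rightarrow> 'v set" where
  "rim G R Y r = {z \<in> free_nonterminals G R Y. \<exists>u\<in>comp_of G Y r. {u, z} \<in> edges G}"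

definition rim_edges :: "'v egraph \<Rightarrow> 'v set \<Rightarrow> 'v element set \<Rightarrow> 'v \<Rightarrow> 'v \<Rightarrow> 'v set set" where
  "rim_edges G R Y r b = (\<lambda>z. {z, b}) ` rim G R Y r"

definition inner_edges :: "'v egraph \<Rightarrow> 'v element set \<Rightarrow> 'v \<Rightarrow> 'v set set" where
  "inner_edges G Y r = {e \<in> edges G. e \<inter> comp_of G Y r \<noteq> {}}"

text \<open>The vertices of the other components become terminals, so they are undeletable sinks. By
  the last clause of \<open>avoiding\<close> this excludes no cheapest cut, and they need no
  additional edge to \<open>b\<close>; only rim vertices cost one, which the edge count relies
  on.\<close>

definition sub_graph :: "'v egraph \<Rightarrow> 'v set \<Rightarrow> 'v element set \<Rightarrow> 'v \<Rightarrow> 'v \<Rightarrow> 'v egraph" where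
  "sub_graph G R Y r b = \<lparr>verts = verts G, edges = inner_edges G Y r \<union> rim_edges G R Y r b,
     terminals = terminals G \<union> (\<Union>r'\<in>R - {r}. comp_of G Y r')\<rparr>"

text \<open>The component of \<open>r\<close> may contain terminals outside \<open>R\<close>; they
  need not be separated from \<open>r\<close> and are left out.\<close>

definition sub_sinks :: "'v egraph \<Rightarrow> 'v set \<Rightarrow> 'v element set \<Rightarrow> 'v \<Rightarrow> 'v set" where
  "sub_sinks G R Y r = (terminals G \<union> (\<Union>r'\<in>R - {r}. comp_of G Y r')) - comp_of G Y r"

definition sub_weight :: "'v egraph \<Rightarrow> ('v element \<Rightarrow> real) \<Rightarrow> 'v set \<Rightarrow> 'v element set \<Rightarrow> 'v \<Rightarrow> 'v \<Rightarrow> 'v element \<Rightarrow> ereal" where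
  "sub_weight G w R Y r b x = (if x \<in> Inr ` rim_edges G R Y r b then \<infinity> else ereal (w x))"

text \<open>All vertices are kept, so that every instance has exactly \<open>n\<close> vertices. The edges of infinite
  weight from the rim to another terminal \<open>b\<close> prevent a cut from leaving the component of \<open>r\<close>.\<close>

locale isolated =
  fixes G :: "'v egraph" and w :: "'v element \<Rightarrow> real" and R Y
  assumes G: "egraph G" and pos: "\<And>x. x \<in> elements G \<Longrightarrow> 0 < w x"
    and R: "R \<subseteq> terminals G"
    and iso: "isolating G w R {(r, r'). r \<noteq> r'} Y"
begin

abbreviation "U \<equiv> comp_of G Y"
abbreviation "N0 \<equiv> free_nonterminals G R Y"

lemma finite_R: "finite R"
  using R G by (auto simp: egraph_def intro: finite_subset)

lemma finite_edges: "finite (edges G)"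
  using G by (auto simp: egraph_def intro: finite_subset[of _ "Pow (verts G)"])

lemma U_self [simp]: "r \<in> U r"
  by (simp add: comp_of_def)

lemma U_verts: "r \<in> R \<Longrightarrow> U r \<subseteq> verts G"
  using reach_verts[OF G, of r] R G by (auto simp: comp_of_def egraph_def)

lemma U_disjoint: "r \<in> R \<Longrightarrow> r' \<in> R \<Longrightarrow> r \<noteq> r' \<Longrightarrow> U r \<inter> U r' = {}"
proof -
  assume a: "r \<in> R" "r' \<in> R" "r \<noteq> r'"
  then have "(r, r') \<notin> (remaining_adj G Y)\<^sup>*" using iso by (auto simp: isolating_def)
  then show ?thesis
    using reach_sym[of r' _ G Y] by (auto simp: comp_of_def) (meson rtrancl_trans)
qed

lemma N0_nonterminals: "N0 \<subseteq> nonterminals G"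
  by (auto simp: free_nonterminals_def)

lemma N0_U: "r \<in> R \<Longrightarrow> N0 \<inter> U r = {}"
  by (auto simp: free_nonterminals_def)

lemma rim_N0: "rim G R Y r \<subseteq> N0"
  by (auto simp: rim_def)

context
  fixes r b assumes r: "r \<in> R" and b: "b \<in> R" and rb: "r \<noteq> b"
begin

abbreviation "G' \<equiv> sub_graph G R Y r b"
abbreviation "B' \<equiv> sub_sinks G R Y r"
abbreviation "w' \<equiv> sub_weight G w R Y r b"

lemma b_notin_U: "b \<notin> U r"
  using U_disjoint[OF r b rb] U_self by blast

lemma sub_graph_egraph: "egraph G'"
proof -
  have RV: "R \<subseteq> verts G" and T: "terminals G \<subseteq> verts G" using R G by (auto simp: egraph_def)
  have "z \<noteq> b" "z \<in> verts G" if "z \<in> rim G R Y r" for z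
    using that rim_N0 N0_nonterminals b R by (auto simp: nonterminals_def)
  then have "e \<subseteq> verts G \<and> card e = 2" if "e \<in> rim_edges G R Y r b" for e
    using that RV b by (auto simp: rim_edges_def)
  moreover have "e \<subseteq> verts G \<and> card e = 2" if "e \<in> inner_edges G Y r" for e
    using that G by (auto simp: inner_edges_def egraph_def)
  ultimately show ?thesis
    using G T U_verts by (simp add: egraph_def sub_graph_def) blast
qed

lemma nonterminals_sub_graph: "nonterminals G' \<subseteq> nonterminals G"
  by (auto simp: sub_graph_def nonterminals_def)

lemma inner_rim_disjoint: "inner_edges G Y r \<inter> rim_edges G R Y r b = {}"
  using b_notin_U N0_U[OF r] rim_N0 by (auto simp: inner_edges_def rim_edges_def)

lemma sub_positive: "positive_weights G' w'"
proof -
  have "x \<in> elements G" if "x \<in> elements G'" "x \<notin> Inr ` rim_edges G R Y r b" for x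
    using that nonterminals_sub_graph by (auto simp: elements_def sub_graph_def inner_edges_def)
  with pos show ?thesis by (auto simp: positive_weights_def sub_weight_def)
qed

lemma sub_sides:
  "{r} \<subseteq> terminals G'" "B' \<subseteq> terminals G'" "b \<in> B'" "{r} \<inter> B' = {}"
  using r b R b_notin_U by (auto simp: sub_graph_def sub_sinks_def)

text \<open>A path of \<open>G\<close> that avoids \<open>X\<close> cannot leave the component of
  \<open>r\<close>. Its first vertex outside would be a sink, which \<open>X\<close> separates from
  \<open>r\<close>, or a rim vertex, whose edge to \<open>b\<close> has infinite weight and is
  therefore not in \<open>X\<close>, so that \<open>b\<close> would be reached.\<close>

lemma sub_cut_lower:
  assumes cut: "element_cut G' {r} B' X" and fin: "sum w' X \<noteq> \<infinity>"
  shows "element_cut G {r} {b} X" "sum w' X = ereal (sum w X)"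
proof -
  have X: "X \<subseteq> elements G'" using cut by (simp add: element_cut_def)
  have finX: "finite X" using X finite_elements[OF sub_graph_egraph] by (auto intro: finite_subset)
  have no_rim: "x \<notin> Inr ` rim_edges G R Y r b" if "x \<in> X" for x
  proof
    assume "x \<in> Inr ` rim_edges G R Y r b"
    then have "w' x = \<infinity>" by (simp add: sub_weight_def)
    with fin finX that show False by (auto simp: sum_Pinfty)
  qed
  then have "sum w' X = sum (\<lambda>x. ereal (w x)) X"
    by (intro sum.cong) (auto simp: sub_weight_def)
  then show "sum w' X = ereal (sum w X)" by simp
  have "X \<subseteq> elements G"
  proof
    fix x assume x: "x \<in> X"
    with X have "x \<in> elements G'" by blast
    then show "x \<in> elements G"
      using no_rim[OF x] nonterminals_sub_graph by (auto simp: elements_def sub_graph_def inner_edges_def)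
  qed
  moreover have "(r, b) \<notin> (remaining_adj G X)\<^sup>*"
  proof
    assume reach: "(r, b) \<in> (remaining_adj G X)\<^sup>*"
    \<comment> \<open>The two properties support each other: inside the component the edges of
      \<open>G\<close> are available in \<open>G'\<close>, and reachability in \<open>G'\<close>
      excludes every exit.\<close>
    have "b \<in> U r \<inter> (remaining_adj G' X)\<^sup>* `` {r}"
    proof (rule reach_closed[OF reach])
      fix u v assume u: "u \<in> U r \<inter> (remaining_adj G' X)\<^sup>* `` {r}" and uv: "(u, v) \<in> remaining_adj G X"
      then have e: "{u, v} \<in> inner_edges G Y r" "{u, v} \<in> edges G"
        by (auto simp: inner_edges_def remaining_adj_def)
      then have "(u, v) \<in> remaining_adj G' X"
        using uv by (auto simp: remaining_adj_def sub_graph_def)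
      then have v: "(r, v) \<in> (remaining_adj G' X)\<^sup>*"
        using u by auto
      then have "v \<notin> B'" using cut by (auto simp: element_cut_def)
      have "v \<in> U r"
      proof (rule ccontr)
        assume "v \<notin> U r"
        moreover have "v \<in> verts G" using e G by (auto simp: egraph_def)
        ultimately have "v \<in> N0"
          using \<open>v \<notin> B'\<close> by (auto simp: sub_sinks_def free_nonterminals_def nonterminals_def)
        then have "v \<in> rim G R Y r"
          using u e(2) by (auto simp: rim_def)
        then have re: "{v, b} \<in> rim_edges G R Y r b"
          by (auto simp: rim_edges_def)
        then have "Inr {v, b} \<notin> X" using no_rim by blast
        moreover have "Inl v \<notin> X" using uv by (auto simp: remaining_adj_def)
        moreover have "Inl b \<notin> X"
          using X sub_sides by (auto simp: elements_def nonterminals_def)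
        ultimately have "(v, b) \<in> remaining_adj G' X"
          using re by (auto simp: remaining_adj_def sub_graph_def)
        with v have "(r, b) \<in> (remaining_adj G' X)\<^sup>*" by auto
        with cut sub_sides show False by (auto simp: element_cut_def)
      qed
      with v show "v \<in> U r \<inter> (remaining_adj G' X)\<^sup>* `` {r}" by auto
    qed simp
    with b_notin_U show False by simp
  qed
  ultimately show "element_cut G {r} {b} X"
    by (simp add: element_cut_def)
qed

text \<open>A biset avoiding \<open>Y\<close> can be restricted to the component of \<open>r\<close>
  at no cost: within it no element of \<open>Y\<close> is met, so an edge that stays inside never
  leads out of the component.\<close>

lemma sub_cut_upper:
  assumes cut: "min_element_cut G' w' {r} B' X" and ST: "biset G S T" "S \<inter> R = {r}"
  shows "sum w' X \<le> ereal (sum w (boundary G S T))"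
proof -
  obtain S1 T1 where "avoiding G w R {(r, r'). r \<noteq> r'} Y r (sum w (boundary G S T)) S1 T1"
    using iso ST r unfolding isolating_def by blast
  then have 1: "biset G S1 T1" "S1 \<inter> R = {r}"
      "sum w (boundary G S1 T1) \<le> sum w (boundary G S T)"
      "\<And>v. v \<in> S1 \<Longrightarrow> Inl v \<notin> Y" "\<And>e. Inr e \<in> Y \<Longrightarrow> \<not> e \<subseteq> S1"
      "\<And>v r'. v \<in> T1 \<Longrightarrow> r' \<in> R \<Longrightarrow> r \<noteq> r' \<Longrightarrow> (r', v) \<notin> (remaining_adj G Y)\<^sup>*"
    unfolding avoiding_def by blast+
  define S2 where "S2 = S1 \<inter> U r"
  \<comment> \<open>This is smaller than the boundary of (\<open>S2\<close>, \<open>T1\<close>),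
    which would also delete the vertices of \<open>S1\<close> outside the component. Only
    \<open>T1 - S1\<close> is deleted, so that \<open>X2\<close> is part of the boundary of
    (\<open>S1\<close>, \<open>T1\<close>).\<close>
  define X2 where "X2 = Inl ` (T1 - S1) \<union> Inr ` {e \<in> edges G. e \<inter> S2 \<noteq> {} \<and> \<not> e \<subseteq> T1}"
  have T1U: "v \<notin> U r'" if "v \<in> T1" "r' \<in> R" "r' \<noteq> r" for v r'
    using 1(6)[OF that(1,2)] that(3) by (auto simp: comp_of_def)
  have rS: "r \<in> S2" using 1(2) by (auto simp: S2_def)
  have X2_sub: "X2 \<subseteq> boundary G S1 T1" by (auto simp: X2_def S2_def boundary_def)
  have finb: "finite (boundary G S1 T1)"
    using boundary_elements[OF 1(1)] finite_elements[OF G] by (rule finite_subset)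
  have X2_no_rim: "x \<notin> Inr ` rim_edges G R Y r b" if "x \<in> X2" for x
  proof
    assume "x \<in> Inr ` rim_edges G R Y r b"
    then obtain z where z: "x = Inr {z, b}" "z \<in> rim G R Y r" by (auto simp: rim_edges_def)
    with that have "{z, b} \<inter> U r \<noteq> {}" by (auto simp: X2_def S2_def)
    with b_notin_U N0_U[OF r] rim_N0 z(2) show False by auto
  qed
  have "element_cut G' {r} B' X2"
  proof -
    have "X2 \<subseteq> elements G'"
    proof
      fix x assume x: "x \<in> X2"
      then consider v where "x = Inl v" "v \<in> T1 - S1"
        | e where "x = Inr e" "e \<in> edges G" "e \<inter> S2 \<noteq> {}" by (auto simp: X2_def)
      then show "x \<in> elements G'"
      proof cases
        case 1
        then show ?thesis using \<open>biset G S1 T1\<close> T1U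
          by (auto simp: elements_def sub_graph_def nonterminals_def biset_def)
      next
        case 2
        then show ?thesis
          by (auto simp: elements_def sub_graph_def inner_edges_def S2_def)
      qed
    qed
    moreover have "(r, v) \<notin> (remaining_adj G' X2)\<^sup>*" if v: "v \<in> B'" for v
    proof
      assume "(r, v) \<in> (remaining_adj G' X2)\<^sup>*"
      then have "v \<in> S2" using rS
      proof (rule reach_closed)
        fix a c assume a: "a \<in> S2" and ac: "(a, c) \<in> remaining_adj G' X2"
        then have nX: "Inl c \<notin> X2" "Inr {a, c} \<notin> X2" and e': "{a, c} \<in> edges G'"
          by (auto simp: remaining_adj_def)
        have "{a, c} \<notin> rim_edges G R Y r b"
          using a b_notin_U N0_U[OF r] rim_N0[of r] by (auto simp: rim_edges_def S2_def doubleton_eq_iff)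
        with e' have e: "{a, c} \<in> edges G" by (auto simp: sub_graph_def inner_edges_def)
        with nX(2) a have "c \<in> T1" by (auto simp: X2_def S2_def)
        with nX(1) have "c \<in> S1" by (auto simp: X2_def)
        moreover have "a \<in> S1" using a by (simp add: S2_def)
        \<comment> \<open>\<open>Y\<close> contains neither end, as both lie in \<open>S1\<close>,
          nor the edge between them. Hence \<open>c\<close> is in the component of \<open>r\<close>
          as well.\<close>
        ultimately have "(a, c) \<in> remaining_adj G Y"
          using e 1(4)[of a] 1(4)[of c] 1(5)[of "{a, c}"] by (auto simp: remaining_adj_def)
        with a \<open>c \<in> S1\<close> show "c \<in> S2"
          by (auto simp: S2_def comp_of_def)
      qed
      with v show False by (auto simp: S2_def sub_sinks_def)
    qed
    ultimately show ?thesis by (auto simp: element_cut_def)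
  qed
  then have "sum w' X \<le> sum w' X2" using cut by (simp add: min_element_cut_def)
  also have "\<dots> = sum (\<lambda>x. ereal (w x)) X2"
    using X2_no_rim by (intro sum.cong) (auto simp: sub_weight_def)
  also have "\<dots> = ereal (sum w X2)" by simp
  also have "sum w X2 \<le> sum w (boundary G S1 T1)"
    using finb X2_sub boundary_elements[OF 1(1)] pos by (intro sum_mono2) (auto intro: less_imp_le)
  finally show ?thesis using 1(3) by (meson ereal_less_eq(3) order_trans)
qed

text \<open>Each rim vertex is charged to one edge joining it to the component. The charge is
  injective because the rim vertex is the only end of that edge outside the component.\<close>

lemma card_sub_edges: "card (edges G') \<le> card (inner_edges G Y r) + card {e \<in> inner_edges G Y r. e \<inter> N0 \<noteq> {}}"
proof -
  have "finite (rim G R Y r)"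
    using G rim_N0 N0_nonterminals
    by (auto simp: egraph_def nonterminals_def intro: finite_subset[of _ "verts G"])
  have "\<forall>z\<in>rim G R Y r. \<exists>u. u \<in> U r \<and> {u, z} \<in> edges G" by (auto simp: rim_def)
  then obtain f where f: "\<And>z. z \<in> rim G R Y r \<Longrightarrow> f z \<in> U r \<and> {f z, z} \<in> edges G" by metis
  have "inj_on (\<lambda>z. {f z, z}) (rim G R Y r)"
  proof (rule inj_onI)
    fix z z' assume z: "z \<in> rim G R Y r" "z' \<in> rim G R Y r" "{f z, z} = {f z', z'}"
    have "z \<notin> U r" "z' \<notin> U r" using z rim_N0 N0_U[OF r] by auto
    with z f show "z = z'" by (metis doubleton_eq_iff)
  qed
  moreover have "(\<lambda>z. {f z, z}) ` rim G R Y r \<subseteq> {e \<in> inner_edges G Y r. e \<inter> N0 \<noteq> {}}"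
    using f rim_N0 by (auto simp: inner_edges_def)
  moreover have "finite {e \<in> inner_edges G Y r. e \<inter> N0 \<noteq> {}}"
    using finite_edges by (auto simp: inner_edges_def)
  ultimately have "card (rim G R Y r) \<le> card {e \<in> inner_edges G Y r. e \<inter> N0 \<noteq> {}}"
    by (rule card_inj_on_le)
  moreover have "card (rim_edges G R Y r b) \<le> card (rim G R Y r)"
    unfolding rim_edges_def by (rule card_image_le) fact
  ultimately show ?thesis
    using card_Un_le[of "inner_edges G Y r" "rim_edges G R Y r b"] by (simp add: sub_graph_def)
qed

end

text \<open>The components are disjoint from one another and from \<open>N0\<close>. An edge
  avoiding \<open>N0\<close> meets at most two components and counts once in each; an edge meeting
  \<open>N0\<close> meets at most one and counts there twice, for itself and for a rim edge.\<close>

lemma sum_card_sub_edges: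
  assumes b: "\<And>r. r \<in> R \<Longrightarrow> b r \<in> R \<and> b r \<noteq> r"
  shows "(\<Sum>r\<in>R. card (edges (sub_graph G R Y r (b r)))) \<le> 2 * card (edges G)"
proof -
  have "(\<Sum>r\<in>R. card (edges (sub_graph G R Y r (b r))))
      \<le> (\<Sum>r\<in>R. card (inner_edges G Y r) + card {e \<in> inner_edges G Y r. e \<inter> N0 \<noteq> {}})"
    using b by (intro sum_mono card_sub_edges) metis+
  also have "\<dots> = (\<Sum>r\<in>R. \<Sum>e\<in>edges G. of_bool (e \<inter> U r \<noteq> {}) + of_bool (e \<inter> U r \<noteq> {} \<and> e \<inter> N0 \<noteq> {}))"
    using finite_edges
    by (intro sum.cong) (auto simp: sum.distrib inner_edges_def of_bool_def sum.If_cases Int_def conj_ac)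
  also have "\<dots> = (\<Sum>e\<in>edges G. \<Sum>r\<in>R. of_bool (e \<inter> U r \<noteq> {}) + of_bool (e \<inter> U r \<noteq> {} \<and> e \<inter> N0 \<noteq> {}))"
    by (rule sum.swap)
  also have "\<dots> \<le> (\<Sum>e\<in>edges G. 2)"
  proof (rule sum_mono)
    fix e assume "e \<in> edges G"
    then have c2: "card e = 2" using G by (auto simp: egraph_def)
    define H where "H = {r \<in> R. e \<inter> U r \<noteq> {}}"
    have "\<exists>f. \<forall>r\<in>H. f r \<in> e \<inter> U r" by (rule bchoice) (auto simp: H_def)
    then obtain f where f: "\<And>r. r \<in> H \<Longrightarrow> f r \<in> e \<inter> U r" by blast
    have inj: "inj_on f H"
    proof (rule inj_onI)
      fix x y assume "x \<in> H" "y \<in> H" "f x = f y"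
      with f[of x] f[of y] U_disjoint[of x y] show "x = y" by (auto simp: H_def)
    qed
    have fin: "finite e" using c2 by (metis card.infinite zero_neq_numeral)
    have "card H \<le> card (e - N0)"
      using inj f fin N0_U by (intro card_inj_on_le[of f]) (auto simp: H_def)
    moreover have "card (e - N0) < 2" if "e \<inter> N0 \<noteq> {}"
      using psubset_card_mono[OF fin, of "e - N0"] c2 that by auto
    moreover have "card (e - N0) \<le> 2" using card_mono[OF fin, of "e - N0"] c2 by auto
    moreover have "(\<Sum>r\<in>R. of_bool (e \<inter> U r \<noteq> {}) + of_bool (e \<inter> U r \<noteq> {} \<and> e \<inter> N0 \<noteq> {}) :: nat)
        = card H + (if e \<inter> N0 \<noteq> {} then card H else 0)"
      using finite_R by (auto simp: sum.distrib of_bool_def sum.If_cases H_def Int_def)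
    ultimately show "(\<Sum>r\<in>R. of_bool (e \<inter> U r \<noteq> {}) + of_bool (e \<inter> U r \<noteq> {} \<and> e \<inter> N0 \<noteq> {}) :: nat) \<le> 2"
      by (auto split: if_splits)
  qed
  also have "\<dots> = 2 * card (edges G)" by simp
  finally show ?thesis .
qed

end

section \<open>The program\<close>

lemma wp_Seq_frame:
  assumes "wp t1 c1 Q1 s" and "t1 + 1 \<le> t"
    and "\<And>s'. Q1 s' \<Longrightarrow> same (nwr c1) (rwr c1) s s' \<Longrightarrow> wp (t - (t1 + 1)) c2 Q s'"
  shows "wp t (Seq c1 c2) Q s"
  by (rule wp_Seq[OF wp_conseq[OF wp_frame[OF assms(1)]]]) (use assms in auto)

lemma wp_straight_Seq:
  assumes "straight c1" "tm c1 + 1 \<le> t" "wp (t - (tm c1 + 1)) c2 Q (ex c1 s)"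
  shows "wp t (Seq c1 c2) Q s"
  by (rule wp_Seq[OF wp_straight[OF assms(1)]]) (use assms in auto)

lemma wp_post_frame:
  assumes "wp t c Q s" "t \<le> t'" "\<And>s'. Q s' \<Longrightarrow> same (nwr c) (rwr c) s s' \<Longrightarrow> Q' s'"
  shows "wp t' c Q' s"
  by (rule wp_weaken[OF wp_frame[OF assms(1)] assms(2)]) (use assms(3) in auto)

abbreviation seq :: "com \<Rightarrow> com \<Rightarrow> com" (infixr ";;" 60) where
  "c1 ;; c2 \<equiv> Seq c1 c2"

abbreviation onlyif :: "bexp \<Rightarrow> com \<Rightarrow> com" where
  "onlyif b c \<equiv> Cond b c Skip"

abbreviation eqb :: "nexp \<Rightarrow> nexp \<Rightarrow> bexp" where
  "eqb a b \<equiv> BAnd (BNot (NLess a b)) (BNot (NLess b a))"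

abbreviation orb :: "bexp \<Rightarrow> bexp \<Rightarrow> bexp" where
  "orb a b \<equiv> BNot (BAnd (BNot a) (BNot b))"

lemma not_less_antisym [simp]: "\<not> (a::nat) < b \<and> \<not> b < a \<longleftrightarrow> a = b"
  by auto

text \<open>\<open>P\<close> may overwrite its input and any other array below \<open>K\<close>, so the program keeps a copy of the
  graph and all its own data in the arrays from \<open>K\<close> on.\<close>

locale cut_program =
  fixes P :: com and K :: nat
  assumes K7: "7 \<le> K" and nwr_P: "nwr P \<subseteq> {..<K}" and rwr_P: "rwr P \<subseteq> {..<K}"
begin

definition arr :: "nat \<Rightarrow> nat" where
  "arr j = K + j"

lemma arr_eq [simp]: "arr i = arr j \<longleftrightarrow> i = j"
  by (simp add: arr_def)

lemma arr_neq [simp]: "a < 7 \<Longrightarrow> a \<noteq> arr j" "a < 7 \<Longrightarrow> arr j \<noteq> a"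
  using K7 by (auto simp: arr_def)

lemma arr_ge [simp]: "7 \<le> arr j" "\<not> arr j < 7"
  using K7 by (auto simp: arr_def)

lemma arr_notin_P [simp]: "arr j \<notin> nwr P" "arr j \<notin> rwr P"
  using nwr_P rwr_P by (auto simp: arr_def)

abbreviation (input) "vn \<equiv> arr 10"
abbreviation (input) "vm \<equiv> arr 11"
abbreviation (input) "vi \<equiv> arr 12"
abbreviation (input) "vj \<equiv> arr 13"
abbreviation (input) "vL \<equiv> arr 14"
abbreviation (input) "vpw \<equiv> arr 15"
abbreviation (input) "vlev \<equiv> arr 16"
abbreviation (input) "vcnt \<equiv> arr 17"
abbreviation (input) "vtc \<equiv> arr 18"
abbreviation (input) "vtb \<equiv> arr 19"
abbreviation (input) "vfst \<equiv> arr 20"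
abbreviation (input) "vlst \<equiv> arr 21"
abbreviation (input) "vem \<equiv> arr 22"
abbreviation (input) "vr \<equiv> arr 23"
abbreviation (input) "vta \<equiv> arr 24"
abbreviation (input) "vb \<equiv> arr 25"
abbreviation (input) "vk \<equiv> arr 26"
abbreviation (input) "vrnd \<equiv> arr 27"
abbreviation (input) "vLL \<equiv> arr 28"
abbreviation (input) "aT \<equiv> arr 40"
abbreviation (input) "aH \<equiv> arr 41"
abbreviation (input) "aTm \<equiv> arr 42"
abbreviation (input) "aR \<equiv> arr 43"
abbreviation (input) "aLev \<equiv> arr 44"
abbreviation (input) "aS \<equiv> arr 45"
abbreviation (input) "aLab \<equiv> arr 46"
abbreviation (input) "aYv \<equiv> arr 47"
abbreviation (input) "aYe \<equiv> arr 48"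
abbreviation (input) "aC \<equiv> arr 49"
abbreviation (input) "aZ \<equiv> arr 50"
abbreviation (input) "aOwn \<equiv> arr 51"
abbreviation (input) "aST \<equiv> arr 52"
abbreviation (input) "aSH \<equiv> arr 53"
abbreviation (input) "aSTm \<equiv> arr 54"
abbreviation (input) "aSLab \<equiv> arr 55"
abbreviation (input) "aNb \<equiv> arr 56"
abbreviation (input) "aRow \<equiv> arr 57"
abbreviation (input) "rE \<equiv> arr 60"
abbreviation (input) "rV \<equiv> arr 61"
abbreviation (input) "rM \<equiv> arr 62"
abbreviation (input) "rW \<equiv> arr 63"
abbreviation (input) "rS \<equiv> arr 64"
abbreviation (input) "rVal \<equiv> arr 65"
abbreviation (input) "rBest \<equiv> arr 66"

abbreviation (input) "N0 \<equiv> NConst 0"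
abbreviation (input) "N1 \<equiv> NConst 1"
abbreviation (input) "cell a x \<equiv> NCell a (var x)"
abbreviation (input) "rcell a x \<equiv> RCell a (var x)"
abbreviation (input) "setr a e \<equiv> RAssign a N0 e"
abbreviation (input) "rvar a \<equiv> RCell a N0"

definition load :: "nat \<Rightarrow> nat \<Rightarrow> nat \<Rightarrow> nat \<Rightarrow> nat \<Rightarrow> nat \<Rightarrow> com" where
  "load tA hA wA mA trA lbA =
     NAssign aSize N0 (var vn) ;;
     NAssign aSize N1 (var mA) ;;
     For vi mA
       (NAssign aTail (var vi) (cell tA vi) ;;
        NAssign aHead (var vi) (cell hA vi) ;;
        RAssign aEdgeWeight (var vi) (rcell wA vi)) ;;
     For vi vn
       (NAssign aTerminal (var vi) (cell trA vi) ;;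
        NAssign aLabel (var vi) (cell lbA vi) ;;
        RAssign aVertexWeight (var vi) (rcell rV vi))"

lemma nwr_load [simp]: "nwr (load tA hA wA mA trA lbA) = {0, 1, 2, 3, 4, vi}"
  and rwr_load [simp]: "rwr (load tA hA wA mA trA lbA) = {0, 1}"
  by (auto simp: load_def)

lemma load_spec:
  assumes names: "7 \<le> tA" "7 \<le> hA" "7 \<le> wA" "7 \<le> mA" "7 \<le> trA" "7 \<le> lbA"
      "vi \<notin> {tA, hA, mA, trA, lbA}"
    and n: "nmem s vn 0 = n" and m: "nmem s mA 0 = m"
  shows "wp (9 * m + 9 * n + 11) (load tA hA wA mA trA lbA)
    (\<lambda>s'. nmem s' aSize 0 = n \<and> nmem s' aSize 1 = m \<and>
      (\<forall>i<m. nmem s' aTail i = nmem s tA i \<and> nmem s' aHead i = nmem s hA i \<and> rmem s' aEdgeWeight i = rmem s wA i) \<and>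
      (\<forall>v<n. nmem s' aTerminal v = nmem s trA v \<and> nmem s' aLabel v = nmem s lbA v \<and> rmem s' aVertexWeight v = rmem s rV v)) s"
    (is "wp _ _ ?Q s")
  unfolding load_def
proof (rule wp_straight_Seq, simp, simp, rule wp_straight_Seq, simp, simp)
  have ne: "a \<noteq> tA" "a \<noteq> hA" "a \<noteq> wA" "a \<noteq> mA" "a \<noteq> trA" "a \<noteq> lbA" if "a < 7" for a
    using names that by auto
  let ?c1 = "NAssign 1 (var vi) (cell tA vi) ;; NAssign 2 (var vi) (cell hA vi) ;; RAssign 1 (var vi) (rcell wA vi)"
  let ?c2 = "NAssign 3 (var vi) (cell trA vi) ;; NAssign 4 (var vi) (cell lbA vi) ;; RAssign 0 (var vi) (rcell rV vi)"
  let ?I1 = "\<lambda>i s'. \<forall>j<i. nmem s' 1 j = nmem s tA j \<and> nmem s' 2 j = nmem s hA j \<and> rmem s' 1 j = rmem s wA j"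
  let ?I2 = "\<lambda>i s'. \<forall>j<i. nmem s' 3 j = nmem s trA j \<and> nmem s' 4 j = nmem s lbA j \<and> rmem s' 0 j = rmem s rV j"
  define s0 where "s0 = ex (NAssign 0 N1 (var mA)) (ex (NAssign 0 N0 (var vn)) s)"
  have s0: "s0 = nwrite 0 1 m (nwrite 0 0 n s)"
    using n m ne by (simp add: s0_def)
  have s0_mem [simp]: "a \<noteq> 0 \<Longrightarrow> nmem s0 a = nmem s a" "rmem s0 = rmem s" for a
    by (simp_all add: s0)
  have "wp (9 * m + 9 * n + 7) (For vi mA ?c1 ;; For vi vn ?c2) ?Q s0"
  proof (rule wp_Seq_frame)
    show "wp (m * 9 + 3) (For vi mA ?c1) (?I1 m) s0"
    proof (rule wp_For_straight[where I = ?I1 and N = m])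
      fix i s' assume i: "i < m" "nmem s' vi 0 = i" and sm: "same (insert vi (nwr ?c1)) (rwr ?c1) s0 s'" and I: "?I1 i s'"
      have "nmem s' tA = nmem s tA" "nmem s' hA = nmem s hA" "rmem s' wA = rmem s wA"
        using names ne[of 0] ne[of 1] ne[of 2] by (auto simp: same_nmem[OF sm] same_rmem[OF sm])
      then show "?I1 (Suc i) (ex ?c1 s')"
        using i I names ne[of 1] ne[of 2] by (auto simp: less_Suc_eq)
    qed (use names m ne[of 0] ne[of 1] ne[of 2] in auto)
  next
    fix s1 assume I1: "?I1 m s1" and "same (nwr (For vi mA ?c1)) (rwr (For vi mA ?c1)) s0 s1"
    then have sm: "same {1, 2, vi} {1} s0 s1"
      by (simp add: insert_commute)
    have sz: "nmem s1 0 0 = n" "nmem s1 0 1 = m" "nmem s1 vn 0 = n"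
      using n by (simp_all add: same_nmem[OF sm] s0)
    show "wp (9 * m + 9 * n + 7 - (m * 9 + 3 + 1)) (For vi vn ?c2) ?Q s1"
    proof (rule wp_post_frame)
      show "wp (n * 9 + 3) (For vi vn ?c2) (?I2 n) s1"
      proof (rule wp_For_straight[where I = ?I2 and N = n])
        fix i s' assume i: "i < n" "nmem s' vi 0 = i" and sm': "same (insert vi (nwr ?c2)) (rwr ?c2) s1 s'" and I: "?I2 i s'"
        have "nmem s' trA = nmem s trA" "nmem s' lbA = nmem s lbA" "rmem s' rV = rmem s rV"
          using names ne[of 0] ne[of 1] ne[of 2] ne[of 3] ne[of 4]
          by (auto simp: same_nmem[OF sm] same_rmem[OF sm] same_nmem[OF sm'] same_rmem[OF sm'])
        then show "?I2 (Suc i) (ex ?c2 s')"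
          using i I names ne[of 3] ne[of 4] by (auto simp: less_Suc_eq)
      qed (use sz in auto)
    next
      fix s' assume h: "?I2 n s'" and sm': "same (nwr (For vi vn ?c2)) (rwr (For vi vn ?c2)) s1 s'"
      show "?Q s'"
        using sz I1 h by (simp add: same_nmem[OF sm'] same_rmem[OF sm'])
    qed simp
  qed simp
  then show "wp (9 * m + 9 * n + 11 - (tm (NAssign 0 N0 (var vn)) + 1) - (tm (NAssign 0 N1 (var mA)) + 1))
      (For vi mA ?c1 ;; For vi vn ?c2) ?Q (ex (NAssign 0 N1 (var mA)) (ex (NAssign 0 N0 (var vn)) s))"
    unfolding s0_def by (rule wp_time_mono) simp
qed

definition call_cut :: "nat \<Rightarrow> nat \<Rightarrow> nat \<Rightarrow> nat \<Rightarrow> nat \<Rightarrow> nat \<Rightarrow> com" where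
  "call_cut tA hA wA mA trA lbA = load tA hA wA mA trA lbA ;; P"

lemma nwr_call_cut [simp]: "nwr (call_cut tA hA wA mA trA lbA) = {0, 1, 2, 3, 4, vi} \<union> nwr P"
  and rwr_call_cut [simp]: "rwr (call_cut tA hA wA mA trA lbA) = {0, 1} \<union> rwr P"
  by (auto simp: call_cut_def)

text \<open>The cut is described through the arrays from which the instance was loaded, in their
  state before the call, because \<open>P\<close> may destroy its own input arrays.\<close>

lemma call_cut_spec:
  fixes G' :: "nat egraph"
  assumes solver: "element_cut_solver P Tec"
    and G': "egraph G'" "positive_weights G' w'" "A \<subseteq> terminals G'" "B \<subseteq> terminals G'" "A \<noteq> {}" "B \<noteq> {}" "A \<inter> B = {}"
    and V: "verts G' = {..<n}"
    and names: "7 \<le> tA" "7 \<le> hA" "7 \<le> wA" "7 \<le> mA" "7 \<le> trA" "7 \<le> lbA"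
      "vi \<notin> {tA, hA, mA, trA, lbA}"
    and n: "nmem s vn 0 = n" and m: "nmem s mA 0 = m" "m = card (edges G')"
    and E: "edges G' = (\<lambda>i. {nmem s tA i, nmem s hA i}) ` {..<m}"
    and wE: "\<And>i. i < m \<Longrightarrow> rmem s wA i = w' (Inr {nmem s tA i, nmem s hA i})"
    and T: "\<And>v. v < n \<Longrightarrow> nmem s trA v = of_bool (v \<in> terminals G')"
    and L: "\<And>v. v < n \<Longrightarrow> nmem s lbA v = (if v \<in> A then 1 else if v \<in> B then 2 else 0)"
    and wV: "\<And>v. v \<in> nonterminals G' \<Longrightarrow> rmem s rV v = w' (Inl v)"
  shows "wp (Tec m n + 9 * m + 9 * n + 12) (call_cut tA hA wA mA trA lbA)
    (\<lambda>s'. \<exists>X. min_element_cut G' w' A B X \<and>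
      (\<forall>v<n. nmem s' aCutVertex v = of_bool (Inl v \<in> X)) \<and>
      (\<forall>i<m. nmem s' aCutEdge i = of_bool (Inr {nmem s tA i, nmem s hA i} \<in> X))) s"
  unfolding call_cut_def
proof (rule wp_Seq_frame[OF load_spec[OF names n m(1)]])
  fix s1 :: state
  assume s1: "nmem s1 0 0 = n \<and> nmem s1 0 1 = m \<and>
      (\<forall>i<m. nmem s1 aTail i = nmem s tA i \<and> nmem s1 aHead i = nmem s hA i \<and> rmem s1 aEdgeWeight i = rmem s wA i) \<and>
      (\<forall>v<n. nmem s1 aTerminal v = nmem s trA v \<and> nmem s1 aLabel v = nmem s lbA v \<and> rmem s1 aVertexWeight v = rmem s rV v)"
  have ed: "edge_at s1 i = {nmem s tA i, nmem s hA i}" if "i < m" for i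
    using s1 that by (simp add: edge_at_def)
  have cE: "card (edges G') = m" and cV: "card (verts G') = n"
    using m(2) V by simp_all
  have E': "edges G' = edge_at s1 ` {..<m}"
    using ed E by auto
  have "graph_input G' w' s1"
    unfolding graph_input_def cE cV
  proof (intro conjI ballI allI impI)
    show "nmem s1 aTerminal v = of_bool (v \<in> terminals G')" if "v \<in> verts G'" for v
      using that V T s1 by simp
    show "rmem s1 aVertexWeight v = w' (Inl v)" if "v \<in> nonterminals G'" for v
      using that V wV s1 by (simp add: nonterminals_def)
    show "rmem s1 aEdgeWeight i = w' (Inr (edge_at s1 i))" if "i < m" for i
      using that wE s1 ed by simp
  qed (use s1 V E' in blast)+
  moreover have "sides_input G' A B s1"
    unfolding sides_input_def using s1 V L by auto
  ultimately have "wp (Tec (card (edges G')) (card (verts G'))) P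
      (\<lambda>s'. \<exists>X. min_element_cut G' w' A B X \<and> cut_output G' X s1 s') s1"
    unfolding wp_def using G'
    by (intro solver[unfolded element_cut_solver_def, THEN spec[of _ G'], THEN spec[of _ w'],
          THEN spec[of _ A], THEN spec[of _ B], THEN spec[of _ s1], THEN mp]) blast
  then have "wp (Tec m n) P (\<lambda>s'. \<exists>X. min_element_cut G' w' A B X \<and> cut_output G' X s1 s') s1"
    unfolding cE cV .
  then show "wp (Tec m n + 9 * m + 9 * n + 12 - (9 * m + 9 * n + 11 + 1)) P
    (\<lambda>s'. \<exists>X. min_element_cut G' w' A B X \<and>
      (\<forall>v<n. nmem s' aCutVertex v = of_bool (Inl v \<in> X)) \<and>
      (\<forall>i<m. nmem s' aCutEdge i = of_bool (Inr {nmem s tA i, nmem s hA i} \<in> X))) s1"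
    by (rule wp_weaken) (use ed V cE in \<open>auto simp: cut_output_def\<close>)
qed simp

end

text \<open>Ranks rather than vertex numbers are written in binary: about log k bits then
  distinguish all sampled terminals, where vertex numbers would need about log n.\<close>

definition rank :: "nat set \<Rightarrow> nat \<Rightarrow> nat" where
  "rank S v = card {u \<in> S. u < v}"

lemma rank_Suc: "rank S (Suc v) = rank S v + of_bool (v \<in> S)"
proof -
  have "{u \<in> S. u < Suc v} = (if v \<in> S then insert v {u \<in> S. u < v} else {u \<in> S. u < v})"
    by (auto simp: less_Suc_eq)
  then show ?thesis by (simp add: rank_def)
qed

lemma rank_0 [simp]: "rank S 0 = 0"
  by (simp add: rank_def)

lemma rank_less: "finite S \<Longrightarrow> v \<in> S \<Longrightarrow> rank S v < card S"
  unfolding rank_def by (intro psubset_card_mono) auto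

lemma rank_strict: "u < v \<Longrightarrow> u \<in> S \<Longrightarrow> rank S u < rank S v"
  unfolding rank_def by (intro psubset_card_mono) auto

lemma rank_eq_iff: "u \<in> S \<Longrightarrow> v \<in> S \<Longrightarrow> rank S u = rank S v \<longleftrightarrow> u = v"
  using rank_strict[of u v S] rank_strict[of v u S] by (cases u v rule: linorder_cases) auto

text \<open>Every rank below the size occurs, which provides members on both sides of each bit and
  so keeps the solver's sides nonempty.\<close>

lemma rank_surj:
  assumes "finite S" "c < card S"
  obtains v where "v \<in> S" "rank S v = c"
proof -
  have "rank S ` S \<subseteq> {..<card S}" using rank_less[OF assms(1)] by auto
  moreover have "card (rank S ` S) = card S"
    by (rule card_image) (auto simp: inj_on_def rank_eq_iff)
  ultimately have "rank S ` S = {..<card S}"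
    by (intro card_subset_eq) auto
  with assms(2) that show ?thesis by (metis imageE lessThan_iff)
qed

definition bit :: "nat set \<Rightarrow> nat \<Rightarrow> nat \<Rightarrow> nat" where
  "bit S p v = (rank S v div p) mod 2"

text \<open>For \<open>p\<close> a power of two, these are the pairs distinguished by the bits below
  \<open>p\<close>, hence separated by the rounds completed so far.\<close>

definition differ :: "nat set \<Rightarrow> nat \<Rightarrow> (nat \<times> nat) set" where
  "differ S p = {(u, v). rank S u mod p \<noteq> rank S v mod p}"

lemma differ_double:
  "differ S (p + p) \<subseteq> differ S p \<union> {(u, v). bit S p u \<noteq> bit S p v}"
proof -
  have "x mod (p + p) = p * (x div p mod 2) + x mod p" for x
    using mod_mult2_eq[of x p 2] by (simp add: mult_2_right)
  then show ?thesis by (auto simp: differ_def bit_def)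
qed

text \<open>Giving the label of \<open>b\<close> to the whole class of \<open>a\<close> merges
  precisely these two classes, which is the effect of a new edge between \<open>a\<close> and
  \<open>b\<close>.\<close>

lemma relabel_connected:
  fixes c :: "nat \<Rightarrow> nat"
  assumes c: "\<And>u v. u < n \<Longrightarrow> v < n \<Longrightarrow> c u = c v \<longleftrightarrow> (u, v) \<in> r\<^sup>*"
    and r: "r \<subseteq> {..<n} \<times> {..<n}" and a: "a < n" "b < n"
    and u: "u < n" "v < n"
  shows "(if c u = c a then c b else c u) = (if c v = c a then c b else c v)
    \<longleftrightarrow> (u, v) \<in> (insert (a, b) (insert (b, a) r))\<^sup>*" (is "?c u = ?c v \<longleftrightarrow> (u, v) \<in> ?r\<^sup>*")
proof
  have sub: "(x, y) \<in> r\<^sup>* \<Longrightarrow> (x, y) \<in> ?r\<^sup>*" for x y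
    using rtrancl_mono[of r ?r] by blast
  have ab: "(a, b) \<in> ?r\<^sup>*" "(b, a) \<in> ?r\<^sup>*" by auto
  have path: "(x, y) \<in> ?r\<^sup>*" if "c x = c a" "c y = c b" "x < n" "y < n" for x y
  proof -
    have "(x, a) \<in> ?r\<^sup>*" "(b, y) \<in> ?r\<^sup>*" using c[of x a] c[of b y] that a sub by auto
    with ab show ?thesis by (meson rtrancl_trans)
  qed
  have path': "(x, y) \<in> ?r\<^sup>*" if "c x = c b" "c y = c a" "x < n" "y < n" for x y
  proof -
    have "(x, b) \<in> ?r\<^sup>*" "(a, y) \<in> ?r\<^sup>*" using c[of x b] c[of a y] that a sub by auto
    with ab show ?thesis by (meson rtrancl_trans)
  qed
  assume "?c u = ?c v"
  then consider "c u = c v" | "c u = c a" "c v = c b" | "c u = c b" "c v = c a"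
    by (auto split: if_splits)
  then show "(u, v) \<in> ?r\<^sup>*"
    by cases (use c[OF u] sub path path' u in auto)
next
  assume "(u, v) \<in> ?r\<^sup>*"
  then show "?c u = ?c v"
  proof (induction)
    case (step y z)
    show ?case
    proof (cases "(y, z) \<in> r")
      case True
      with r have "y < n" "z < n" by auto
      with c[of y z] True have "c y = c z" by auto
      with step show ?thesis by simp
    next
      case False
      with step have "y = a \<and> z = b \<or> y = b \<and> z = a" by auto
      with step show ?thesis by auto
    qed
  qed simp
qed

text \<open>The setting after capping: all weights are real. \<open>te\<close> and \<open>he\<close>
  fix the order and orientation of the edge list, and \<open>L\<close> bounds both the rounds for a
  sample and the highest level.\<close>

locale graph_data = cut_program P K for P K +
  fixes Tec :: "nat \<Rightarrow> nat \<Rightarrow> nat" and G :: "nat egraph" and n m :: nat and te he :: "nat \<Rightarrow> nat"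
    and wr :: "nat element \<Rightarrow> real" and R :: "nat set" and L :: nat
  assumes solver: "element_cut_solver P Tec"
    and G: "egraph G" and V: "verts G = {..<n}" and cE: "card (edges G) = m"
    and E: "edges G = (\<lambda>i. {te i, he i}) ` {..<m}"
    and pos: "\<And>x. x \<in> elements G \<Longrightarrow> 0 < wr x"
    and R: "R \<subseteq> terminals G" and L: "card R \<le> 2 ^ L"
begin

abbreviation "ed i \<equiv> {te i, he i}"

lemma T_n: "v \<in> terminals G \<Longrightarrow> v < n"
  using G V by (auto simp: egraph_def)

lemma R_n: "v \<in> R \<Longrightarrow> v < n"
  using R T_n by auto

lemma finite_R: "finite R"
  using R_n by (auto intro: finite_subset[of _ "{..<n}"])

lemma ed_edges: "i < m \<Longrightarrow> ed i \<in> edges G"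
  using E by auto

lemma ed_n: "i < m \<Longrightarrow> te i < n" "i < m \<Longrightarrow> he i < n"
proof -
  assume "i < m"
  from ed_edges[OF this] have "ed i \<subseteq> {..<n}"
    using G unfolding egraph_def V by blast
  then show "te i < n" "he i < n" by auto
qed

text \<open>The machine cannot multiply integers, so the row offsets \<open>v * n\<close> of the
  adjacency matrix \<open>rW\<close> are tabulated. Entry 0 stands for a missing edge; this is
  unambiguous because weights are positive.\<close>

definition base :: "state \<Rightarrow> bool" where
  "base s \<longleftrightarrow> nmem s vn 0 = n \<and> nmem s vm 0 = m \<and> nmem s vL 0 = L \<and>
     (\<forall>i<m. nmem s aT i = te i \<and> nmem s aH i = he i \<and> rmem s rE i = ereal (wr (Inr (ed i)))) \<and>
     (\<forall>v<n. nmem s aTm v = of_bool (v \<in> terminals G) \<and> nmem s aR v = of_bool (v \<in> R) \<and> nmem s aRow v = v * n) \<and>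
     (\<forall>v\<in>nonterminals G. rmem s rV v = ereal (wr (Inl v))) \<and>
     (\<forall>u<n. \<forall>v<n. rmem s rW (u * n + v) = (if {u, v} \<in> edges G then ereal (wr (Inr {u, v})) else 0))"

lemma base_same:
  assumes "base s" "same X Y s s'" "X \<inter> {vn, vm, vL, aT, aH, aTm, aR, aRow} = {}" "Y \<inter> {rE, rV, rW} = {}"
  shows "base s'"
proof -
  have "nmem s' a = nmem s a" if "a \<in> {vn, vm, vL, aT, aH, aTm, aR, aRow}" for a
    using assms that by (intro same_nmem[OF assms(2)]) auto
  moreover have "rmem s' a = rmem s a" if "a \<in> {rE, rV, rW}" for a
    using assms that by (intro same_rmem[OF assms(2)]) auto
  ultimately show ?thesis
    using assms(1) unfolding base_def by simp
qed

definition Srep :: "nat set \<Rightarrow> state \<Rightarrow> bool" where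
  "Srep S s \<longleftrightarrow> nmem s vcnt 0 = card S \<and> (\<forall>v<n. nmem s aS v = of_bool (v \<in> S))"

definition Yrep :: "nat element set \<Rightarrow> state \<Rightarrow> bool" where
  "Yrep Y s \<longleftrightarrow> (\<forall>v<n. nmem s aYv v = of_bool (Inl v \<in> Y)) \<and> (\<forall>i<m. nmem s aYe i = of_bool (Inr (ed i) \<in> Y))"

end

section \<open>Code for the separating rounds, the components and their owners\<close>

context cut_program
begin

text \<open>The first and the last sampled terminal are remembered: at least one of them differs
  from any given \<open>r\<close> and can serve as the terminal \<open>b\<close> of its small
  instance.\<close>

definition select :: com where
  "select = setv vcnt N0 ;;
     For vi vn
       (Cond (BAnd (eqb (cell aR vi) N1) (BNot (NLess (cell aLev vi) (var vlev))))
          (NAssign aS (var vi) N1 ;;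
           onlyif (NLess (var vcnt) N1) (setv vfst (var vi)) ;;
           setv vlst (var vi) ;;
           setv vcnt (NAdd (var vcnt) N1))
          (NAssign aS (var vi) N0))"

definition label :: com where
  "label = setv vtc N0 ;; setv vtb (NConst 2) ;;
     For vi vn
       (Cond (eqb (cell aS vi) N1)
          (NAssign aLab (var vi) (var vtb) ;;
           setv vtc (NAdd (var vtc) N1) ;;
           onlyif (eqb (var vtc) (var vpw)) (setv vtc N0 ;; setv vtb (NSub (NConst 3) (var vtb))))
          (NAssign aLab (var vi) N0))"

definition merge :: com where
  "merge = For vi vn (onlyif (eqb (NCell aCutVertex (var vi)) N1) (NAssign aYv (var vi) N1)) ;;
     For vi vm (onlyif (eqb (NCell aCutEdge (var vi)) N1) (NAssign aYe (var vi) N1))"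

definition round :: com where
  "round = label ;; call_cut aT aH rE vm aTm aLab ;; merge ;; setv vpw (NAdd (var vpw) (var vpw))"

text \<open>The guard stops the solver calls once \<open>p\<close> reaches the sample size, when all
  remaining bits are 0 and one side would be empty.\<close>

definition rounds :: com where
  "rounds = For vi vn (NAssign aYv (var vi) N0) ;; For vi vm (NAssign aYe (var vi) N0) ;;
     setv vpw N1 ;;
     For vrnd vL (onlyif (NLess (var vpw) (var vcnt)) round)"

definition components :: com where
  "components = For vi vn (NAssign aC (var vi) (var vi)) ;;
     For vi vm
       (onlyif
          (BAnd (NLess (cell aYe vi) N1)
            (BAnd (NLess (NCell aYv (cell aT vi)) N1)
              (BAnd (NLess (NCell aYv (cell aH vi)) N1)
                (BNot (eqb (NCell aC (cell aT vi)) (NCell aC (cell aH vi)))))))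
          (setv vta (NCell aC (cell aT vi)) ;;
           setv vtb (NCell aC (cell aH vi)) ;;
           For vj vn (onlyif (eqb (cell aC vj) (var vta)) (NAssign aC (var vj) (var vtb)))))"

text \<open>\<open>aZ\<close> maps a component label to its sampled terminal plus one, leaving 0 for
  a component without owner.\<close>

definition owners :: com where
  "owners = For vi vn (NAssign aZ (var vi) N0) ;;
     For vi vn (onlyif (eqb (cell aS vi) N1) (NAssign aZ (cell aC vi) (NAdd (var vi) N1))) ;;
     For vi vn (NAssign aOwn (var vi) (NCell aZ (cell aC vi)))"

lemma frame_select [simp]: "nwr select = {vcnt, vi, aS, vfst, vlst}" "rwr select = {}"
  and frame_label [simp]: "nwr label = {vtc, vtb, vi, aLab}" "rwr label = {}"
  and frame_merge [simp]: "nwr merge = {vi, aYv, aYe}" "rwr merge = {}"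
  by (auto simp: select_def label_def merge_def)

lemma frame_round [simp]:
  "nwr round = {vtc, vtb, vi, aLab, 0, 1, 2, 3, 4, aYv, aYe, vpw} \<union> nwr P" "rwr round = {0, 1} \<union> rwr P"
  by (auto simp: round_def)

lemma frame_rounds [simp]:
  "nwr rounds = {vtc, vtb, vi, aLab, 0, 1, 2, 3, 4, aYv, aYe, vpw, vrnd} \<union> nwr P" "rwr rounds = {0, 1} \<union> rwr P"
  by (auto simp: rounds_def)

lemma frame_components [simp]: "nwr components = {vi, aC, vta, vtb, vj}" "rwr components = {}"
  and frame_owners [simp]: "nwr owners = {vi, aZ, aOwn}" "rwr owners = {}"
  by (auto simp: components_def owners_def)

end

context graph_data
begin

lemma select_spec:
  assumes s: "base s" and lev: "\<And>v. v < n \<Longrightarrow> nmem s aLev v = lev v" and l: "nmem s vlev 0 = l"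
  defines "S \<equiv> {v \<in> R. l \<le> lev v}"
  shows "wp (n * 14 + 5) select (\<lambda>s'. Srep S s' \<and> (2 \<le> card S \<longrightarrow>
     nmem s' vfst 0 \<in> S \<and> nmem s' vlst 0 \<in> S \<and> nmem s' vfst 0 \<noteq> nmem s' vlst 0)) s"
  unfolding select_def
proof (rule wp_straight_Seq)
  let ?b = "Cond (BAnd (eqb (cell aR vi) N1) (BNot (NLess (cell aLev vi) (var vlev))))
          (NAssign aS (var vi) N1 ;; onlyif (NLess (var vcnt) N1) (setv vfst (var vi)) ;;
           setv vlst (var vi) ;; setv vcnt (NAdd (var vcnt) N1))
          (NAssign aS (var vi) N0)"
  let ?I = "\<lambda>i s'. nmem s' vcnt 0 = rank S i \<and> (\<forall>v<i. nmem s' aS v = of_bool (v \<in> S)) \<and>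
     (1 \<le> rank S i \<longrightarrow> nmem s' vfst 0 \<in> S \<and> nmem s' vlst 0 \<in> S \<and> nmem s' vfst 0 < i) \<and>
     (2 \<le> rank S i \<longrightarrow> nmem s' vfst 0 \<noteq> nmem s' vlst 0)"
  have S_n: "{u \<in> S. u < n} = S" using R_n by (auto simp: S_def)
  show "wp (n * 14 + 5 - (tm (setv vcnt N0) + 1)) (For vi vn ?b) (\<lambda>s'. Srep S s' \<and> (2 \<le> card S \<longrightarrow>
     nmem s' vfst 0 \<in> S \<and> nmem s' vlst 0 \<in> S \<and> nmem s' vfst 0 \<noteq> nmem s' vlst 0)) (ex (setv vcnt N0) s)"
  proof (rule wp_conseq)
    show "wp (n * 14 + 5 - (tm (setv vcnt N0) + 1)) (For vi vn ?b) (?I n) (ex (setv vcnt N0) s)"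
    proof (rule wp_For_straight[where I = ?I and N = n])
      fix i s' assume i: "i < n" "nmem s' vi 0 = i" and sm: "same (insert vi (nwr ?b)) (rwr ?b) (ex (setv vcnt N0) s) s'"
        and I: "?I i s'"
      have "nmem s' aR i = of_bool (i \<in> R)" "nmem s' aLev i = lev i" "nmem s' vlev 0 = l"
        using s i lev l by (simp_all add: same_nmem[OF sm] base_def)
      then show "?I (Suc i) (ex ?b s')"
        using i I by (auto simp: less_Suc_eq rank_Suc S_def)
    qed (use s in \<open>auto simp: base_def\<close>)
  qed (use S_n in \<open>auto simp: Srep_def rank_def\<close>)
qed auto

lemma label_spec:
  assumes s: "base s" "Srep S s" "nmem s vpw 0 = p" and p: "0 < p"
  shows "wp (n * 15 + 10) label
    (\<lambda>s'. \<forall>v<n. nmem s' aLab v = (if v \<in> S then (if bit S p v = 1 then 1 else 2) else 0)) s"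
  unfolding label_def
proof (rule wp_straight_Seq, simp, simp, rule wp_straight_Seq, simp, simp)
  let ?b = "Cond (eqb (cell aS vi) N1)
          (NAssign aLab (var vi) (var vtb) ;; setv vtc (NAdd (var vtc) N1) ;;
           onlyif (eqb (var vtc) (var vpw)) (setv vtc N0 ;; setv vtb (NSub (NConst 3) (var vtb))))
          (NAssign aLab (var vi) N0)"
  let ?I = "\<lambda>i s'. nmem s' vtc 0 = rank S i mod p \<and> nmem s' vtb 0 = (if bit S p i = 1 then 1 else 2) \<and>
     (\<forall>v<i. nmem s' aLab v = (if v \<in> S then (if bit S p v = 1 then 1 else 2) else 0))"
  define s0 where "s0 = ex (setv vtb (NConst 2)) (ex (setv vtc N0) s)"
  have "wp (n * 15 + 6) (For vi vn ?b) (?I n) s0"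
  proof (rule wp_For_straight[where I = ?I and N = n])
    fix i s' assume i: "i < n" "nmem s' vi 0 = i" and sm: "same (insert vi (nwr ?b)) (rwr ?b) s0 s'"
      and I: "?I i s'"
    have "nmem s' aS i = of_bool (i \<in> S)" "nmem s' vpw 0 = p"
      using s i by (simp_all add: same_nmem[OF sm] s0_def Srep_def)
    then show "?I (Suc i) (ex ?b s')"
      using i I p by (auto simp: less_Suc_eq rank_Suc bit_def mod_Suc div_Suc mod2_eq_if)
  qed (use s in \<open>auto simp: base_def s0_def bit_def\<close>)
  then show "wp (n * 15 + 10 - (tm (setv vtc N0) + 1) - (tm (setv vtb (NConst 2)) + 1)) (For vi vn ?b)
      (\<lambda>s'. \<forall>v<n. nmem s' aLab v = (if v \<in> S then (if bit S p v = 1 then 1 else 2) else 0))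
      (ex (setv vtb (NConst 2)) (ex (setv vtc N0) s))"
    unfolding s0_def by (rule wp_weaken) auto
qed

lemma merge_spec:
  assumes s: "base s" "Yrep Y s" "\<And>v. v < n \<Longrightarrow> nmem s aCutVertex v = of_bool (Inl v \<in> X)"
    "\<And>i. i < m \<Longrightarrow> nmem s aCutEdge i = of_bool (Inr (ed i) \<in> X)"
  shows "wp (n * 6 + m * 6 + 7) merge (Yrep (Y \<union> X)) s"
  unfolding merge_def
proof (rule wp_Seq_frame)
  let ?b1 = "onlyif (eqb (NCell aCutVertex (var vi)) N1) (NAssign aYv (var vi) N1)"
  let ?b2 = "onlyif (eqb (NCell aCutEdge (var vi)) N1) (NAssign aYe (var vi) N1)"
  let ?I1 = "\<lambda>i s'. \<forall>v<n. nmem s' aYv v = of_bool (Inl v \<in> Y \<or> v < i \<and> Inl v \<in> X)"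
  let ?I2 = "\<lambda>i s'. \<forall>j<m. nmem s' aYe j = of_bool (Inr (ed j) \<in> Y \<or> j < i \<and> Inr (ed j) \<in> X)"
  show "wp (n * 6 + 3) (For vi vn ?b1) (?I1 n) s"
  proof (rule wp_For_straight[where I = ?I1 and N = n])
    fix i s' assume i: "i < n" "nmem s' vi 0 = i" and sm: "same (insert vi (nwr ?b1)) (rwr ?b1) s s'"
      and I: "?I1 i s'"
    have "nmem s' 5 i = of_bool (Inl i \<in> X)"
      using s i by (simp add: same_nmem[OF sm])
    then show "?I1 (Suc i) (ex ?b1 s')"
      using i I by (auto simp: less_Suc_eq)
  qed (use s in \<open>auto simp: base_def Yrep_def\<close>)
  fix s1 assume I1: "?I1 n s1" and "same (nwr (For vi vn ?b1)) (rwr (For vi vn ?b1)) s s1"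
  then have sm1: "same {vi, aYv} {} s s1" by simp
  show "wp (n * 6 + m * 6 + 7 - (n * 6 + 3 + 1)) (For vi vm ?b2) (Yrep (Y \<union> X)) s1"
  proof (rule wp_post_frame)
    show "wp (m * 6 + 3) (For vi vm ?b2) (?I2 m) s1"
    proof (rule wp_For_straight[where I = ?I2 and N = m])
      fix i s' assume i: "i < m" "nmem s' vi 0 = i" and sm: "same (insert vi (nwr ?b2)) (rwr ?b2) s1 s'"
        and I: "?I2 i s'"
      have "nmem s' 6 i = of_bool (Inr (ed i) \<in> X)"
        using s i by (simp add: same_nmem[OF sm] same_nmem[OF sm1])
      then show "?I2 (Suc i) (ex ?b2 s')"
        using i I by (auto simp: less_Suc_eq)
    qed (use s in \<open>auto simp: base_def Yrep_def same_nmem[OF sm1]\<close>)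
  next
    fix s' assume "?I2 m s'" and "same (nwr (For vi vm ?b2)) (rwr (For vi vm ?b2)) s1 s'"
    then show "Yrep (Y \<union> X) s'"
      using I1 by (auto simp: Yrep_def same_def)
  qed simp
qed simp

end

context graph_data
begin

lemma G_weights: "positive_weights G (\<lambda>x. ereal (wr x))"
  using pos by (auto simp: positive_weights_def)

lemma round_spec:
  assumes s: "base s" "Srep S s" "Yrep Y s" "nmem s vpw 0 = p" and p: "0 < p" "p < card S"
    and S: "S \<subseteq> R" and iso: "isolating G wr S (differ S p) Y"
  shows "wp (Tec m n + 30 * n + 15 * m + 40) round
    (\<lambda>s'. nmem s' vpw 0 = p + p \<and> (\<exists>Y'. Yrep Y' s' \<and> isolating G wr S (differ S (p + p)) Y')) s"
  unfolding round_def
proof (rule wp_Seq_frame[OF label_spec[OF s(1,2,4) p(1)]])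
  fix s1 assume lab: "\<forall>v<n. nmem s1 aLab v = (if v \<in> S then (if bit S p v = 1 then 1 else 2) else 0)"
    and sm1: "same (nwr label) (rwr label) s s1"
  define A B where "A = {v \<in> S. bit S p v = 1}" and "B = {v \<in> S. bit S p v \<noteq> 1}"
  have b1: "base s1" by (rule base_same[OF s(1) sm1]) auto
  have finS: "finite S" using S finite_R by (rule finite_subset)
  have AB: "A \<union> B = S" "A \<inter> B = {}" by (auto simp: A_def B_def)
  \<comment> \<open>The terminals of rank \<open>p\<close> and of rank 0 witness that neither side
    is empty.\<close>
  obtain a where a: "a \<in> S" "rank S a = p" using rank_surj[OF finS p(2)] .
  have "bit S p a = 1" using a p(1) by (simp add: bit_def)
  then have "A \<noteq> {}" using a by (auto simp: A_def)
  obtain b where b: "b \<in> S" "rank S b = 0" using rank_surj[OF finS, of 0] p by auto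
  have "bit S p b = 0" using b by (simp add: bit_def)
  then have "B \<noteq> {}" using b by (auto simp: B_def)
  have ST: "S \<subseteq> terminals G" using S R by auto
  let ?w = "\<lambda>x. ereal (wr x)"
  have E1: "edges G = (\<lambda>i. {nmem s1 aT i, nmem s1 aH i}) ` {..<m}"
    unfolding E using b1 by (intro image_cong) (auto simp: base_def)
  have call: "wp (Tec m n + 9 * m + 9 * n + 12) (call_cut aT aH rE vm aTm aLab)
    (\<lambda>s'. \<exists>X. min_element_cut G ?w A B X \<and>
      (\<forall>v<n. nmem s' aCutVertex v = of_bool (Inl v \<in> X)) \<and>
      (\<forall>i<m. nmem s' aCutEdge i = of_bool (Inr {nmem s1 aT i, nmem s1 aH i} \<in> X))) s1"
  proof (rule call_cut_spec[OF solver G G_weights _ _ \<open>A \<noteq> {}\<close> \<open>B \<noteq> {}\<close> AB(2) V])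
    show "nmem s1 aLab v = (if v \<in> A then 1 else if v \<in> B then 2 else 0)" if "v < n" for v
      using lab that by (auto simp: A_def B_def)
  qed (use b1 AB ST cE E1 in \<open>auto simp: base_def\<close>)
  show "wp (Tec m n + 30 * n + 15 * m + 40 - (n * 15 + 10 + 1))
     (call_cut aT aH rE vm aTm aLab ;; merge ;; setv vpw (NAdd (var vpw) (var vpw)))
     (\<lambda>s'. nmem s' vpw 0 = p + p \<and> (\<exists>Y'. Yrep Y' s' \<and> isolating G wr S (differ S (p + p)) Y')) s1"
  proof (rule wp_Seq_frame[OF call])
    fix s2 :: state
    assume "\<exists>X. min_element_cut G ?w A B X \<and>
      (\<forall>v<n. nmem s2 aCutVertex v = of_bool (Inl v \<in> X)) \<and>
      (\<forall>i<m. nmem s2 aCutEdge i = of_bool (Inr {nmem s1 aT i, nmem s1 aH i} \<in> X))"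
    then obtain X where X: "min_element_cut G ?w A B X"
      and Xv: "\<And>v. v < n \<Longrightarrow> nmem s2 aCutVertex v = of_bool (Inl v \<in> X)"
      and Xe': "\<And>i. i < m \<Longrightarrow> nmem s2 aCutEdge i = of_bool (Inr {nmem s1 aT i, nmem s1 aH i} \<in> X)"
      by blast
    have Xe: "nmem s2 aCutEdge i = of_bool (Inr (ed i) \<in> X)" if "i < m" for i
      using Xe'[OF that] b1 that by (simp add: base_def)
    assume sm2: "same (nwr (call_cut aT aH rE vm aTm aLab)) (rwr (call_cut aT aH rE vm aTm aLab)) s1 s2"
    have b2: "base s2" by (rule base_same[OF b1 sm2]) auto
    have Y2: "Yrep Y s2"
      using s(3) by (simp add: Yrep_def same_nmem[OF sm1] same_nmem[OF sm2])
    have p2: "nmem s2 vpw 0 = p"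
      using s(4) by (simp add: same_nmem[OF sm1] same_nmem[OF sm2])
    show "wp (Tec m n + 30 * n + 15 * m + 40 - (n * 15 + 10 + 1) - (Tec m n + 9 * m + 9 * n + 12 + 1))
     (merge ;; setv vpw (NAdd (var vpw) (var vpw)))
     (\<lambda>s'. nmem s' vpw 0 = p + p \<and> (\<exists>Y'. Yrep Y' s' \<and> isolating G wr S (differ S (p + p)) Y')) s2"
    proof (rule wp_Seq_frame[OF merge_spec[OF b2 Y2 Xv Xe]])
      fix s3 assume Y3: "Yrep (Y \<union> X) s3" and sm3: "same (nwr merge) (rwr merge) s2 s3"
      have "nmem s3 vpw 0 = p" using p2 by (simp add: same_nmem[OF sm3])
      moreover have "isolating G wr S (differ S p \<union> A \<times> B \<union> B \<times> A) (Y \<union> X)"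
        by (rule isolating_step[OF G pos ST AB iso X])
      then have "isolating G wr S (differ S (p + p)) (Y \<union> X)"
      proof (rule isolating_mono)
        have "u \<in> A \<and> v \<in> B \<or> u \<in> B \<and> v \<in> A" if "u \<in> S" "v \<in> S" "bit S p u \<noteq> bit S p v" for u v
          using that by (auto simp: A_def B_def bit_def mod2_eq_if split: if_splits)
        then show "differ S (p + p) \<inter> S \<times> S \<subseteq> differ S p \<union> A \<times> B \<union> B \<times> A"
          using differ_double[of S p] by blast
      qed
      ultimately show "wp (Tec m n + 30 * n + 15 * m + 40 - (n * 15 + 10 + 1) - (Tec m n + 9 * m + 9 * n + 12 + 1)
          - (n * 6 + m * 6 + 7 + 1)) (setv vpw (NAdd (var vpw) (var vpw)))
        (\<lambda>s'. nmem s' vpw 0 = p + p \<and> (\<exists>Y'. Yrep Y' s' \<and> isolating G wr S (differ S (p + p)) Y')) s3"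
        using Y3 by (intro wp_NAssign) (auto simp: Yrep_def)
    qed auto
  qed auto
qed auto

lemma rounds_spec:
  assumes s: "base s" "Srep S s" and S: "S \<subseteq> R" "2 \<le> card S"
  shows "wp (L * (Tec m n + 30 * n + 15 * m + 45) + 5 * n + 5 * m + 15) rounds
    (\<lambda>s'. \<exists>Y. Yrep Y s' \<and> isolating G wr S {(r, r'). r \<noteq> r'} Y) s"
    (is "wp ?T _ ?Q s")
  unfolding rounds_def
proof (rule wp_Seq_frame)
  let ?b1 = "NAssign aYv (var vi) N0" and ?b2 = "NAssign aYe (var vi) N0"
  let ?b3 = "onlyif (NLess (var vpw) (var vcnt)) round"
  let ?I1 = "\<lambda>i s'. \<forall>v<i. nmem s' aYv v = 0"
  let ?I2 = "\<lambda>i s'. \<forall>v<i. nmem s' aYe v = 0"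
  show "wp (n * 5 + 3) (For vi vn ?b1) (?I1 n) s"
    by (rule wp_For_straight[where I = ?I1 and N = n]) (use s in \<open>auto simp: base_def less_Suc_eq\<close>)
  fix s1 assume I1: "?I1 n s1" and sm1: "same (nwr (For vi vn ?b1)) (rwr (For vi vn ?b1)) s s1"
  have b1: "base s1" by (rule base_same[OF s(1) sm1]) auto
  show "wp (?T - (n * 5 + 3 + 1)) (For vi vm ?b2 ;; setv vpw N1 ;; For vrnd vL ?b3) ?Q s1"
  proof (rule wp_Seq_frame)
    show "wp (m * 5 + 3) (For vi vm ?b2) (?I2 m) s1"
      by (rule wp_For_straight[where I = ?I2 and N = m]) (use b1 in \<open>auto simp: base_def less_Suc_eq\<close>)
    fix s2 assume I2: "?I2 m s2" and sm2: "same (nwr (For vi vm ?b2)) (rwr (For vi vm ?b2)) s1 s2"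
    have b2: "base s2" by (rule base_same[OF b1 sm2]) auto
    have S2: "Srep S s2" using s(2) by (simp add: Srep_def same_nmem[OF sm1] same_nmem[OF sm2])
    have Y2: "Yrep {} s2" using I1 I2 by (simp add: Yrep_def same_nmem[OF sm2])
    define s3 where "s3 = ex (setv vpw N1) s2"
    have 3: "base s3" "Srep S s3" "Yrep {} s3" "nmem s3 vpw 0 = 1"
      using b2 S2 Y2 by (simp_all add: s3_def base_def Srep_def Yrep_def)
    \<comment> \<open>Once \<open>p\<close> has reached the sample size it no longer doubles, hence
      the alternative to \<open>p = 2 ^ j\<close>.\<close>
    let ?I3 = "\<lambda>j s'. \<exists>Y p. Yrep Y s' \<and> nmem s' vpw 0 = p \<and> 0 < p \<and> (p = 2 ^ j \<or> card S \<le> p) \<and>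
      isolating G wr S (differ S p) Y"
    have "wp (L * (Tec m n + 30 * n + 15 * m + 45) + 3) (For vrnd vL ?b3) (?I3 L) s3"
    proof (rule wp_For_const[where I = ?I3 and N = L and T = "Tec m n + 30 * n + 15 * m + 41"])
      have "differ S 1 = {}" by (auto simp: differ_def)
      then show "?I3 0 s3" using 3 isolating_empty[of G wr S] by auto
    next
      fix j s4 assume j: "j < L" and sm4: "same (insert vrnd (nwr ?b3)) (rwr ?b3) s3 s4" and I: "?I3 j s4"
      have b4: "base s4" by (rule base_same[OF 3(1) sm4]) auto
      have S4: "Srep S s4" using 3(2) by (simp add: Srep_def same_nmem[OF sm4])
      obtain Y p where Y: "Yrep Y s4" "nmem s4 vpw 0 = p" "0 < p" "p = 2 ^ j \<or> card S \<le> p"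
        "isolating G wr S (differ S p) Y" using I by blast
      show "wp (Tec m n + 30 * n + 15 * m + 41) ?b3 (?I3 (Suc j)) s4"
      proof (rule wp_Cond)
        show "wp (Tec m n + 30 * n + 15 * m + 40) (if bval (NLess (var vpw) (var vcnt)) s4 then round else Skip)
          (?I3 (Suc j)) s4"
        proof (cases "p < card S")
          case True
          then have "p = 2 ^ j" using Y by auto
          then have "p + p = 2 ^ Suc j" by simp
          then have "wp (Tec m n + 30 * n + 15 * m + 40) round (?I3 (Suc j)) s4"
            using Y(3) by (intro wp_conseq[OF round_spec[OF b4 S4 Y(1-3) True S(1) Y(5)]]) fastforce
          then show ?thesis using True Y S4 by (simp add: Srep_def)
        next
          case False
          then show ?thesis using Y S4 by (auto simp: Srep_def)
        qed
      qed simp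
    qed (use 3 in \<open>auto simp: base_def Yrep_def\<close>)
    moreover have "?Q s'" if I3: "?I3 L s'" for s'
    proof -
      obtain Y p where Y: "Yrep Y s'" "0 < p" "p = 2 ^ L \<or> card S \<le> p" "isolating G wr S (differ S p) Y"
        using I3 by blast
      have finS: "finite S" using S finite_R by (auto intro: finite_subset)
      have "card S \<le> card R" using S finite_R by (intro card_mono)
      with Y(3) L have "card S \<le> p" by auto
      \<comment> \<open>All ranks are below \<open>p\<close> and therefore equal to their remainders
        modulo \<open>p\<close>.\<close>
      then have "(u, v) \<in> differ S p" if "u \<in> S" "v \<in> S" "u \<noteq> v" for u v
        using rank_less[OF finS that(1)] rank_less[OF finS that(2)] rank_eq_iff[OF that(1,2)] that(3)
        by (simp add: differ_def)
      then have "isolating G wr S {(r, r'). r \<noteq> r'} Y"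
        by (intro isolating_mono[OF Y(4)]) auto
      with Y show ?thesis by blast
    qed
    ultimately have "wp (L * (Tec m n + 30 * n + 15 * m + 45) + 3) (For vrnd vL ?b3) ?Q s3"
      by (rule wp_conseq)
    then show "wp (?T - (n * 5 + 3 + 1) - (m * 5 + 3 + 1)) (setv vpw N1 ;; For vrnd vL ?b3) ?Q s2"
      unfolding s3_def by (intro wp_straight_Seq) (auto elim: wp_time_mono)
  qed simp
qed simp

lemma components_spec:
  assumes s: "base s" "Yrep Y s"
  shows "wp (m * 12 + n * (9 * n + 25) + 15) components
    (\<lambda>s'. (\<forall>u<n. nmem s' aC u < n) \<and>
      (\<forall>u<n. \<forall>v<n. nmem s' aC u = nmem s' aC v \<longleftrightarrow> (u, v) \<in> (remaining_adj G Y)\<^sup>*)) s"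
    (is "wp ?T _ ?Q s")
  unfolding components_def
proof (rule wp_Seq_frame)
  let ?b1 = "NAssign aC (var vi) (var vi)"
  let ?b3 = "onlyif (eqb (cell aC vj) (var vta)) (NAssign aC (var vj) (var vtb))"
  let ?c = "BAnd (NLess (cell aYe vi) N1) (BAnd (NLess (NCell aYv (cell aT vi)) N1)
              (BAnd (NLess (NCell aYv (cell aH vi)) N1)
                (BNot (eqb (NCell aC (cell aT vi)) (NCell aC (cell aH vi))))))"
  let ?d = "setv vta (NCell aC (cell aT vi)) ;; setv vtb (NCell aC (cell aH vi)) ;; For vj vn ?b3"
  let ?b2 = "onlyif ?c ?d"
  let ?I1 = "\<lambda>i s'. \<forall>v<i. nmem s' aC v = v"
  show "wp (n * 5 + 3) (For vi vn ?b1) (?I1 n) s"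
    by (rule wp_For_straight[where I = ?I1 and N = n]) (use s in \<open>auto simp: base_def less_Suc_eq\<close>)
  fix s1 assume I1: "?I1 n s1" and sm1: "same (nwr (For vi vn ?b1)) (rwr (For vi vn ?b1)) s s1"
  have b1: "base s1" by (rule base_same[OF s(1) sm1]) auto
  have Y1: "Yrep Y s1" using s(2) by (simp add: Yrep_def same_nmem[OF sm1])
  define ok where "ok i \<longleftrightarrow> Inr (ed i) \<notin> Y \<and> Inl (te i) \<notin> Y \<and> Inl (he i) \<notin> Y" for i
  define r where "r i = {(te j, he j) | j. j < i \<and> ok j} \<union> {(he j, te j) | j. j < i \<and> ok j}" for i
  have r_Suc: "r (Suc i) = (if ok i then insert (te i, he i) (insert (he i, te i) (r i)) else r i)" for i
    by (auto simp: r_def less_Suc_eq)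
  have r_n: "r i \<subseteq> {..<n} \<times> {..<n}" if "i \<le> m" for i
    using that ed_n by (auto simp: r_def)
  have r_m: "r m = remaining_adj G Y"
  proof -
    have "(u, v) \<in> remaining_adj G Y \<longleftrightarrow>
        (\<exists>j<m. ok j \<and> (u = te j \<and> v = he j \<or> u = he j \<and> v = te j))" for u v
    proof
      assume uv: "(u, v) \<in> remaining_adj G Y"
      then obtain j where j: "j < m" "{u, v} = ed j"
        by (auto simp: remaining_adj_def E)
      moreover have "Inr (ed j) \<notin> Y" "Inl u \<notin> Y" "Inl v \<notin> Y"
        using uv by (simp_all add: remaining_adj_def flip: j(2))
      ultimately show "\<exists>j<m. ok j \<and> (u = te j \<and> v = he j \<or> u = he j \<and> v = te j)"
        by (intro exI[of _ j]) (auto simp: ok_def doubleton_eq_iff)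
    next
      assume "\<exists>j<m. ok j \<and> (u = te j \<and> v = he j \<or> u = he j \<and> v = te j)"
      then obtain j where j: "j < m" "ok j" "u = te j \<and> v = he j \<or> u = he j \<and> v = te j" by blast
      then have "{u, v} = ed j" by auto
      with j ed_edges show "(u, v) \<in> remaining_adj G Y"
        by (auto simp: remaining_adj_def ok_def)
    qed
    then show ?thesis
      by (auto simp: r_def)
  qed
  let ?I2 = "\<lambda>i s'. i \<le> m \<longrightarrow> (\<forall>u<n. nmem s' aC u < n) \<and>
      (\<forall>u<n. \<forall>v<n. nmem s' aC u = nmem s' aC v \<longleftrightarrow> (u, v) \<in> (r i)\<^sup>*)"
  (* Every relabelling removes one of the labels, which pays for its O(n) steps. *)
  let ?B = "\<lambda>i s'. (m - i) * 5 + card (nmem s' aC ` {..<n}) * (6 * n + 9)"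
  show "wp (?T - (n * 5 + 3 + 1)) (For vi vm ?b2) ?Q s1"
  proof (rule wp_weaken)
    show "wp (m * 5 + n * (6 * n + 9) + 3) (For vi vm ?b2) (?I2 m) s1"
    proof (rule wp_For_potential[where I = ?I2 and N = m and B = ?B])
      show "?I2 0 s1" using I1 by (auto simp: r_def)
      have "nmem s1 aC ` {..<n} = {..<n}" using I1 by auto
      then show "?B 0 s1 + 3 \<le> m * 5 + n * (6 * n + 9) + 3" by simp
    next
      fix i s' assume i: "i < m" "nmem s' vi 0 = i" and sm: "same (insert vi (nwr ?b2)) (rwr ?b2) s1 s'"
        and I: "?I2 i s'"
      have b': "base s'" by (rule base_same[OF b1 sm]) auto
      have Y': "Yrep Y s'" using Y1 by (simp add: Yrep_def same_nmem[OF sm])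
      let ?C = "nmem s' aC"
      have C_n: "\<And>u. u < n \<Longrightarrow> ?C u < n" and C: "\<And>u v. u < n \<Longrightarrow> v < n \<Longrightarrow> ?C u = ?C v \<longleftrightarrow> (u, v) \<in> (r i)\<^sup>*"
        using I i(1) by auto
      let ?a = "te i" and ?h = "he i"
      let ?C' = "\<lambda>v. if ?C v = ?C ?a then ?C ?h else ?C v"
      have C': "?C' u = ?C' v \<longleftrightarrow> (u, v) \<in> (insert (?a, ?h) (insert (?h, ?a) (r i)))\<^sup>*" if "u < n" "v < n" for u v
        using i(1) by (intro relabel_connected[OF C r_n ed_n that]) auto
      have cond: "bval ?c s' \<longleftrightarrow> ok i \<and> ?C ?a \<noteq> ?C ?h"
        using i b' Y' ed_n[OF i(1)] by (auto simp: base_def Yrep_def ok_def)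
      show "\<exists>t. wp t ?b2 (\<lambda>s''. ?I2 (Suc i) s'' \<and> t + 4 + ?B (Suc i) s'' \<le> ?B i s') s'"
      proof (cases "bval ?c s'")
        case False
        have "(u, v) \<in> (r (Suc i))\<^sup>* \<longleftrightarrow> ?C u = ?C v" if "u < n" "v < n" for u v
        proof (cases "ok i")
          case True
          \<comment> \<open>The ends already share a label, so the relabelling is the identity and
            \<open>relabel_connected\<close> covers the skipped edge too.\<close>
          then have eq: "?C ?a = ?C ?h" using False cond by blast
          have Ceq: "?C' x = ?C x" for x using eq by simp
          have rS: "r (Suc i) = insert (?a, ?h) (insert (?h, ?a) (r i))" using r_Suc True by simp
          show ?thesis using C'[OF that] unfolding rS Ceq by blast
        qed (use C[OF that] r_Suc in simp)
        then have post: "?I2 (Suc i) s' \<and> 1 + 4 + ?B (Suc i) s' \<le> ?B i s'"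
          using C_n i(1) by auto
        have "wp 1 ?b2 (\<lambda>s''. ?I2 (Suc i) s'' \<and> 1 + 4 + ?B (Suc i) s'' \<le> ?B i s') s'"
          by (rule wp_Cond[where ?t1.0 = 0]) (simp only: False if_False wp_Skip, rule post, simp)
        then show ?thesis by blast
      next
        case True
        then have ok: "ok i" and ne: "?C ?a \<noteq> ?C ?h" using cond by blast+
        let ?s = "ex (setv vtb (NCell aC (cell aH vi))) (ex (setv vta (NCell aC (cell aT vi))) s')"
        let ?I3 = "\<lambda>j s''. \<forall>v<n. nmem s'' aC v = (if v < j then ?C' v else ?C v)"
        have loop: "wp (n * 6 + 3) (For vj vn ?b3) (?I3 n) ?s"
        proof (rule wp_For_straight[where I = ?I3 and N = n])
          fix j s'' assume j: "j < n" "nmem s'' vj 0 = j" and sm': "same (insert vj (nwr ?b3)) (rwr ?b3) ?s s''"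
            and I3: "?I3 j s''"
          have "nmem s'' vta 0 = ?C ?a" "nmem s'' vtb 0 = ?C ?h"
            using b' i by (simp_all add: same_nmem[OF sm'] base_def)
          then show "?I3 (Suc j) (ex ?b3 s'')"
            using j I3 by (auto simp: less_Suc_eq)
        qed (use b' in \<open>auto simp: base_def\<close>)
        have "wp (n * 6 + 8) ?b2 (\<lambda>s''. \<forall>v<n. nmem s'' aC v = ?C' v) s'"
        proof (rule wp_Cond)
          have "wp (n * 6 + 7) ?d (\<lambda>s''. \<forall>v<n. nmem s'' aC v = ?C' v) s'"
            by (rule wp_straight_Seq, simp, simp, rule wp_straight_Seq, simp, simp, rule wp_weaken[OF loop]) simp_all
          then show "wp (n * 6 + 7) (if bval ?c s' then ?d else Skip) (\<lambda>s''. \<forall>v<n. nmem s'' aC v = ?C' v) s'"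
            by (simp only: True if_True)
        qed simp
        then have "wp (n * 6 + 8) ?b2 (\<lambda>s''. ?I2 (Suc i) s'' \<and> n * 6 + 8 + 4 + ?B (Suc i) s'' \<le> ?B i s') s'"
        proof (rule wp_conseq)
          fix s'' assume C'': "\<forall>v<n. nmem s'' aC v = ?C' v"
          have "nmem s'' aC ` {..<n} = ?C ` {..<n} - {?C ?a}"
          proof -
            have "nmem s'' aC ` {..<n} = ?C' ` {..<n}" using C'' by (intro image_cong) auto
            also have "\<dots> = ?C ` {..<n} - {?C ?a}"
              using ne ed_n[OF i(1)] by (auto simp: image_iff split: if_splits)
            finally show ?thesis .
          qed
          then have cd: "card (nmem s'' aC ` {..<n}) + 1 = card (?C ` {..<n})"
            using ed_n[OF i(1)] card_Suc_Diff1[of "?C ` {..<n}" "?C ?a"] by simp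
          have "?B (Suc i) s'' + (6 * n + 9) + 5 = (m - i) * 5 + (card (nmem s'' aC ` {..<n}) + 1) * (6 * n + 9)"
            using i(1) by (simp add: algebra_simps Suc_diff_Suc)
          then have "n * 6 + 8 + 4 + ?B (Suc i) s'' \<le> ?B i s'" unfolding cd by simp
          moreover have "?I2 (Suc i) s''"
            using C'' C_n C' ok ed_n[OF i(1)] by (simp add: r_Suc)
          ultimately show "?I2 (Suc i) s'' \<and> n * 6 + 8 + 4 + ?B (Suc i) s'' \<le> ?B i s'" by blast
        qed
        then show ?thesis by blast
      qed
    qed (use b1 in \<open>auto simp: base_def\<close>)
  next
    show "m * 5 + n * (6 * n + 9) + 3 \<le> ?T - (n * 5 + 3 + 1)"
      by (simp add: algebra_simps)
  qed (use r_m in auto)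
qed (simp add: algebra_simps)

lemma owners_spec:
  assumes s: "base s" "Srep S s" and S: "S \<subseteq> R"
    and C: "\<And>v. v < n \<Longrightarrow> nmem s aC v < n"
      "\<And>u v. u < n \<Longrightarrow> v < n \<Longrightarrow> nmem s aC u = nmem s aC v \<longleftrightarrow> (u, v) \<in> (remaining_adj G Y)\<^sup>*"
    and iso: "isolating G wr S {(r, r'). r \<noteq> r'} Y"
  shows "wp (n * 20 + 15) owners (\<lambda>s'. \<forall>v<n. \<forall>r. nmem s' aOwn v = Suc r \<longleftrightarrow> r \<in> S \<and> v \<in> comp_of G Y r) s"
    (is "wp ?T _ ?Q s")
  unfolding owners_def
proof (rule wp_Seq_frame)
  let ?b1 = "NAssign aZ (var vi) N0" and ?b3 = "NAssign aOwn (var vi) (NCell aZ (cell aC vi))"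
  let ?b2 = "onlyif (eqb (cell aS vi) N1) (NAssign aZ (cell aC vi) (NAdd (var vi) N1))"
  let ?I1 = "\<lambda>i s'. \<forall>v<i. nmem s' aZ v = 0"
  let ?C = "nmem s aC"
  \<comment> \<open>Distinct sampled terminals lie in distinct components, so no owner overwrites
    another one.\<close>
  have C_inj: "r = r'" if "r \<in> S" "r' \<in> S" "?C r = ?C r'" for r r'
  proof (rule ccontr)
    assume "r \<noteq> r'"
    with iso that have "(r, r') \<notin> (remaining_adj G Y)\<^sup>*" by (auto simp: isolating_def)
    with C(2)[of r r'] that S R_n show False by auto
  qed
  show "wp (n * 5 + 3) (For vi vn ?b1) (?I1 n) s"
    by (rule wp_For_straight[where I = ?I1 and N = n]) (use s in \<open>auto simp: base_def less_Suc_eq\<close>)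
  fix s1 assume I1: "?I1 n s1" and sm1: "same (nwr (For vi vn ?b1)) (rwr (For vi vn ?b1)) s s1"
  have b1: "base s1" by (rule base_same[OF s(1) sm1]) auto
  let ?I2 = "\<lambda>i s'. \<forall>c<n. \<forall>r. nmem s' aZ c = Suc r \<longleftrightarrow> r < i \<and> r \<in> S \<and> ?C r = c"
  show "wp (?T - (n * 5 + 3 + 1)) (For vi vn ?b2 ;; For vi vn ?b3) ?Q s1"
  proof (rule wp_Seq_frame)
    show "wp (n * 6 + 3) (For vi vn ?b2) (?I2 n) s1"
    proof (rule wp_For_straight[where I = ?I2 and N = n])
      fix i s' assume i: "i < n" "nmem s' vi 0 = i" and sm: "same (insert vi (nwr ?b2)) (rwr ?b2) s1 s'"
        and I: "?I2 i s'"
      have eq: "nmem s' aS i = of_bool (i \<in> S)" "nmem s' aC = ?C"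
        using s(2) i by (simp_all add: Srep_def same_nmem[OF sm] same_nmem[OF sm1])
      show "?I2 (Suc i) (ex ?b2 s')"
      proof (cases "i \<in> S")
        case True
        then have upd: "nmem (ex ?b2 s') aZ c = (if c = ?C i then Suc i else nmem s' aZ c)" for c
          using eq i by simp
        show ?thesis
        proof (intro allI impI)
          fix c r assume "c < n"
          show "nmem (ex ?b2 s') aZ c = Suc r \<longleftrightarrow> r < Suc i \<and> r \<in> S \<and> ?C r = c"
          proof (cases "c = ?C i")
            case c: True
            then show ?thesis using upd C_inj[OF _ True] True by auto
          next
            case False
            then show ?thesis using upd I \<open>c < n\<close> by (auto simp: less_Suc_eq)
          qed
        qed
      next
        case False
        then show ?thesis using eq i I by (auto simp: less_Suc_eq)
      qed
    qed (use b1 I1 in \<open>auto simp: base_def\<close>)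
    fix s2 assume I2: "?I2 n s2" and sm2: "same (nwr (For vi vn ?b2)) (rwr (For vi vn ?b2)) s1 s2"
    have b2: "base s2" by (rule base_same[OF b1 sm2]) auto
    let ?I3 = "\<lambda>i s'. \<forall>v<i. nmem s' aOwn v = nmem s2 aZ (?C v)"
    show "wp (?T - (n * 5 + 3 + 1) - (n * 6 + 3 + 1)) (For vi vn ?b3) ?Q s2"
    proof (rule wp_weaken)
      show "wp (n * 5 + 3) (For vi vn ?b3) (?I3 n) s2"
      proof (rule wp_For_straight[where I = ?I3 and N = n])
        fix i s' assume i: "i < n" "nmem s' vi 0 = i" and sm: "same (insert vi (nwr ?b3)) (rwr ?b3) s2 s'"
          and I: "?I3 i s'"
        then show "?I3 (Suc i) (ex ?b3 s')"
          by (auto simp: less_Suc_eq same_nmem[OF sm] same_nmem[OF sm1] same_nmem[OF sm2])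
      qed (use b2 in \<open>auto simp: base_def\<close>)
      fix s' :: state
      assume I3: "?I3 n s'"
      show "?Q s'"
      proof (intro allI impI)
        fix v r assume v: "v < n"
        have "nmem s' aOwn v = Suc r \<longleftrightarrow> r < n \<and> r \<in> S \<and> ?C r = ?C v"
          using I3 I2 C(1)[OF v] v by simp
        also have "\<dots> \<longleftrightarrow> r \<in> S \<and> v \<in> comp_of G Y r"
          using S R_n C(2)[of r v] v by (auto simp: comp_of_def)
        finally show "nmem s' aOwn v = Suc r \<longleftrightarrow> r \<in> S \<and> v \<in> comp_of G Y r" .
      qed
    qed simp
  qed simp
qed simp

end

lemma wp_Cond_True: "bval b s \<Longrightarrow> wp t1 c1 Q s \<Longrightarrow> t1 + 1 \<le> t \<Longrightarrow> wp t (Cond b c1 c2) Q s"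
  by (rule wp_Cond) simp_all

lemma wp_onlyif_False: "\<not> bval b s \<Longrightarrow> Q s \<Longrightarrow> 1 \<le> t \<Longrightarrow> wp t (onlyif b c) Q s"
  by (rule wp_Cond[where ?t1.0 = 0]) simp_all

section \<open>Building, solving and evaluating the small instances\<close>

context cut_program
begin

abbreviation push :: "nexp \<Rightarrow> nexp \<Rightarrow> rexp \<Rightarrow> com" where
  "push x y c \<equiv> NAssign aST (var vem) x ;; NAssign aSH (var vem) y ;; RAssign rS (var vem) c ;;
     setv vem (NAdd (var vem) N1)"

text \<open>The matrix rows of the vertices in the component of \<open>r\<close> are scanned. An
  edge with both ends inside is pushed only from its smaller end. Marking neighbours in
  \<open>aNb\<close> ensures that a rim vertex gets a single edge to \<open>b\<close>, however many
  neighbours it has in the component.\<close>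

definition build :: com where
  "build = setv vem N0 ;;
     For vi vn (NAssign aNb (var vi) N0) ;;
     For vi vn
       (onlyif (eqb (cell aOwn vi) (NAdd (var vr) N1))
         (For vj vn
           (onlyif (BAnd (RLess RZero (RCell rW (NAdd (cell aRow vi) (var vj))))
                     (orb (BNot (eqb (cell aOwn vj) (NAdd (var vr) N1))) (NLess (var vi) (var vj))))
             (NAssign aNb (var vj) N1 ;;
              push (var vi) (var vj) (RCell rW (NAdd (cell aRow vi) (var vj))))))) ;;
     For vi vn
       (Cond (orb (eqb (cell aTm vi) N1)
               (BAnd (NLess N0 (cell aOwn vi)) (BNot (eqb (cell aOwn vi) (NAdd (var vr) N1)))))
          (NAssign aSTm (var vi) N1) (NAssign aSTm (var vi) N0) ;;
        Cond (eqb (var vi) (var vr)) (NAssign aSLab (var vi) N1)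
          (Cond (BAnd (eqb (cell aSTm vi) N1) (BNot (eqb (cell aOwn vi) (NAdd (var vr) N1))))
             (NAssign aSLab (var vi) (NConst 2)) (NAssign aSLab (var vi) N0)) ;;
        onlyif (BAnd (eqb (cell aNb vi) N1) (BAnd (eqb (cell aTm vi) N0) (eqb (cell aOwn vi) N0)))
          (push (var vi) (var vb) RInf))"

definition evaluate :: com where
  "evaluate = setr rVal RZero ;;
     For vi vn (onlyif (eqb (NCell aCutVertex (var vi)) N1) (setr rVal (RAdd (rvar rVal) (rcell rV vi)))) ;;
     For vi vem (onlyif (eqb (NCell aCutEdge (var vi)) N1) (setr rVal (RAdd (rvar rVal) (rcell rS vi)))) ;;
     onlyif (RLess (rvar rVal) (rvar rBest)) (setr rBest (rvar rVal))"

definition sub_cut :: com where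
  "sub_cut = Cond (eqb (var vr) (var vfst)) (setv vb (var vlst)) (setv vb (var vfst)) ;;
     build ;; call_cut aST aSH rS vem aSTm aSLab ;; evaluate"

definition sub_cuts :: com where
  "sub_cuts = For vr vn (onlyif (eqb (cell aS vr) N1) sub_cut)"

definition level :: com where
  "level = select ;; onlyif (NLess N1 (var vcnt)) (rounds ;; components ;; owners ;; sub_cuts)"

lemma frame_build [simp]:
  "nwr build = {vem, vi, vj, aNb, aST, aSH, aSTm, aSLab}" "rwr build = {rS}"
  and frame_evaluate [simp]: "nwr evaluate = {vi}" "rwr evaluate = {rVal, rBest}"
  by (auto simp: build_def evaluate_def)

lemma frame_sub_cut [simp]:
  "nwr sub_cut = {vb, vem, vi, vj, aNb, aST, aSH, aSTm, aSLab, 0, 1, 2, 3, 4} \<union> nwr P"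
  "rwr sub_cut = {rS, rVal, rBest, 0, 1} \<union> rwr P"
  by (auto simp: sub_cut_def)

lemma frame_sub_cuts [simp]:
  "nwr sub_cuts = {vr, vb, vem, vi, vj, aNb, aST, aSH, aSTm, aSLab, 0, 1, 2, 3, 4} \<union> nwr P"
  "rwr sub_cuts = {rS, rVal, rBest, 0, 1} \<union> rwr P"
  by (auto simp: sub_cuts_def)

lemma frame_level [simp]:
  "nwr level = {vcnt, vi, aS, vfst, vlst, vtc, vtb, aLab, 0, 1, 2, 3, 4, aYv, aYe, vpw, vrnd,
     aC, vta, vj, aZ, aOwn, vr, vb, vem, aNb, aST, aSH, aSTm, aSLab} \<union> nwr P"
  "rwr level = {rS, rVal, rBest, 0, 1} \<union> rwr P"
  by (auto simp: level_def)

text \<open>A list of exactly \<open>card F\<close> entries covering \<open>F\<close> is free of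
  repetitions, as the input convention of the solver demands.\<close>

definition Erep :: "(nat element \<Rightarrow> ereal) \<Rightarrow> nat set set \<Rightarrow> state \<Rightarrow> bool" where
  "Erep W F s \<longleftrightarrow> finite F \<and> nmem s vem 0 = card F \<and>
     (\<lambda>i. {nmem s aST i, nmem s aSH i}) ` {..<card F} = F \<and>
     (\<forall>i<card F. rmem s rS i = W (Inr {nmem s aST i, nmem s aSH i}))"

lemma Erep_push:
  assumes F: "Erep W F s" "{u, v} \<notin> F"
    and s': "nmem s' vem 0 = Suc (nmem s vem 0)"
      "nmem s' aST = (nmem s aST)(nmem s vem 0 := u)" "nmem s' aSH = (nmem s aSH)(nmem s vem 0 := v)"
      "rmem s' rS = (rmem s rS)(nmem s vem 0 := W (Inr {u, v}))"
  shows "Erep W (insert {u, v} F) s'"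
proof -
  have c: "card (insert {u, v} F) = Suc (card F)" and k: "nmem s vem 0 = card F"
    using F by (simp_all add: Erep_def)
  have "(\<lambda>i. {nmem s' aST i, nmem s' aSH i}) ` {..<card F} = F"
    using F(1) s'(2,3) k by (simp add: Erep_def cong: image_cong_simp)
  then have "(\<lambda>i. {nmem s' aST i, nmem s' aSH i}) ` {..<Suc (card F)} = insert {u, v} F"
    using s'(2,3) k by (simp add: lessThan_Suc)
  then show ?thesis
    using F(1) s' k unfolding Erep_def c by (auto simp: less_Suc_eq)
qed

lemma Erep_cong:
  assumes "Erep W F s" "nmem s' vem = nmem s vem" "nmem s' aST = nmem s aST" "nmem s' aSH = nmem s aSH"
    "rmem s' rS = rmem s rS"
  shows "Erep W F s'"
  using assms by (simp add: Erep_def)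

end

context graph_data
begin

definition owned :: "nat set \<Rightarrow> nat element set \<Rightarrow> state \<Rightarrow> bool" where
  "owned S Y s \<longleftrightarrow> (\<forall>v<n. \<forall>r. nmem s aOwn v = Suc r \<longleftrightarrow> r \<in> S \<and> v \<in> comp_of G Y r)"

text \<open>Only the rows of the component are scanned in full. The components are disjoint, so the
  row scans for all terminals together take quadratic time.\<close>

lemma build_spec:
  assumes s: "base s" "owned S Y s" and S: "S \<subseteq> R" and iso: "isolating G wr S {(r, r'). r \<noteq> r'} Y"
    and r: "nmem s vr 0 = r" "r \<in> S" and b: "nmem s vb 0 = b" "b \<in> S" and rb: "r \<noteq> b"
  defines "W \<equiv> sub_weight G wr S Y r b" and "G' \<equiv> sub_graph G S Y r b"
  shows "wp (29 * n + card (comp_of G Y r) * (14 * n + 4) + 15) build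
    (\<lambda>s'. Erep W (edges G') s' \<and> (\<forall>v<n. nmem s' aSTm v = of_bool (v \<in> terminals G') \<and>
       nmem s' aSLab v = (if v \<in> {r} then 1 else if v \<in> sub_sinks G S Y r then 2 else 0))) s"
    (is "wp ?T _ ?Q s")
proof -
  have ST: "S \<subseteq> terminals G" using S R by auto
  interpret iso: isolated G wr S Y
    by (rule isolated.intro[OF G pos ST iso])
  define U where "U = comp_of G Y r"
  have U_n: "u < n" if "u \<in> U" for u
    using iso.U_verts[OF r(2)] V that by (auto simp: U_def)
  have finU: "finite U" using U_n by (auto intro: finite_subset[of _ "{..<n}"])
  have E_n: "u < n \<and> v < n \<and> u \<noteq> v" if "{u, v} \<in> edges G" for u v
  proof -
    have sub: "{u, v} \<subseteq> verts G" and c: "card {u, v} = 2" using that G unfolding egraph_def by blast+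
    have "u \<noteq> v" using c by (cases "u = v") simp_all
    moreover have "u < n" "v < n" using sub unfolding V by simp_all
    ultimately show ?thesis by simp
  qed
  have own_r: "nmem s aOwn v = Suc r \<longleftrightarrow> v \<in> U" if "v < n" for v
    using s(2) r(2) that by (auto simp: owned_def U_def)
  have own_0: "nmem s aOwn v = 0 \<longleftrightarrow> (\<forall>r\<in>S. v \<notin> comp_of G Y r)" if "v < n" for v
  proof -
    have own: "nmem s aOwn v = Suc r \<longleftrightarrow> r \<in> S \<and> v \<in> comp_of G Y r" for r
      using s(2) that by (simp add: owned_def)
    show ?thesis
    proof (cases "nmem s aOwn v")
      case 0
      then show ?thesis using own by simp
    next
      case (Suc r)
      then show ?thesis using own[of r] by auto
    qed
  qed
  \<comment> \<open>The orientation in which an inner edge is pushed; every inner edge has exactly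
    one. \<open>F i j\<close> below collects the edges pushed before position (\<open>i\<close>,
    \<open>j\<close>) of the row-wise scan.\<close>
  define Pr where "Pr u v \<longleftrightarrow> u \<in> U \<and> {u, v} \<in> edges G \<and> (v \<notin> U \<or> u < v)" for u v
  define F where "F i j = {{u, v} | u v. Pr u v \<and> (u < i \<or> u = i \<and> v < j)}" for i j
  have F_00: "F 0 0 = {}" by (auto simp: F_def)
  have F_skip: "F i (Suc j) = F i j" if "\<not> Pr i j" for i j
  proof -
    have "Pr u v \<and> (u < i \<or> u = i \<and> v < Suc j) \<longleftrightarrow> Pr u v \<and> (u < i \<or> u = i \<and> v < j)" for u v
      using that by (auto simp: less_Suc_eq)
    then show ?thesis unfolding F_def by simp
  qed
  have F_push: "F i (Suc j) = insert {i, j} (F i j)" "{i, j} \<notin> F i j" if "Pr i j" for i j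
  proof -
    show "F i (Suc j) = insert {i, j} (F i j)"
    proof -
      have "u < i \<or> u = i \<and> v < Suc j \<longleftrightarrow> u < i \<or> u = i \<and> v < j \<or> u = i \<and> v = j" for u v
        by auto
      then show ?thesis unfolding F_def using that by blast
    qed
    show "{i, j} \<notin> F i j"
    proof
      assume "{i, j} \<in> F i j"
      then obtain u v where "{i, j} = {u, v}" "Pr u v" "u < i \<or> u = i \<and> v < j"
        by (auto simp: F_def)
      with that show False by (auto simp: Pr_def doubleton_eq_iff)
    qed
  qed
  have F_row: "F (Suc i) 0 = F i n" for i
  proof -
    have "Pr u v \<and> (u < Suc i \<or> u = Suc i \<and> v < 0) \<longleftrightarrow> Pr u v \<and> (u < i \<or> u = i \<and> v < n)" for u v
      using E_n[of u v] by (auto simp: Pr_def)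
    then show ?thesis unfolding F_def by simp
  qed
  have F_row_skip: "F (Suc i) 0 = F i 0" if "i \<notin> U" for i
  proof -
    have "Pr u v \<and> (u < Suc i \<or> u = Suc i \<and> v < 0) \<longleftrightarrow> Pr u v \<and> (u < i \<or> u = i \<and> v < 0)" for u v
      using that by (auto simp: Pr_def less_Suc_eq)
    then show ?thesis unfolding F_def by simp
  qed
  have F_n: "F n 0 = inner_edges G Y r"
  proof
    show "F n 0 \<subseteq> inner_edges G Y r"
      by (auto simp: F_def Pr_def inner_edges_def U_def)
    show "inner_edges G Y r \<subseteq> F n 0"
    proof
      fix e assume e: "e \<in> inner_edges G Y r"
      then have "card e = 2" using G by (auto simp: inner_edges_def egraph_def)
      then obtain x y where xy: "e = {x, y}" "x \<noteq> y" by (auto simp: card_2_iff)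
      with e have "Pr x y \<or> Pr y x"
        by (auto simp: inner_edges_def Pr_def U_def insert_commute)
      moreover have "Pr u v \<Longrightarrow> u < n" for u v using U_n by (auto simp: Pr_def)
      ultimately show "e \<in> F n 0"
        unfolding F_def xy(1) by (auto simp: insert_commute)
    qed
  qed
  have F_inner: "F i j \<subseteq> inner_edges G Y r" for i j
    by (auto simp: F_def Pr_def inner_edges_def U_def)
  have W_inner: "W (Inr e) = ereal (wr (Inr e))" if "e \<in> inner_edges G Y r" for e
    using iso.inner_rim_disjoint[OF r(2) b(2) rb] that by (auto simp: W_def sub_weight_def)
  let ?b1 = "NAssign aNb (var vi) N0"
  let ?c = "BAnd (RLess RZero (RCell rW (NAdd (cell aRow vi) (var vj))))
              (orb (BNot (eqb (cell aOwn vj) (NAdd (var vr) N1))) (NLess (var vi) (var vj)))"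
  let ?d = "NAssign aNb (var vj) N1 ;; push (var vi) (var vj) (RCell rW (NAdd (cell aRow vi) (var vj)))"
  let ?b2 = "onlyif ?c ?d"
  let ?b3 = "onlyif (eqb (cell aOwn vi) (NAdd (var vr) N1)) (For vj vn ?b2)"
  let ?c1 = "Cond (orb (eqb (cell aTm vi) N1)
               (BAnd (NLess N0 (cell aOwn vi)) (BNot (eqb (cell aOwn vi) (NAdd (var vr) N1)))))
          (NAssign aSTm (var vi) N1) (NAssign aSTm (var vi) N0)"
  let ?c2 = "Cond (eqb (var vi) (var vr)) (NAssign aSLab (var vi) N1)
          (Cond (BAnd (eqb (cell aSTm vi) N1) (BNot (eqb (cell aOwn vi) (NAdd (var vr) N1))))
             (NAssign aSLab (var vi) (NConst 2)) (NAssign aSLab (var vi) N0))"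
  let ?c3 = "onlyif (BAnd (eqb (cell aNb vi) N1) (BAnd (eqb (cell aTm vi) N0) (eqb (cell aOwn vi) N0)))
          (push (var vi) (var vb) RInf)"
  let ?b4 = "?c1 ;; ?c2 ;; ?c3"
  define s0 where "s0 = ex (setv vem N0) s"
  have b0: "base s0" using s(1) by (simp add: s0_def base_def)
  have e0: "Erep W {} s0" by (simp add: s0_def Erep_def)
  have m0: "nmem s0 aOwn = nmem s aOwn" "nmem s0 vr 0 = r" "nmem s0 vb 0 = b"
    using r b by (simp_all add: s0_def)
  let ?I1 = "\<lambda>i s'. \<forall>v<i. nmem s' aNb v = 0"
  let ?I2 = "\<lambda>i j s'. Erep W (F i j) s' \<and> (\<forall>v<n. nmem s' aNb v = of_bool (\<exists>u. Pr u v \<and> (u < i \<or> u = i \<and> v < j)))"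
  let ?Rim = "\<lambda>i. (\<lambda>z. {z, b}) ` {z \<in> rim G S Y r. z < i}"
  let ?I4 = "\<lambda>i s'. Erep W (inner_edges G Y r \<union> ?Rim i) s' \<and> (\<forall>v<i. nmem s' aSTm v = of_bool (v \<in> terminals G') \<and>
       nmem s' aSLab v = (if v \<in> {r} then 1 else if v \<in> sub_sinks G S Y r then 2 else 0))"
  have "wp (?T - 2) (For vi vn ?b1 ;; For vi vn ?b3 ;; For vi vn ?b4) ?Q s0"
  proof (rule wp_Seq_frame)
    show "wp (n * 5 + 3) (For vi vn ?b1) (?I1 n) s0"
      by (rule wp_For_straight[where I = ?I1 and N = n]) (use b0 in \<open>auto simp: base_def less_Suc_eq\<close>)
    fix s1 assume I1: "?I1 n s1" and sm1: "same (nwr (For vi vn ?b1)) (rwr (For vi vn ?b1)) s0 s1"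
    have b1: "base s1" by (rule base_same[OF b0 sm1]) auto
    have e1: "Erep W (F 0 0) s1"
      using e0 unfolding F_00 by (rule Erep_cong) (simp_all add: same_nmem[OF sm1] same_rmem[OF sm1])
    have m1: "nmem s1 aOwn = nmem s aOwn" "nmem s1 vr 0 = r" "nmem s1 vb 0 = b"
      using m0 by (simp_all add: same_nmem[OF sm1])
    show "wp (?T - 2 - (n * 5 + 3 + 1)) (For vi vn ?b3 ;; For vi vn ?b4) ?Q s1"
    proof (rule wp_Seq_frame)
      show "wp (n * 5 + card U * (14 * n + 3) + 3) (For vi vn ?b3) (?I2 n 0) s1"
      proof (rule wp_For[where I = "\<lambda>i. ?I2 i 0" and N = n and T = "\<lambda>i. if i \<in> U then 14 * n + 4 else 1"])
        show "?I2 0 0 s1" using e1 I1 by simp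
      next
        fix i s' assume i: "i < n" "nmem s' vi 0 = i" and sm: "same (insert vi (nwr ?b3)) (rwr ?b3) s1 s'"
          and I: "?I2 i 0 s'"
        have b': "base s'" by (rule base_same[OF b1 sm]) auto
        have m': "nmem s' aOwn = nmem s aOwn" "nmem s' vr 0 = r"
          using m1 by (simp_all add: same_nmem[OF sm])
        have cond: "bval (eqb (cell aOwn vi) (NAdd (var vr) N1)) s' \<longleftrightarrow> i \<in> U"
          using i m' own_r[OF i(1)] by simp
        show "wp (if i \<in> U then 14 * n + 4 else 1) ?b3 (?I2 (Suc i) 0) s'"
        proof (cases "i \<in> U")
          case True
          have loop: "wp (n * 14 + 3) (For vj vn ?b2) (?I2 i n) s'"
          proof (rule wp_For_straight[where I = "?I2 i" and N = n])
            show "?I2 i 0 s'" by (rule I)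
          next
            fix j s'' assume j: "j < n" "nmem s'' vj 0 = j" and sm': "same (insert vj (nwr ?b2)) (rwr ?b2) s' s''"
              and I': "?I2 i j s''"
            have b'': "base s''" by (rule base_same[OF b' sm']) auto
            have m'': "nmem s'' aOwn = nmem s aOwn" "nmem s'' vr 0 = r" "nmem s'' vi 0 = i"
              using m' i by (simp_all add: same_nmem[OF sm'])
            have row: "nmem s'' aRow i = i * n"
              and w: "rmem s'' rW (i * n + j) = (if {i, j} \<in> edges G then ereal (wr (Inr {i, j})) else 0)"
              using b'' i(1) j(1) by (simp_all add: base_def)
            have "0 < wr (Inr {i, j})" if "{i, j} \<in> edges G"
              using that pos[of "Inr {i, j}"] by (auto simp: elements_def)
            then have c: "bval ?c s'' \<longleftrightarrow> Pr i j"
              using m'' row w j own_r[OF j(1)] True by (auto simp: Pr_def)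
            show "?I2 i (Suc j) (ex ?b2 s'')"
            proof (cases "Pr i j")
              case True
              then have ex: "ex ?b2 s'' = ex ?d s''" using c by (simp only: ex.simps if_True)
              have ij: "{i, j} \<in> edges G" using True by (simp add: Pr_def)
              then have Wij: "W (Inr {i, j}) = rmem s'' rW (i * n + j)"
                using True w by (subst W_inner) (auto simp: inner_edges_def Pr_def U_def)
              have "Erep W (F i (Suc j)) (ex ?d s'')"
                unfolding F_push(1)[OF True] using I' F_push(2)[OF True]
                by (rule Erep_push[OF conjunct1]) (use m'' j row Wij in simp_all)
              moreover have "nmem (ex ?d s'') aNb = (nmem s'' aNb)(j := 1)"
                using j by simp
              ultimately show ?thesis unfolding ex using I' True by (auto simp: less_Suc_eq)
            next
              case False
              then have ex: "ex ?b2 s'' = s''" using c by (simp only: ex.simps if_False)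
              have "(\<exists>u. Pr u v \<and> (u < i \<or> u = i \<and> v < Suc j)) \<longleftrightarrow> (\<exists>u. Pr u v \<and> (u < i \<or> u = i \<and> v < j))" for v
                using False by (auto simp: less_Suc_eq)
              then show ?thesis unfolding ex F_skip[OF False] using I' by simp
            qed
          qed (use b' in \<open>auto simp: base_def Erep_def\<close>)
          have row_end: "?I2 (Suc i) 0 s''" if I3: "?I2 i n s''" for s'' :: state
          proof -
            have "(u < Suc i \<or> u = Suc i \<and> v < 0) \<longleftrightarrow> (u < i \<or> u = i \<and> v < n)" if "v < n" for u v :: nat
              using that by auto
            then show ?thesis unfolding F_row using I3 by simp
          qed
          have "wp (14 * n + 3) (For vj vn ?b2) (?I2 (Suc i) 0) s'"
            by (rule wp_weaken[OF loop _ row_end]) simp_all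
          from wp_Cond_True[OF cond[THEN iffD2, OF True] this] show ?thesis
            using True by simp
        next
          case False
          then have ncond: "\<not> bval (eqb (cell aOwn vi) (NAdd (var vr) N1)) s'"
            using cond by blast
          have "(\<exists>u. Pr u v \<and> (u < Suc i \<or> u = Suc i \<and> v < 0)) \<longleftrightarrow> (\<exists>u. Pr u v \<and> (u < i \<or> u = i \<and> v < 0))" for v
            using False by (auto simp: less_Suc_eq Pr_def)
          then have "?I2 (Suc i) 0 s'"
            unfolding F_row_skip[OF False] using I by simp
          then show ?thesis
            using False by (intro wp_onlyif_False[OF ncond]) simp_all
        qed
      next
        have "(\<Sum>i<n. (if i \<in> U then 14 * n + 4 else 1) + 4) = (\<Sum>i<n. 5 + (if i \<in> U then 14 * n + 3 else 0))"
          by (intro sum.cong) auto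
        also have "\<dots> = n * 5 + card ({..<n} \<inter> U) * (14 * n + 3)"
          by (simp add: sum.distrib sum.If_cases Int_def)
        also have "{..<n} \<inter> U = U" using U_n by auto
        finally show "(\<Sum>i<n. (if i \<in> U then 14 * n + 4 else 1) + 4) + 3 \<le> n * 5 + card U * (14 * n + 3) + 3"
          by simp
      qed (use b1 in \<open>auto simp: base_def Erep_def\<close>)
      fix s2 assume I2: "?I2 n 0 s2" and sm2: "same (nwr (For vi vn ?b3)) (rwr (For vi vn ?b3)) s1 s2"
      have b2: "base s2" by (rule base_same[OF b1 sm2]) auto
      have m2: "nmem s2 aOwn = nmem s aOwn" "nmem s2 vr 0 = r" "nmem s2 vb 0 = b"
        using m1 by (simp_all add: same_nmem[OF sm2])
      have nb: "nmem s2 aNb v = of_bool (\<exists>u. Pr u v)" if "v < n" for v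
      proof -
        have "Pr u v \<Longrightarrow> u < n" for u using U_n by (auto simp: Pr_def)
        then show ?thesis using I2 that by auto
      qed
      show "wp (?T - 2 - (n * 5 + 3 + 1) - (n * 5 + card U * (14 * n + 3) + 3 + 1)) (For vi vn ?b4) ?Q s2"
      proof (rule wp_weaken)
        show "wp (n * 19 + 3) (For vi vn ?b4) (?I4 n) s2"
        proof (rule wp_For_straight[where I = ?I4 and N = n])
          show "?I4 0 s2" using I2 F_n by simp
        next
          fix i s' assume i: "i < n" "nmem s' vi 0 = i" and sm: "same (insert vi (nwr ?b4)) (rwr ?b4) s2 s'"
            and I: "?I4 i s'"
          have b': "base s'" by (rule base_same[OF b2 sm]) auto
          have m': "nmem s' aOwn = nmem s aOwn" "nmem s' vr 0 = r" "nmem s' vb 0 = b" "nmem s' aNb = nmem s2 aNb"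
            using m2 by (simp_all add: same_nmem[OF sm])
          have tm: "nmem s' aTm i = of_bool (i \<in> terminals G)" using b' i by (simp add: base_def)
          have trm: "i \<in> terminals G' \<longleftrightarrow> nmem s' aTm i = 1 \<or> 0 < nmem s' aOwn i \<and> nmem s' aOwn i \<noteq> Suc r"
          proof -
            have "0 < nmem s' aOwn i \<and> nmem s' aOwn i \<noteq> Suc r \<longleftrightarrow> (\<exists>r'\<in>S - {r}. i \<in> comp_of G Y r')"
            proof
              assume "0 < nmem s' aOwn i \<and> nmem s' aOwn i \<noteq> Suc r"
              then show "\<exists>r'\<in>S - {r}. i \<in> comp_of G Y r'"
                using own_0[OF i(1)] own_r[OF i(1)] m'(1) unfolding U_def by auto
            next
              assume "\<exists>r'\<in>S - {r}. i \<in> comp_of G Y r'"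
              then obtain r' where r': "r' \<in> S" "r' \<noteq> r" "i \<in> comp_of G Y r'" by blast
              then have "i \<notin> U" using iso.U_disjoint[OF r(2) r'(1)] by (auto simp: U_def)
              then show "0 < nmem s' aOwn i \<and> nmem s' aOwn i \<noteq> Suc r"
                using own_0[OF i(1)] own_r[OF i(1)] m'(1) r' by auto
            qed
            then show ?thesis using tm by (auto simp: G'_def sub_graph_def)
          qed
          have sink: "i \<in> sub_sinks G S Y r \<longleftrightarrow> i \<in> terminals G' \<and> nmem s' aOwn i \<noteq> Suc r"
            using own_r[OF i(1)] m'(1) by (auto simp: G'_def sub_graph_def sub_sinks_def U_def)
          have rim: "i \<in> rim G S Y r \<longleftrightarrow> nmem s' aNb i = 1 \<and> nmem s' aTm i = 0 \<and> nmem s' aOwn i = 0"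
          proof -
            have N: "i \<in> free_nonterminals G S Y \<longleftrightarrow> nmem s' aTm i = 0 \<and> nmem s' aOwn i = 0"
              using own_0[OF i(1)] tm m'(1) i(1) V by (auto simp: free_nonterminals_def nonterminals_def)
            have "(\<exists>u\<in>U. {u, i} \<in> edges G) \<longleftrightarrow> nmem s' aNb i = 1" if "i \<in> free_nonterminals G S Y"
              using that iso.N0_U[OF r(2)] nb[OF i(1)] m'(4) by (auto simp: Pr_def U_def)
            with N show ?thesis by (auto simp: rim_def U_def)
          qed
          define s3 where "s3 = ex ?c2 (ex ?c1 s')"
          have tm3: "nmem s3 aSTm = (nmem s' aSTm)(i := of_bool (i \<in> terminals G'))"
            using i m' trm by (auto simp: s3_def)
          have lab3: "nmem s3 aSLab = (nmem s' aSLab)(i := (if i \<in> {r} then 1 else if i \<in> sub_sinks G S Y r then 2 else 0))"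
            using i m' trm sink by (auto simp: s3_def)
          have eq3: "nmem s3 a = nmem s' a" if "a \<noteq> aSTm" "a \<noteq> aSLab" for a
            using that by (simp add: s3_def)
          have req3: "rmem s3 = rmem s'" by (simp add: s3_def)
          have e3: "Erep W (inner_edges G Y r \<union> ?Rim i) s3"
            using conjunct1[OF I] by (rule Erep_cong) (simp_all add: eq3 req3)
          have c3: "bval (BAnd (eqb (cell aNb vi) N1) (BAnd (eqb (cell aTm vi) N0) (eqb (cell aOwn vi) N0))) s3 \<longleftrightarrow> i \<in> rim G S Y r"
            using rim i by (auto simp: eq3)
          have ex4: "ex ?b4 s' = (if i \<in> rim G S Y r then ex (push (var vi) (var vb) RInf) s3 else s3)"
            using c3 unfolding s3_def by (simp only: ex.simps)
          have mem4: "nmem (ex ?b4 s') aSTm = nmem s3 aSTm" "nmem (ex ?b4 s') aSLab = nmem s3 aSLab"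
            unfolding ex4 by auto
          have "Erep W (inner_edges G Y r \<union> ?Rim (Suc i)) (ex ?b4 s')"
          proof (cases "i \<in> rim G S Y r")
            case True
            have Rim: "inner_edges G Y r \<union> ?Rim (Suc i) = insert {i, b} (inner_edges G Y r \<union> ?Rim i)"
              using True by (auto simp: less_Suc_eq)
            have ib: "{i, b} \<in> rim_edges G S Y r b" using True by (auto simp: rim_edges_def)
            then have "{i, b} \<notin> inner_edges G Y r"
              using iso.inner_rim_disjoint[OF r(2) b(2) rb] by auto
            moreover have "{i, b} \<notin> ?Rim i"
              using True iso.rim_N0[of r] iso.N0_nonterminals b(2) ST by (auto simp: doubleton_eq_iff nonterminals_def)
            ultimately have new: "{i, b} \<notin> inner_edges G Y r \<union> ?Rim i" by blast
            have Wib: "W (Inr {i, b}) = \<infinity>" using ib by (auto simp: W_def sub_weight_def)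
            show ?thesis
              unfolding Rim ex4 if_P[OF True] using e3 new
              by (rule Erep_push) (use i m' Wib in \<open>simp_all add: eq3\<close>)
          next
            case False
            then have "?Rim (Suc i) = ?Rim i" by (auto simp: less_Suc_eq)
            then show ?thesis unfolding ex4 using e3 False by simp
          qed
          then show "?I4 (Suc i) (ex ?b4 s')"
            unfolding mem4 tm3 lab3 using conjunct2[OF I] by (simp add: less_Suc_eq)
        qed (use b2 in \<open>auto simp: base_def Erep_def\<close>)
      next
        fix s' assume I4: "?I4 n s'"
        have "z < n" if "z \<in> rim G S Y r" for z
          using that iso.rim_N0[of r] iso.N0_nonterminals V by (auto simp: nonterminals_def)
        then have "{z \<in> rim G S Y r. z < n} = rim G S Y r" by auto
        then have "inner_edges G Y r \<union> ?Rim n = edges G'"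
          by (simp add: G'_def sub_graph_def rim_edges_def)
        with I4 show "?Q s'" by simp
      qed (simp add: U_def algebra_simps)
    qed (simp add: U_def algebra_simps)
  qed simp
  then show ?thesis
    unfolding build_def s0_def by (rule wp_straight_Seq[rotated 2, OF wp_time_mono]) simp_all
qed

end

text \<open>The maximum ranges over \<open>n\<close> instances numbered from 1; vertices are shifted
  by one, and those outside \<open>S\<close> stand for instances without edges.\<close>

lemma split_time_le:
  assumes S: "S \<subseteq> {..<n}" and ms: "(\<Sum>r\<in>S. ms r) \<le> 2 * m"
  shows "(\<Sum>r\<in>S. Tec (ms r) n) \<le> max_split_time Tec m n"
proof -
  define ms' where "ms' i = (if i - 1 \<in> S then ms (i - 1) else 0)" for i :: nat
  have shift: "(\<Sum>i=1..n. f i) = (\<Sum>r<n. f (Suc r))" for f :: "nat \<Rightarrow> nat"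
    by (rule sum.reindex_bij_witness[of _ Suc "\<lambda>i. i - 1"]) auto
  have "(\<Sum>i=1..n. ms' i) = (\<Sum>r<n. if r \<in> S then ms r else 0)"
    unfolding shift by (intro sum.cong) (auto simp: ms'_def)
  also have "\<dots> = (\<Sum>r\<in>S. ms r)"
    using S by (simp add: sum.If_cases Int_absorb1)
  finally have "(\<Sum>i=1..n. ms' i) \<le> 2 * m" using ms by simp
  then have "(\<Sum>i=1..n. Tec (ms' i) n) \<le> max_split_time Tec m n"
    unfolding max_split_time_def by (intro Max_ge finite_split_times) blast
  moreover have "(\<Sum>r\<in>S. Tec (ms r) n) \<le> (\<Sum>i=1..n. Tec (ms' i) n)"
  proof -
    have "(\<Sum>r\<in>S. Tec (ms r) n) = (\<Sum>r\<in>S. Tec (ms' (Suc r)) n)"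
      by (intro sum.cong) (auto simp: ms'_def)
    also have "\<dots> \<le> (\<Sum>r<n. Tec (ms' (Suc r)) n)"
      using S by (intro sum_mono2) auto
    finally show ?thesis unfolding shift .
  qed
  ultimately show ?thesis by linarith
qed

context graph_data
begin

lemma evaluate_spec:
  assumes s: "base s" "Erep W F s" and X: "finite X"
    and Xv: "\<And>v. Inl v \<in> X \<Longrightarrow> v < n \<and> rmem s rV v = W (Inl v)" and Xe: "\<And>e. Inr e \<in> X \<Longrightarrow> e \<in> F"
    and cv: "\<And>v. v < n \<Longrightarrow> nmem s aCutVertex v = of_bool (Inl v \<in> X)"
    and ce: "\<And>i. i < card F \<Longrightarrow> nmem s aCutEdge i = of_bool (Inr {nmem s aST i, nmem s aSH i} \<in> X)"
  shows "wp (6 * n + 6 * card F + 13) evaluate (\<lambda>s'. rmem s' rBest 0 = min (rmem s rBest 0) (sum W X)) s"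
    (is "wp ?T _ ?Q s")
  unfolding evaluate_def
proof (rule wp_straight_Seq, simp, simp)
  let ?b1 = "onlyif (eqb (NCell aCutVertex (var vi)) N1) (setr rVal (RAdd (rvar rVal) (rcell rV vi)))"
  let ?b2 = "onlyif (eqb (NCell aCutEdge (var vi)) N1) (setr rVal (RAdd (rvar rVal) (rcell rS vi)))"
  let ?b3 = "onlyif (RLess (rvar rVal) (rvar rBest)) (setr rBest (rvar rVal))"
  let ?e = "\<lambda>i. {nmem s aST i, nmem s aSH i}"
  define s0 where "s0 = ex (setr rVal RZero) s"
  have b0: "base s0" using s(1) by (simp add: s0_def base_def)
  let ?f = "\<lambda>v. if Inl v \<in> X then W (Inl v) else 0" and ?g = "\<lambda>i. if Inr (?e i) \<in> X then W (Inr (?e i)) else 0"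
  let ?I1 = "\<lambda>i s'. rmem s' rVal 0 = (\<Sum>v<i. ?f v)"
  let ?I2 = "\<lambda>i s'. rmem s' rVal 0 = (\<Sum>v<n. ?f v) + (\<Sum>j<i. ?g j)"
  have total: "sum W X = (\<Sum>v<n. ?f v) + (\<Sum>j<card F. ?g j)"
  proof -
    have F: "?e ` {..<card F} = F" using s(2) by (simp add: Erep_def)
    \<comment> \<open>The list has as many entries as there are edges, so no edge occurs twice and
      no weight is added twice.\<close>
    then have inj: "inj_on ?e {..<card F}" by (intro eq_card_imp_inj_on) simp_all
    let ?A = "{v. Inl v \<in> X}" and ?B = "{e. Inr e \<in> X}"
    have XAB: "X = Inl ` ?A \<union> Inr ` ?B"
    proof
      show "X \<subseteq> Inl ` ?A \<union> Inr ` ?B"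
      proof
        fix x assume "x \<in> X" then show "x \<in> Inl ` ?A \<union> Inr ` ?B" by (cases x) auto
      qed
    qed auto
    have fin: "finite ?A" "finite ?B"
      using X by (auto intro: finite_vimageI[of X Inl, unfolded vimage_def] finite_vimageI[of X Inr, unfolded vimage_def])
    have "sum W X = sum W (Inl ` ?A) + sum W (Inr ` ?B)"
      by (subst XAB, rule sum.union_disjoint) (use fin in auto)
    also have "sum W (Inl ` ?A) = (\<Sum>v\<in>?A. W (Inl v))"
      by (subst sum.reindex) (auto simp: o_def)
    also have "\<dots> = (\<Sum>v<n. ?f v)"
      using Xv by (intro sum.mono_neutral_cong_left) auto
    also have "sum W (Inr ` ?B) = (\<Sum>e\<in>?B. W (Inr e))"
      by (subst sum.reindex) (auto simp: o_def)
    also have "\<dots> = (\<Sum>e\<in>F. if Inr e \<in> X then W (Inr e) else 0)"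
      using Xe s(2) by (intro sum.mono_neutral_cong_left) (auto simp: Erep_def)
    also have "\<dots> = (\<Sum>e\<in>?e ` {..<card F}. if Inr e \<in> X then W (Inr e) else 0)"
      unfolding F ..
    also have "\<dots> = (\<Sum>j<card F. ?g j)"
      using inj by (subst sum.reindex) (auto simp: o_def)
    finally show ?thesis .
  qed
  have "wp (?T - 2) (For vi vn ?b1 ;; For vi vem ?b2 ;; ?b3) ?Q s0"
  proof (rule wp_Seq_frame)
    show "wp (n * 6 + 3) (For vi vn ?b1) (?I1 n) s0"
    proof (rule wp_For_straight[where I = ?I1 and N = n])
      fix i s' assume i: "i < n" "nmem s' vi 0 = i" and sm: "same (insert vi (nwr ?b1)) (rwr ?b1) s0 s'"
        and I: "?I1 i s'"
      have "nmem s' 5 i = of_bool (Inl i \<in> X)" "rmem s' rV = rmem s rV"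
        using cv[OF i(1)] by (simp_all add: same_nmem[OF sm] same_rmem[OF sm] s0_def)
      then show "?I1 (Suc i) (ex ?b1 s')"
        using i I Xv[of i] by auto
    qed (use b0 in \<open>auto simp: base_def s0_def\<close>)
    fix s1 assume I1: "?I1 n s1" and sm1: "same (nwr (For vi vn ?b1)) (rwr (For vi vn ?b1)) s0 s1"
    have 1: "nmem s1 aST = nmem s aST" "nmem s1 aSH = nmem s aSH" "nmem s1 vem 0 = card F"
      "rmem s1 rS = rmem s rS" "nmem s1 6 = nmem s 6" "rmem s1 rBest 0 = rmem s rBest 0"
      using s(2) by (simp_all add: same_nmem[OF sm1] same_rmem[OF sm1] s0_def Erep_def)
    show "wp (?T - 2 - (n * 6 + 3 + 1)) (For vi vem ?b2 ;; ?b3) ?Q s1"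
    proof (rule wp_Seq_frame)
      show "wp (card F * 6 + 3) (For vi vem ?b2) (?I2 (card F)) s1"
      proof (rule wp_For_straight[where I = ?I2 and N = "card F"])
        show "?I2 0 s1" using I1 by simp
      next
        fix i s' assume i: "i < card F" "nmem s' vi 0 = i" and sm: "same (insert vi (nwr ?b2)) (rwr ?b2) s1 s'"
          and I: "?I2 i s'"
        have "nmem s' 6 i = of_bool (Inr (?e i) \<in> X)" "rmem s' rS i = W (Inr (?e i))"
          using ce[OF i(1)] 1 s(2) i(1) by (simp_all add: same_nmem[OF sm] same_rmem[OF sm] Erep_def)
        then show "?I2 (Suc i) (ex ?b2 s')"
          using i I by (auto simp: add.assoc)
      qed (use 1 in auto)
      fix s2 assume I2: "?I2 (card F) s2" and sm2: "same (nwr (For vi vem ?b2)) (rwr (For vi vem ?b2)) s1 s2"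
      have "rmem s2 rVal 0 = sum W X" "rmem s2 rBest 0 = rmem s rBest 0"
        using I2 total 1 by (simp_all add: same_rmem[OF sm2])
      then show "wp (?T - 2 - (n * 6 + 3 + 1) - (card F * 6 + 3 + 1)) ?b3 ?Q s2"
        by (intro wp_straight) (auto simp: min_def)
    qed simp
  qed simp
  then show "wp (?T - (tm (setr rVal RZero) + 1)) (For vi vn ?b1 ;; For vi vem ?b2 ;; ?b3) ?Q (ex (setr rVal RZero) s)"
    unfolding s0_def by simp
qed

text \<open>Soundness of the best value, valid for every coin outcome: it is never smaller than the
  capped optimum.\<close>

definition attained :: "ereal \<Rightarrow> bool" where
  "attained c \<longleftrightarrow> c = \<infinity> \<or> (\<exists>r\<in>R. \<exists>b\<in>R. r \<noteq> b \<and> (\<exists>X. element_cut G {r} {b} X \<and> c = ereal (sum wr X)))"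

text \<open>The counterpart of \<open>attained\<close>: no biset isolating \<open>r\<close> within
  the sample is cheaper. Both hold without luck; chance only decides whether an optimal cut isolates
  a sampled terminal.\<close>

definition below :: "nat set \<Rightarrow> nat \<Rightarrow> ereal \<Rightarrow> bool" where
  "below S r c \<longleftrightarrow> (\<forall>A B. biset G A B \<longrightarrow> A \<inter> S = {r} \<longrightarrow> c \<le> ereal (sum wr (boundary G A B)))"

lemma below_mono: "below S r c \<Longrightarrow> c' \<le> c \<Longrightarrow> below S r c'"
  unfolding below_def by (meson order_trans)

definition partner :: "state \<Rightarrow> nat \<Rightarrow> nat" where
  "partner s r = (if r = nmem s vfst 0 then nmem s vlst 0 else nmem s vfst 0)"

lemma sub_cut_spec:
  assumes s: "base s" "owned S Y s" and S: "S \<subseteq> R" and iso: "isolating G wr S {(r, r'). r \<noteq> r'} Y"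
    and r: "nmem s vr 0 = r" "r \<in> S" and b: "partner s r = b" "b \<in> S" "b \<noteq> r"
    and best: "attained (rmem s rBest 0)"
  defines "mr \<equiv> card (edges (sub_graph G S Y r b))"
  shows "wp (Tec mr n + 15 * mr + 44 * n + card (comp_of G Y r) * (14 * n + 4) + 50) sub_cut
    (\<lambda>s'. attained (rmem s' rBest 0) \<and> rmem s' rBest 0 \<le> rmem s rBest 0 \<and> below S r (rmem s' rBest 0)) s"
    (is "wp ?T _ ?Q s")
proof -
  have ST: "S \<subseteq> terminals G" using S R by auto
  interpret iso: isolated G wr S Y
    by (rule isolated.intro[OF G pos ST iso])
  have rb: "r \<noteq> b" using b(3) by simp
  define W where "W = sub_weight G wr S Y r b"
  define G' where "G' = sub_graph G S Y r b"
  define B' where "B' = sub_sinks G S Y r"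
  let ?c0 = "Cond (eqb (var vr) (var vfst)) (setv vb (var vlst)) (setv vb (var vfst))"
  define s0 where "s0 = ex ?c0 s"
  have s0: "nmem s0 a = nmem s a" if "a \<noteq> vb" for a
    using that by (simp add: s0_def)
  have s0': "rmem s0 = rmem s" "nmem s0 vb 0 = b"
    using b(1) r by (auto simp: s0_def partner_def)
  have b0: "base s0" "owned S Y s0" "nmem s0 vr 0 = r" "nmem s0 vb 0 = b"
    using s r s0' by (simp_all add: base_def owned_def s0)
  have V': "verts G' = {..<n}" using V by (simp add: G'_def sub_graph_def)
  have main: "wp (?T - 3) (build ;; call_cut aST aSH rS vem aSTm aSLab ;; evaluate) ?Q s0"
  proof (rule wp_Seq_frame[OF build_spec[OF b0(1,2) S iso b0(3) r(2) b0(4) b(2) rb], folded W_def G'_def B'_def])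
    fix s1 :: state
    assume 1: "Erep W (edges G') s1 \<and> (\<forall>v<n. nmem s1 aSTm v = of_bool (v \<in> terminals G') \<and>
       nmem s1 aSLab v = (if v \<in> {r} then 1 else if v \<in> B' then 2 else 0))"
      and sm1: "same (nwr build) (rwr build) s0 s1"
    have e1: "Erep W (edges G') s1" using 1 by blast
    have b1: "base s1" by (rule base_same[OF b0(1) sm1]) auto
    have mr: "mr = card (edges G')" by (simp add: mr_def G'_def)
    have best1: "rmem s1 rBest 0 = rmem s rBest 0" using s0' by (simp add: same_rmem[OF sm1])
    have call: "wp (Tec mr n + 9 * mr + 9 * n + 12) (call_cut aST aSH rS vem aSTm aSLab)
      (\<lambda>s'. \<exists>X. min_element_cut G' W {r} B' X \<and>
        (\<forall>v<n. nmem s' aCutVertex v = of_bool (Inl v \<in> X)) \<and>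
        (\<forall>i<mr. nmem s' aCutEdge i = of_bool (Inr {nmem s1 aST i, nmem s1 aSH i} \<in> X))) s1"
    proof (rule call_cut_spec[OF solver])
      show "egraph G'" unfolding G'_def by (rule iso.sub_graph_egraph[OF r(2) b(2) rb])
      show "positive_weights G' W" unfolding G'_def W_def by (rule iso.sub_positive[OF r(2) b(2) rb])
      show "{r} \<subseteq> terminals G'" "B' \<subseteq> terminals G'" "B' \<noteq> {}" "{r} \<inter> B' = {}"
        using iso.sub_sides[OF r(2) b(2) rb] unfolding G'_def B'_def by blast+
      show "nmem s1 aSLab v = (if v \<in> {r} then 1 else if v \<in> B' then 2 else 0)" if "v < n" for v
        using 1 that by blast
      show "nmem s1 aSTm v = of_bool (v \<in> terminals G')" if "v < n" for v
        using 1 that by blast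
      show "edges G' = (\<lambda>i. {nmem s1 aST i, nmem s1 aSH i}) ` {..<mr}"
        using e1 mr by (simp add: Erep_def)
      show "nmem s1 vem 0 = mr" "mr = card (edges G')"
        using e1 mr by (simp_all add: Erep_def)
      show "rmem s1 rS i = W (Inr {nmem s1 aST i, nmem s1 aSH i})" if "i < mr" for i
        using e1 mr that by (simp add: Erep_def)
      show "nmem s1 vn 0 = n" using b1 by (simp add: base_def)
      show "rmem s1 rV v = W (Inl v)" if "v \<in> nonterminals G'" for v
        using b1 that iso.nonterminals_sub_graph[OF r(2) b(2) rb]
        by (auto simp: base_def G'_def W_def sub_weight_def)
    qed (use V' in simp_all)
    show "wp (?T - 3 - (29 * n + card (comp_of G Y r) * (14 * n + 4) + 15 + 1))
        (call_cut aST aSH rS vem aSTm aSLab ;; evaluate) ?Q s1"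
    proof (rule wp_Seq_frame[OF call])
      fix s2 :: state
      assume "\<exists>X. min_element_cut G' W {r} B' X \<and>
        (\<forall>v<n. nmem s2 aCutVertex v = of_bool (Inl v \<in> X)) \<and>
        (\<forall>i<mr. nmem s2 aCutEdge i = of_bool (Inr {nmem s1 aST i, nmem s1 aSH i} \<in> X))"
      then obtain X where X: "min_element_cut G' W {r} B' X"
        and Xv: "\<And>v. v < n \<Longrightarrow> nmem s2 aCutVertex v = of_bool (Inl v \<in> X)"
        and Xe: "\<And>i. i < mr \<Longrightarrow> nmem s2 aCutEdge i = of_bool (Inr {nmem s1 aST i, nmem s1 aSH i} \<in> X)"
        by blast
      assume sm2: "same (nwr (call_cut aST aSH rS vem aSTm aSLab)) (rwr (call_cut aST aSH rS vem aSTm aSLab)) s1 s2"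
      have b2: "base s2" by (rule base_same[OF b1 sm2]) auto
      have e2: "Erep W (edges G') s2"
        using e1 by (rule Erep_cong) (simp_all add: same_nmem[OF sm2] same_rmem[OF sm2])
      have best2: "rmem s2 rBest 0 = rmem s rBest 0" using best1 by (simp add: same_rmem[OF sm2])
      have cut: "element_cut G' {r} B' X" using X by (simp add: min_element_cut_def)
      then have Xel: "X \<subseteq> elements G'" by (simp add: element_cut_def)
      have finX: "finite X"
        using Xel finite_elements[OF iso.sub_graph_egraph[OF r(2) b(2) rb]] unfolding G'_def by (rule finite_subset)
      have ev: "wp (6 * n + 6 * card (edges G') + 13) evaluate (\<lambda>s'. rmem s' rBest 0 = min (rmem s2 rBest 0) (sum W X)) s2"
      proof (rule evaluate_spec[OF b2 e2 finX])
        fix v assume "Inl v \<in> X"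
        then have "v \<in> nonterminals G'" using Xel by (auto simp: elements_def)
        then have "v \<in> nonterminals G" using iso.nonterminals_sub_graph[OF r(2) b(2) rb] by (auto simp: G'_def)
        then show "v < n \<and> rmem s2 rV v = W (Inl v)"
          using b2 V by (auto simp: base_def nonterminals_def W_def sub_weight_def)
      next
        fix e assume "Inr e \<in> X" then show "e \<in> edges G'" using Xel by (auto simp: elements_def)
      next
        fix i assume "i < card (edges G')"
        then show "nmem s2 aCutEdge i = of_bool (Inr {nmem s2 aST i, nmem s2 aSH i} \<in> X)"
          using Xe mr by (simp add: same_nmem[OF sm2])
      qed (rule Xv)
      show "wp (?T - 3 - (29 * n + card (comp_of G Y r) * (14 * n + 4) + 15 + 1) - (Tec mr n + 9 * mr + 9 * n + 12 + 1))
        evaluate ?Q s2"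
      proof (rule wp_weaken[OF ev])
        fix s' :: state
        assume s': "rmem s' rBest 0 = min (rmem s2 rBest 0) (sum W X)"
        have up: "below S r (sum W X)"
          unfolding below_def W_def using iso.sub_cut_upper[OF r(2) b(2) rb, folded G'_def B'_def W_def, OF X]
          unfolding W_def by blast
        have att: "attained (sum W X)"
        proof (cases "sum W X = \<infinity>")
          case False
          note low = iso.sub_cut_lower[OF r(2) b(2) rb, folded G'_def B'_def W_def, OF cut False]
          show ?thesis unfolding attained_def using low rb r(2) b(2) S by blast
        qed (simp add: attained_def)
        have "attained (min (rmem s rBest 0) (sum W X))"
          using best att by (simp add: min_def)
        moreover have "below S r (min (rmem s rBest 0) (sum W X))"
          using up by (rule below_mono) simp
        ultimately show "?Q s'" unfolding s' best2 by simp
      qed (simp add: mr)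
    qed simp
  qed simp
  show ?thesis
    unfolding sub_cut_def
    by (rule wp_straight_Seq, simp, simp, rule wp_time_mono[OF main[unfolded s0_def]], simp)
qed

text \<open>The solver calls are covered by the split maximum, since the edge numbers add up to at
  most \<open>2 * m\<close>. The row scans take quadratic time because the disjoint components have
  at most \<open>n\<close> vertices together.\<close>

lemma sub_cuts_spec:
  assumes s: "base s" "Srep S s" "owned S Y s" and S: "S \<subseteq> R" and iso: "isolating G wr S {(r, r'). r \<noteq> r'} Y"
    and fl: "nmem s vfst 0 \<in> S" "nmem s vlst 0 \<in> S" "nmem s vfst 0 \<noteq> nmem s vlst 0"
    and best: "attained (rmem s rBest 0)"
  shows "wp (max_split_time Tec m n + 30 * m + 58 * (n * n) + 63 * n + 3) sub_cuts
    (\<lambda>s'. attained (rmem s' rBest 0) \<and> rmem s' rBest 0 \<le> rmem s rBest 0 \<and> (\<forall>r\<in>S. below S r (rmem s' rBest 0))) s"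
    (is "wp ?T _ ?Q s")
proof -
  have ST: "S \<subseteq> terminals G" using S R by auto
  interpret iso: isolated G wr S Y
    by (rule isolated.intro[OF G pos ST iso])
  define pt where "pt = partner s"
  have pt: "pt r \<in> S" "pt r \<noteq> r" for r
    using fl by (auto simp: pt_def partner_def)
  define mr where "mr r = card (edges (sub_graph G S Y r (pt r)))" for r
  let ?U = "\<lambda>r. card (comp_of G Y r)"
  let ?t = "\<lambda>r. Tec (mr r) n + 15 * mr r + 44 * n + ?U r * (14 * n + 4) + 50"
  let ?b = "onlyif (eqb (cell aS vr) N1) sub_cut"
  let ?I = "\<lambda>i s'. attained (rmem s' rBest 0) \<and> rmem s' rBest 0 \<le> rmem s rBest 0 \<and>
      (\<forall>r\<in>S. r < i \<longrightarrow> below S r (rmem s' rBest 0))"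
  have S_n: "r < n" if "r \<in> S" for r using that S R_n by auto
  have finS: "finite S" using S finite_R by (rule finite_subset)
  have "wp ?T (For vr vn ?b) (?I n) s"
  proof (rule wp_For[where I = ?I and N = n and T = "\<lambda>r. if r \<in> S then ?t r + 1 else 1"])
    fix i s' assume i: "i < n" "nmem s' vr 0 = i" and sm: "same (insert vr (nwr ?b)) (rwr ?b) s s'"
      and I: "?I i s'"
    have b': "base s'" by (rule base_same[OF s(1) sm]) auto
    have aS: "nmem s' aS i = of_bool (i \<in> S)" using s(2) i by (simp add: Srep_def same_nmem[OF sm])
    have own: "owned S Y s'" using s(3) by (simp add: owned_def same_nmem[OF sm])
    have pt': "partner s' i = pt i" by (simp add: partner_def pt_def same_nmem[OF sm])
    show "wp (if i \<in> S then ?t i + 1 else 1) ?b (?I (Suc i)) s'"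
    proof (cases "i \<in> S")
      case True
      then have c: "bval (eqb (cell aS vr) N1) s'" using aS i by simp
      have "wp (?t i) sub_cut (\<lambda>s''. attained (rmem s'' rBest 0) \<and> rmem s'' rBest 0 \<le> rmem s' rBest 0 \<and>
          below S i (rmem s'' rBest 0)) s'"
        using sub_cut_spec[OF b' own S iso i(2) True pt' pt conjunct1[OF I]] by (simp add: mr_def)
      then have "wp (?t i) sub_cut (?I (Suc i)) s'"
      proof (rule wp_conseq)
        fix s'' :: state
        assume q: "attained (rmem s'' rBest 0) \<and> rmem s'' rBest 0 \<le> rmem s' rBest 0 \<and>
          below S i (rmem s'' rBest 0)"
        have "below S r (rmem s'' rBest 0)" if "r \<in> S" "r < Suc i" for r
        proof (cases "r = i")
          case False
          then have "below S r (rmem s' rBest 0)" using I that by auto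
          then show ?thesis using q by (blast intro: below_mono)
        qed (use q in simp)
        moreover have "rmem s'' rBest 0 \<le> rmem s rBest 0" using q I by (blast intro: order_trans)
        ultimately show "?I (Suc i) s''" using q by blast
      qed
      from wp_Cond_True[OF c this] show ?thesis using True by simp
    next
      case False
      then have c: "\<not> bval (eqb (cell aS vr) N1) s'" using aS i by simp
      have "?I (Suc i) s'" using I False by (auto simp: less_Suc_eq)
      then show ?thesis using wp_onlyif_False[OF c] False by simp
    qed
  next
    have mr_sum: "(\<Sum>r\<in>S. mr r) \<le> 2 * m"
      unfolding mr_def using iso.sum_card_sub_edges[of pt] pt cE by simp
    have U_sum: "(\<Sum>r\<in>S. ?U r) \<le> n"
    proof -
      have "(\<Sum>r\<in>S. ?U r) = card (\<Union>r\<in>S. comp_of G Y r)"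
      proof (rule card_UN_disjoint[symmetric])
        show "\<forall>r\<in>S. finite (comp_of G Y r)"
          using iso.U_verts V by (auto intro: finite_subset[of _ "{..<n}"])
        show "\<forall>r\<in>S. \<forall>r'\<in>S. r \<noteq> r' \<longrightarrow> comp_of G Y r \<inter> comp_of G Y r' = {}"
          using iso.U_disjoint by blast
      qed fact
      also have "\<dots> \<le> card {..<n}"
        using iso.U_verts V by (intro card_mono) auto
      finally show ?thesis by simp
    qed
    have cS: "card S \<le> n"
      using card_mono[of "{..<n}" S] S_n by auto
    have "(\<Sum>i<n. (if i \<in> S then ?t i + 1 else 1) + 4) = (\<Sum>i<n. 5 + (if i \<in> S then ?t i else 0))"
      by (intro sum.cong) auto
    also have "\<dots> = n * 5 + (\<Sum>r\<in>S. ?t r)"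
    proof -
      have "{..<n} \<inter> S = S" using S_n by auto
      then show ?thesis by (simp add: sum.distrib sum.If_cases Int_def)
    qed
    also have "(\<Sum>r\<in>S. ?t r) = (\<Sum>r\<in>S. Tec (mr r) n) + 15 * (\<Sum>r\<in>S. mr r) + card S * (44 * n + 50) + (\<Sum>r\<in>S. ?U r) * (14 * n + 4)"
      by (simp add: sum.distrib sum_distrib_left sum_distrib_right algebra_simps)
    also have "\<dots> \<le> max_split_time Tec m n + 15 * (2 * m) + n * (44 * n + 50) + n * (14 * n + 4)"
      using split_time_le[of S n mr m Tec] S_n mr_sum U_sum cS by (intro add_mono mult_le_mono) auto
    finally show "(\<Sum>i<n. (if i \<in> S then ?t i + 1 else 1) + 4) + 3 \<le> ?T"
      by (simp add: algebra_simps)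
  qed (use s best in \<open>auto simp: base_def\<close>)
  then show ?thesis
    unfolding sub_cuts_def by (rule wp_conseq) (use S_n in auto)
qed

lemma level_spec:
  assumes s: "base s" and lev: "\<And>v. v < n \<Longrightarrow> nmem s aLev v = lev v" and l: "nmem s vlev 0 = l"
    and best: "attained (rmem s rBest 0)"
  defines "S \<equiv> {v \<in> R. l \<le> lev v}"
  shows "wp (L * (Tec m n + 30 * n + 15 * m + 45) + max_split_time Tec m n + 67 * (n * n) + 50 * m + 140 * n + 70) level
    (\<lambda>s'. attained (rmem s' rBest 0) \<and> rmem s' rBest 0 \<le> rmem s rBest 0 \<and>
      (2 \<le> card S \<longrightarrow> (\<forall>r\<in>S. below S r (rmem s' rBest 0)))) s"
    (is "wp ?T _ ?Q s")
  unfolding level_def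
proof (rule wp_Seq_frame[OF select_spec[OF s lev l], folded S_def])
  fix s1 :: state
  assume 1: "Srep S s1 \<and> (2 \<le> card S \<longrightarrow>
     nmem s1 vfst 0 \<in> S \<and> nmem s1 vlst 0 \<in> S \<and> nmem s1 vfst 0 \<noteq> nmem s1 vlst 0)"
    and sm1: "same (nwr select) (rwr select) s s1"
  have b1: "base s1" by (rule base_same[OF s sm1]) auto
  have best1: "rmem s1 rBest 0 = rmem s rBest 0" by (simp add: same_rmem[OF sm1])
  have S: "S \<subseteq> R" by (auto simp: S_def)
  let ?c = "rounds ;; components ;; owners ;; sub_cuts"
  let ?T1 = "?T - (n * 14 + 5 + 1) - 1"
  show "wp (?T - (n * 14 + 5 + 1)) (onlyif (NLess N1 (var vcnt)) ?c) ?Q s1"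
  proof (cases "2 \<le> card S")
    case False
    then have "\<not> bval (NLess N1 (var vcnt)) s1" using 1 by (simp add: Srep_def)
    then show ?thesis
      by (rule wp_onlyif_False) (use best best1 False in auto)
  next
    case True
    then have cnd: "bval (NLess N1 (var vcnt)) s1" using 1 by (simp add: Srep_def)
    have "wp ?T1 ?c ?Q s1"
    proof (rule wp_Seq_frame[OF rounds_spec[OF b1 conjunct1[OF 1] S True]])
      fix s2 :: state
      assume "\<exists>Y. Yrep Y s2 \<and> isolating G wr S {(r, r'). r \<noteq> r'} Y"
      then obtain Y where Y: "Yrep Y s2" "isolating G wr S {(r, r'). r \<noteq> r'} Y" by blast
      assume sm2: "same (nwr rounds) (rwr rounds) s1 s2"
      have b2: "base s2" by (rule base_same[OF b1 sm2]) auto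
      let ?T2 = "?T1 - (L * (Tec m n + 30 * n + 15 * m + 45) + 5 * n + 5 * m + 15 + 1)"
      show "wp ?T2 (components ;; owners ;; sub_cuts) ?Q s2"
      proof (rule wp_Seq_frame[OF components_spec[OF b2 Y(1)]])
        fix s3 :: state
        assume 3: "(\<forall>u<n. nmem s3 aC u < n) \<and>
          (\<forall>u<n. \<forall>v<n. nmem s3 aC u = nmem s3 aC v \<longleftrightarrow> (u, v) \<in> (remaining_adj G Y)\<^sup>*)"
          and sm3: "same (nwr components) (rwr components) s2 s3"
        have b3: "base s3" by (rule base_same[OF b2 sm3]) auto
        have S3: "Srep S s3" using 1 by (simp add: Srep_def same_nmem[OF sm2] same_nmem[OF sm3])
        have C3: "nmem s3 aC v < n" if "v < n" for v using 3 that by blast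
        have C3': "nmem s3 aC u = nmem s3 aC v \<longleftrightarrow> (u, v) \<in> (remaining_adj G Y)\<^sup>*" if "u < n" "v < n" for u v
          using 3 that by blast
        let ?T3 = "?T2 - (m * 12 + n * (9 * n + 25) + 15 + 1)"
        show "wp ?T3 (owners ;; sub_cuts) ?Q s3"
        proof (rule wp_Seq_frame[OF owners_spec[OF b3 S3 S C3 C3' Y(2)]])
          fix s4 :: state
          assume "\<forall>v<n. \<forall>r. nmem s4 aOwn v = Suc r \<longleftrightarrow> r \<in> S \<and> v \<in> comp_of G Y r"
            and sm4: "same (nwr owners) (rwr owners) s3 s4"
          then have own: "owned S Y s4" by (simp add: owned_def)
          have b4: "base s4" by (rule base_same[OF b3 sm4]) auto
          have S4: "Srep S s4" using S3 by (simp add: Srep_def same_nmem[OF sm4])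
          have fl: "nmem s4 vfst 0 \<in> S" "nmem s4 vlst 0 \<in> S" "nmem s4 vfst 0 \<noteq> nmem s4 vlst 0"
            using 1 True by (simp_all add: same_nmem[OF sm2] same_nmem[OF sm3] same_nmem[OF sm4])
          have best4: "rmem s4 rBest 0 = rmem s rBest 0"
            using best1 by (simp add: same_rmem[OF sm2] same_rmem[OF sm3] same_rmem[OF sm4])
          have "wp (max_split_time Tec m n + 30 * m + 58 * (n * n) + 63 * n + 3) sub_cuts
            (\<lambda>s'. attained (rmem s' rBest 0) \<and> rmem s' rBest 0 \<le> rmem s4 rBest 0 \<and> (\<forall>r\<in>S. below S r (rmem s' rBest 0))) s4"
            using best best4 by (intro sub_cuts_spec[OF b4 S4 own S Y(2) fl]) simp
          then show "wp (?T3 - (n * 20 + 15 + 1)) sub_cuts ?Q s4"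
            by (rule wp_weaken) (simp_all add: best4 algebra_simps)
        qed (auto simp: algebra_simps)
      qed (auto simp: algebra_simps)
    qed (auto simp: algebra_simps)
    from wp_Cond_True[OF cnd this] show ?thesis by simp
  qed
qed auto

end

section \<open>Lower bounds for the time of a solver\<close>

lemma run_changed_cells:
  "(c', s') \<in> set_pmf (run t c s) \<Longrightarrow>
   finite {(a, i). nmem s' a i \<noteq> nmem s a i} \<and> card {(a, i). nmem s' a i \<noteq> nmem s a i} \<le> t"
proof (induction t arbitrary: c s)
  case (Suc t)
  have step: "\<exists>x. {(a, i). nmem s' a i \<noteq> nmem s a i} \<subseteq> {x}" if "(c', s') \<in> set_pmf (step c s)" for c c' s s'
    using that
  proof (induction c arbitrary: c' s')
    case (NAssign a i e)
    then show ?case by (intro exI[of _ "(a, nval i s)"]) (auto split: if_splits)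
  next
    case (Flip a i)
    then show ?case by (intro exI[of _ "(a, nval i s)"]) (auto split: if_splits)
  qed (auto split: if_splits)
  from Suc.prems obtain c1 s1 where 1: "(c1, s1) \<in> set_pmf (step c s)" "(c', s') \<in> set_pmf (run t c1 s1)"
    by auto
  obtain x where x: "{(a, i). nmem s1 a i \<noteq> nmem s a i} \<subseteq> {x}" using step[OF 1(1)] by blast
  let ?A = "{(a, i). nmem s' a i \<noteq> nmem s1 a i}"
  have sub: "{(a, i). nmem s' a i \<noteq> nmem s a i} \<subseteq> insert x ?A"
  proof
    fix y assume y: "y \<in> {(a, i). nmem s' a i \<noteq> nmem s a i}"
    show "y \<in> insert x ?A"
    proof (cases "y \<in> ?A")
      case False
      with y have "y \<in> {(a, i). nmem s1 a i \<noteq> nmem s a i}" by auto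
      with x show ?thesis by blast
    qed simp
  qed
  moreover have IH: "finite ?A" "card ?A \<le> t" using Suc.IH[OF 1(2)] by auto
  moreover have "card (insert x ?A) \<le> Suc t" using card_insert_le_m1[of "Suc t" ?A x] IH by (simp add: card_insert_if)
  ultimately show ?case by (meson card_mono finite.insertI finite_subset le_trans)
qed simp

text \<open>Start from memory whose output arrays are filled with 2. A correct output has only the
  values 0 and 1, so all \<open>m + n\<close> cells must change, and a step changes at most
  one.\<close>

lemma solver_time_lower_bound:
  assumes solver: "element_cut_solver P Tec" and G: "egraph G" and T: "a \<in> terminals G" "b \<in> terminals G" "a \<noteq> b"
    and inp: "graph_input G (\<lambda>_. 1) s"
  shows "card (edges G) + card (verts G) \<le> Tec (card (edges G)) (card (verts G))"
proof -
  define s1 where "s1 = s\<lparr>nmem := (nmem s)(4 := (\<lambda>v. if v = a then 1 else if v = b then 2 else 0), 5 := (\<lambda>_. 2), 6 := (\<lambda>_. 2))\<rparr>"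
  let ?n = "card (verts G)" and ?m = "card (edges G)"
  have mem: "v \<in> verts G" if "v < ?n" for v
    using inp that unfolding graph_input_def by blast
  have ed: "edge_at s1 = edge_at s" by (rule ext) (simp add: edge_at_def s1_def)
  have mems: "nmem s1 0 = nmem s 0" "nmem s1 3 = nmem s 3" "rmem s1 = rmem s"
    by (simp_all add: s1_def)
  have "graph_input G (\<lambda>_. 1) s1"
    using inp unfolding graph_input_def ed mems .
  moreover have "sides_input G {a} {b} s1"
    by (auto simp: sides_input_def s1_def)
  moreover have "positive_weights G (\<lambda>_. 1)"
    by (simp add: positive_weights_def)
  ultimately have "\<forall>(c', s') \<in> set_pmf (run (Tec ?m ?n) P s1).
           c' = Skip \<and> (\<exists>X. min_element_cut G (\<lambda>_. 1) {a} {b} X \<and> cut_output G X s1 s')"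
    using G T
    by (intro solver[unfolded element_cut_solver_def, THEN spec[of _ G], THEN spec[of _ "\<lambda>_. 1"],
          THEN spec[of _ "{a}"], THEN spec[of _ "{b}"], THEN spec[of _ s1], THEN mp]) simp
  moreover obtain z where z: "z \<in> set_pmf (run (Tec ?m ?n) P s1)"
    using set_pmf_not_empty by fast
  moreover obtain c' s' where "z = (c', s')" by (cases z)
  with z have r: "(c', s') \<in> set_pmf (run (Tec ?m ?n) P s1)" by simp
  ultimately obtain X where "cut_output G X s1 s'" by blast
  then have out5: "v < ?n \<Longrightarrow> nmem s' 5 v \<le> 1" and out6: "i < ?m \<Longrightarrow> nmem s' 6 i \<le> 1" for v i
    using mem by (simp_all add: cut_output_def)
  let ?C = "{(a, i). nmem s' a i \<noteq> nmem s1 a i}"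
  have "(\<lambda>v. (5::nat, v)) ` {..<?n} \<union> (\<lambda>i. (6::nat, i)) ` {..<?m} \<subseteq> ?C"
    using out5 out6 by (fastforce simp: s1_def)
  moreover have fin: "finite ?C" "card ?C \<le> Tec ?m ?n" using run_changed_cells[OF r] by blast+
  ultimately have "card ((\<lambda>v. (5::nat, v)) ` {..<?n} \<union> (\<lambda>i. (6::nat, i)) ` {..<?m}) \<le> Tec ?m ?n"
    using card_mono le_trans by blast
  also have "card ((\<lambda>v. (5::nat, v)) ` {..<?n} \<union> (\<lambda>i. (6::nat, i)) ` {..<?m}) = ?n + ?m"
    by (subst card_Un_disjoint) (auto simp: card_image inj_on_def)
  finally show ?thesis by simp
qed

text \<open>The split into \<open>n\<close> instances without edges, each on \<open>n\<close>
  vertices. An edgeless graph with two terminals shows that every one of them costs at least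
  \<open>n\<close>.\<close>

lemma max_split_time_ge_square:
  assumes solver: "element_cut_solver P Tec" and n: "2 \<le> n"
  shows "n * n \<le> max_split_time Tec m n"
proof -
  define G where "G = \<lparr>verts = {..<n}, edges = {}, terminals = {0, 1}\<rparr>"
  define s where "s = \<lparr>nmem = (\<lambda>a i. if a = 0 then (if i = 0 then n else 0) else of_bool (i < 2)), rmem = (\<lambda>_ _. 1)\<rparr>"
  have "egraph G" using n by (auto simp: G_def egraph_def)
  moreover have "graph_input G (\<lambda>_. 1) s"
    by (auto simp: graph_input_def G_def s_def)
  ultimately have "n \<le> Tec 0 n"
    using solver_time_lower_bound[OF solver, of G 0 1 s] by (simp add: G_def)
  then have "n * n \<le> (\<Sum>r\<in>{..<n}. Tec 0 n)" by simp
  also have "\<dots> \<le> max_split_time Tec m n"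
    by (rule split_time_le) simp_all
  finally show ?thesis .
qed

section \<open>Preparing the input: copy, capped weights, adjacency matrix, number of levels\<close>

context cut_program
begin

definition copy_in :: com where
  "copy_in = setv vn (NCell aSize N0) ;; setv vm (NCell aSize N1) ;;
     For vi vm
       (NAssign aT (var vi) (cell aTail vi) ;;
        NAssign aH (var vi) (cell aHead vi) ;;
        RAssign rE (var vi) (rcell aEdgeWeight vi)) ;;
     For vi vn
       (NAssign aTm (var vi) (cell aTerminal vi) ;;
        NAssign aR (var vi) (cell aLabel vi) ;;
        RAssign rV (var vi) (rcell aVertexWeight vi))"

text \<open>The cap is computed in \<open>rM\<close> before any weight is replaced. Weight cells of
  terminals may hold anything, so the sum excludes them; replacing their contents in the last loop
  is harmless.\<close>

definition cap :: com where
  "cap = setr rM ROne ;;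
     For vi vm (onlyif (RLess (rcell rE vi) RInf) (setr rM (RAdd (rvar rM) (rcell rE vi)))) ;;
     For vi vn (onlyif (BAnd (eqb (cell aTm vi) N0) (RLess (rcell rV vi) RInf))
       (setr rM (RAdd (rvar rM) (rcell rV vi)))) ;;
     For vi vm (onlyif (BNot (RLess (rcell rE vi) RInf)) (RAssign rE (var vi) (rvar rM))) ;;
     For vi vn (onlyif (BNot (RLess (rcell rV vi) RInf)) (RAssign rV (var vi) (rvar rM)))"

definition matrix :: com where
  "matrix = setv vta N0 ;;
     For vi vn
       (NAssign aRow (var vi) (var vta) ;;
        setv vta (NAdd (var vta) (var vn)) ;;
        For vj vn (RAssign rW (NAdd (cell aRow vi) (var vj)) RZero)) ;;
     For vi vm
       (RAssign rW (NAdd (NCell aRow (cell aT vi)) (cell aH vi)) (rcell rE vi) ;;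
        RAssign rW (NAdd (NCell aRow (cell aH vi)) (cell aT vi)) (rcell rE vi))"

text \<open>The least exponent is found by doubling, as the machine has no logarithm;
  \<open>n\<close> iterations suffice because the size of \<open>R\<close> is at most
  \<open>n\<close> and \<open>n < 2 ^ n\<close>.\<close>

definition levels :: com where
  "levels = setv vk N0 ;;
     For vi vn (setv vk (NAdd (var vk) (cell aR vi))) ;;
     setv vpw N1 ;; setv vL N0 ;;
     For vi vn (onlyif (NLess (var vpw) (var vk))
       (setv vpw (NAdd (var vpw) (var vpw)) ;; setv vL (NAdd (var vL) N1))) ;;
     setv vLL (NAdd (var vL) N1)"

definition init :: com where
  "init = copy_in ;; cap ;; matrix ;; levels"

lemma frame_copy_in [simp]: "nwr copy_in = {vn, vm, vi, aT, aH, aTm, aR}" "rwr copy_in = {rE, rV}"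
  and frame_cap [simp]: "nwr cap = {vi}" "rwr cap = {rM, rE, rV}"
  and frame_matrix [simp]: "nwr matrix = {vta, vi, aRow, vj}" "rwr matrix = {rW}"
  and frame_levels [simp]: "nwr levels = {vk, vi, vpw, vL, vLL}" "rwr levels = {}"
  by (auto simp: copy_in_def cap_def matrix_def levels_def)

lemma row_eq_iff: "v < n \<Longrightarrow> v' < n \<Longrightarrow> u * n + v = u' * n + v' \<longleftrightarrow> u = u' \<and> v = (v'::nat)"
proof
  assume v: "v < n" "v' < n" and eq: "u * n + v = u' * n + v'"
  have "(u * n + v) div n = u" "(u' * n + v') div n = u'" using v by simp_all
  with eq have "u = u'" by metis
  with eq show "u = u' \<and> v = v'" by simp
qed simp

end

locale element_instance = cut_program P K for P K +
  fixes Tec :: "nat \<Rightarrow> nat \<Rightarrow> nat" and G :: "nat egraph" and w :: "nat element \<Rightarrow> ereal" and R :: "nat set"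
    and s0 :: state
  assumes solver: "element_cut_solver P Tec"
    and G: "egraph G" and w: "positive_weights G w" and R: "R \<subseteq> terminals G" and R2: "2 \<le> card R"
    and inp: "graph_input G w s0" and sub: "subset_input G R s0"
begin

definition n :: nat where "n = card (verts G)"
definition m :: nat where "m = card (edges G)"
definition te :: "nat \<Rightarrow> nat" where "te i = nmem s0 aTail i"
definition he :: "nat \<Rightarrow> nat" where "he i = nmem s0 aHead i"

text \<open>Capping infinite weights at a value above every finite cut makes minimum cuts finite, as the
  uncrossing argument needs: a cut of infinite weight is minimum whenever no finite one exists and
  then carries no information.\<close>

definition fin_weight :: "nat element \<Rightarrow> real" where
  "fin_weight x = (if w x = \<infinity> then 0 else real_of_ereal (w x))"

definition bound :: real where
  "bound = 1 + (\<Sum>i<m. fin_weight (Inr {te i, he i})) +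
     (\<Sum>v<n. if v \<in> nonterminals G then fin_weight (Inl v) else 0)"

definition cap_weight :: "nat element \<Rightarrow> real" where
  "cap_weight x = (if w x = \<infinity> then bound else real_of_ereal (w x))"

definition depth :: nat where
  "depth = (LEAST l. card R \<le> 2 ^ l)"

lemmas gi = inp[unfolded graph_input_def, folded n_def m_def]

lemma V: "verts G = {..<n}"
  using gi by blast

lemma E: "edges G = (\<lambda>i. {te i, he i}) ` {..<m}"
  using gi unfolding edge_at_def te_def he_def by blast

lemma w_pos: "x \<in> elements G \<Longrightarrow> 0 < w x"
  using w by (auto simp: positive_weights_def)

lemma w_fin: "x \<in> elements G \<Longrightarrow> w x \<noteq> \<infinity> \<Longrightarrow> w x = ereal (fin_weight x) \<and> 0 < fin_weight x"
  using w_pos[of x] by (cases "w x") (auto simp: fin_weight_def)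

lemma fin_weight_nonneg: "x \<in> elements G \<Longrightarrow> 0 \<le> fin_weight x"
  using w_fin[of x] by (cases "w x = \<infinity>") (auto simp: fin_weight_def)

lemma inner_elements: "i < m \<Longrightarrow> Inr {te i, he i} \<in> elements G"
  using E by (auto simp: elements_def)

text \<open>The definition of \<open>bound\<close> follows the loops of the program. That the listed
  edges are distinct turns it into a sum over elements.\<close>

lemma bound_sum: "bound = 1 + sum fin_weight (elements G)"
proof -
  have inj: "inj_on (\<lambda>i. {te i, he i}) {..<m}"
    by (rule eq_card_imp_inj_on) (simp_all flip: E m_def)
  have finV: "finite (nonterminals G)" and finE: "finite (edges G)"
    using G E by (auto simp: nonterminals_def egraph_def)
  have "sum fin_weight (elements G) = sum fin_weight (Inl ` nonterminals G) + sum fin_weight (Inr ` edges G)"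
    unfolding elements_def using finV finE by (intro sum.union_disjoint) auto
  also have "sum fin_weight (Inl ` nonterminals G) = (\<Sum>v\<in>nonterminals G. fin_weight (Inl v))"
    by (subst sum.reindex) (auto simp: o_def)
  also have "\<dots> = (\<Sum>v<n. if v \<in> nonterminals G then fin_weight (Inl v) else 0)"
    using V by (intro sum.mono_neutral_cong_left) (auto simp: nonterminals_def)
  also have "sum fin_weight (Inr ` edges G) = (\<Sum>e\<in>edges G. fin_weight (Inr e))"
    by (subst sum.reindex) (auto simp: o_def)
  also have "\<dots> = (\<Sum>i<m. fin_weight (Inr {te i, he i}))"
    unfolding E by (subst sum.reindex[OF inj]) (simp add: o_def)
  finally show ?thesis by (simp add: bound_def)
qed

lemma bound_pos: "0 < bound"
  unfolding bound_sum using sum_nonneg[of "elements G" fin_weight] fin_weight_nonneg by force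

lemma cap_weight_pos: "x \<in> elements G \<Longrightarrow> 0 < cap_weight x"
  using w_fin[of x] bound_pos by (auto simp: cap_weight_def fin_weight_def split: if_splits)

lemma cap_weight_fin: "x \<in> elements G \<Longrightarrow> w x \<noteq> \<infinity> \<Longrightarrow> w x = ereal (cap_weight x) \<and> cap_weight x = fin_weight x"
  using w_fin[of x] by (auto simp: cap_weight_def fin_weight_def)

lemma cap_sum_finite:
  assumes "X \<subseteq> elements G" "sum w X \<noteq> \<infinity>"
  shows "sum w X = ereal (sum cap_weight X)" "sum cap_weight X < bound"
proof -
  have finX: "finite X" using assms(1) finite_elements[OF G] by (rule finite_subset)
  have fin: "w x \<noteq> \<infinity>" if "x \<in> X" for x
    using assms(2) finX that by (auto simp: sum_Pinfty)
  have "sum w X = (\<Sum>x\<in>X. ereal (cap_weight x))"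
    using fin cap_weight_fin assms(1) by (intro sum.cong) auto
  then show "sum w X = ereal (sum cap_weight X)" by simp
  have "sum cap_weight X = sum fin_weight X"
    using fin cap_weight_fin assms(1) by (intro sum.cong) auto
  also have "\<dots> \<le> sum fin_weight (elements G)"
    using assms(1) finite_elements[OF G] fin_weight_nonneg by (intro sum_mono2) auto
  finally show "sum cap_weight X < bound" by (simp add: bound_sum)
qed

text \<open>A single element of infinite weight would already contribute
  \<open>bound\<close>.\<close>

lemma cap_sum_less:
  assumes "X \<subseteq> elements G" "sum cap_weight X < bound"
  shows "sum w X = ereal (sum cap_weight X)"
proof -
  have finX: "finite X" using assms(1) finite_elements[OF G] by (rule finite_subset)
  have "w x \<noteq> \<infinity>" if "x \<in> X" for x
  proof
    assume "w x = \<infinity>"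
    then have "bound \<le> cap_weight x" by (simp add: cap_weight_def)
    also have "\<dots> \<le> sum cap_weight X"
      using that assms(1) cap_weight_pos finX by (intro member_le_sum) (auto intro: less_imp_le)
    finally show False using assms(2) by simp
  qed
  then have "sum w X \<noteq> \<infinity>" using finX by (auto simp: sum_Pinfty)
  with assms(1) show ?thesis by (rule cap_sum_finite)
qed

lemma card_R_le: "card R \<le> n"
proof -
  have "R \<subseteq> {..<n}" using R G V by (auto simp: egraph_def)
  from card_mono[OF _ this] show ?thesis by simp
qed

lemma depth: "card R \<le> 2 ^ depth"
  unfolding depth_def using less_exp[of "card R"] by (intro LeastI[of "\<lambda>l. card R \<le> 2 ^ l" "card R"]) simp

lemma depth_less: "l < depth \<Longrightarrow> 2 ^ l < card R"
  unfolding depth_def using not_less_Least[of l "\<lambda>l. card R \<le> 2 ^ l"] by simp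

sublocale graph_data P K Tec G n m te he cap_weight R depth
  by unfold_locales (rule solver G V m_def[symmetric] E R depth | erule cap_weight_pos)+

lemma copy_in_spec:
  "wp (9 * n + 9 * m + 11) copy_in (\<lambda>s. nmem s vn 0 = n \<and> nmem s vm 0 = m \<and>
     (\<forall>i<m. nmem s aT i = te i \<and> nmem s aH i = he i \<and> rmem s rE i = w (Inr (ed i))) \<and>
     (\<forall>v<n. nmem s aTm v = of_bool (v \<in> terminals G) \<and> nmem s aR v = of_bool (v \<in> R)) \<and>
     (\<forall>v\<in>nonterminals G. rmem s rV v = w (Inl v))) s0"
    (is "wp ?T _ ?Q s0")
  unfolding copy_in_def
proof (rule wp_straight_Seq, simp, simp, rule wp_straight_Seq, simp, simp)
  let ?b1 = "NAssign aT (var vi) (cell aTail vi) ;; NAssign aH (var vi) (cell aHead vi) ;; RAssign rE (var vi) (rcell aEdgeWeight vi)"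
  let ?b2 = "NAssign aTm (var vi) (cell aTerminal vi) ;; NAssign aR (var vi) (cell aLabel vi) ;; RAssign rV (var vi) (rcell aVertexWeight vi)"
  define s1 where "s1 = ex (setv vm (NCell aSize N1)) (ex (setv vn (NCell aSize N0)) s0)"
  have sz: "nmem s0 0 0 = n" "nmem s0 0 1 = m"
    using gi by blast+
  have 1: "nmem s1 vn 0 = n" "nmem s1 vm 0 = m" "a < 7 \<Longrightarrow> nmem s1 a = nmem s0 a" "rmem s1 = rmem s0" for a
    using sz by (auto simp: s1_def)
  have we: "rmem s0 1 i = w (Inr (ed i))" if "i < m" for i
    using gi that unfolding te_def he_def edge_at_def by blast
  have tv: "nmem s0 3 v = of_bool (v \<in> terminals G)" "nmem s0 4 v = of_bool (v \<in> R)" if "v < n" for v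
    using gi sub that V unfolding subset_input_def by blast+
  have wv: "rmem s0 0 v = w (Inl v)" if "v \<in> nonterminals G" for v
    using gi that by blast
  let ?I1 = "\<lambda>i s. \<forall>j<i. nmem s aT j = te j \<and> nmem s aH j = he j \<and> rmem s rE j = w (Inr (ed j))"
  let ?I2 = "\<lambda>i s. (\<forall>v<i. nmem s aTm v = of_bool (v \<in> terminals G) \<and> nmem s aR v = of_bool (v \<in> R) \<and>
     rmem s rV v = rmem s0 0 v)"
  have main: "wp (?T - 4) (For vi vm ?b1 ;; For vi vn ?b2) ?Q s1"
  proof (rule wp_Seq_frame)
    show "wp (m * 9 + 3) (For vi vm ?b1) (?I1 m) s1"
    proof (rule wp_For_straight[where I = ?I1 and N = m])
      fix i s assume i: "i < m" "nmem s vi 0 = i" and sm: "same (insert vi (nwr ?b1)) (rwr ?b1) s1 s" and I: "?I1 i s"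
      have "nmem s 1 i = te i" "nmem s 2 i = he i" "rmem s 1 i = w (Inr (ed i))"
        using we[OF i(1)] 1(3)[of 1] 1(3)[of 2] 1(4) by (simp_all add: same_nmem[OF sm] same_rmem[OF sm] te_def he_def)
      then show "?I1 (Suc i) (ex ?b1 s)"
        using i I by (auto simp: less_Suc_eq)
    qed (use 1 in auto)
    fix s2 assume I1: "?I1 m s2" and sm2: "same (nwr (For vi vm ?b1)) (rwr (For vi vm ?b1)) s1 s2"
    have 2: "nmem s2 vn 0 = n" "nmem s2 vm 0 = m" "nmem s2 3 = nmem s0 3" "nmem s2 4 = nmem s0 4" "rmem s2 0 = rmem s0 0"
      using 1 1(3)[of 3] 1(3)[of 4] by (simp_all add: same_nmem[OF sm2] same_rmem[OF sm2])
    show "wp (?T - 4 - (m * 9 + 3 + 1)) (For vi vn ?b2) ?Q s2"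
    proof (rule wp_post_frame)
      show "wp (n * 9 + 3) (For vi vn ?b2) (?I2 n) s2"
      proof (rule wp_For_straight[where I = ?I2 and N = n])
        fix i s assume i: "i < n" "nmem s vi 0 = i" and sm: "same (insert vi (nwr ?b2)) (rwr ?b2) s2 s" and I: "?I2 i s"
        have "nmem s 3 i = of_bool (i \<in> terminals G)" "nmem s 4 i = of_bool (i \<in> R)" "rmem s 0 = rmem s0 0"
          using tv[OF i(1)] 2 by (simp_all add: same_nmem[OF sm] same_rmem[OF sm])
        then show "?I2 (Suc i) (ex ?b2 s)"
          using i I by (auto simp: less_Suc_eq)
      qed (use 2 in auto)
      fix s :: state
      assume I2: "?I2 n s" and sm: "same (nwr (For vi vn ?b2)) (rwr (For vi vn ?b2)) s2 s"
      have "rmem s rV v = w (Inl v)" if "v \<in> nonterminals G" for v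
        using I2 wv[OF that] that V by (auto simp: nonterminals_def)
      then show "?Q s"
        using I1 I2 2 by (simp add: same_nmem[OF sm] same_rmem[OF sm])
    qed simp
  qed simp
  show "wp (?T - (tm (setv vn (NCell aSize N0)) + 1) - (tm (setv vm (NCell aSize N1)) + 1))
      (For vi vm ?b1 ;; For vi vn ?b2) ?Q (ex (setv vm (NCell aSize N1)) (ex (setv vn (NCell aSize N0)) s0))"
    by (rule wp_time_mono[OF main[unfolded s1_def]]) simp
qed

end

context element_instance
begin

definition raw :: "state \<Rightarrow> bool" where
  "raw s \<longleftrightarrow> nmem s vn 0 = n \<and> nmem s vm 0 = m \<and>
     (\<forall>i<m. nmem s aT i = te i \<and> nmem s aH i = he i) \<and>
     (\<forall>v<n. nmem s aTm v = of_bool (v \<in> terminals G) \<and> nmem s aR v = of_bool (v \<in> R))"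

lemma raw_same:
  assumes "raw s" "same X Y s s'" "X \<inter> {vn, vm, aT, aH, aTm, aR} = {}"
  shows "raw s'"
proof -
  have "nmem s' a = nmem s a" if "a \<in> {vn, vm, aT, aH, aTm, aR}" for a
    using assms that by (intro same_nmem[OF assms(2)]) auto
  then show ?thesis
    using assms(1) unfolding raw_def by simp
qed

lemma n_nonterminals: "v \<in> nonterminals G \<longleftrightarrow> v < n \<and> v \<notin> terminals G"
  using V by (auto simp: nonterminals_def)

lemma cap_spec:
  assumes s: "raw s" "\<And>i. i < m \<Longrightarrow> rmem s rE i = w (Inr (ed i))"
    "\<And>v. v \<in> nonterminals G \<Longrightarrow> rmem s rV v = w (Inl v)"
  shows "wp (12 * n + 12 * m + 20) cap (\<lambda>s'. rmem s' rM 0 = ereal bound \<and>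
     (\<forall>i<m. rmem s' rE i = ereal (cap_weight (Inr (ed i)))) \<and>
     (\<forall>v\<in>nonterminals G. rmem s' rV v = ereal (cap_weight (Inl v)))) s"
    (is "wp ?T _ ?Q s")
  unfolding cap_def
proof (rule wp_straight_Seq, simp, simp)
  let ?b1 = "onlyif (RLess (rcell rE vi) RInf) (setr rM (RAdd (rvar rM) (rcell rE vi)))"
  let ?b2 = "onlyif (BAnd (eqb (cell aTm vi) N0) (RLess (rcell rV vi) RInf)) (setr rM (RAdd (rvar rM) (rcell rV vi)))"
  let ?b3 = "onlyif (BNot (RLess (rcell rE vi) RInf)) (RAssign rE (var vi) (rvar rM))"
  let ?b4 = "onlyif (BNot (RLess (rcell rV vi) RInf)) (RAssign rV (var vi) (rvar rM))"
  let ?f = "\<lambda>i. fin_weight (Inr (ed i))" and ?g = "\<lambda>v. if v \<in> nonterminals G then fin_weight (Inl v) else 0"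
  define s0 where "s0 = ex (setr rM ROne) s"
  have r0: "raw s0" using s(1) by (simp add: s0_def raw_def)
  have we: "w (Inr (ed i)) \<noteq> \<infinity> \<Longrightarrow> w (Inr (ed i)) = ereal (?f i)"
    and wi: "w (Inr (ed i)) = \<infinity> \<Longrightarrow> ?f i = 0" if "i < m" for i
    using w_fin[OF inner_elements[OF that]] by (simp_all add: fin_weight_def)
  have nte: "v \<in> nonterminals G \<Longrightarrow> Inl v \<in> elements G" for v by (simp add: elements_def)
  let ?I1 = "\<lambda>i s'. rmem s' rM 0 = ereal (1 + (\<Sum>j<i. ?f j))"
  let ?I2 = "\<lambda>i s'. rmem s' rM 0 = ereal (1 + (\<Sum>j<m. ?f j) + (\<Sum>v<i. ?g v))"
  let ?I3 = "\<lambda>i s'. \<forall>j<m. rmem s' rE j = (if j < i then ereal (cap_weight (Inr (ed j))) else w (Inr (ed j)))"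
  let ?I4 = "\<lambda>i s'. \<forall>v\<in>nonterminals G. rmem s' rV v = (if v < i then ereal (cap_weight (Inl v)) else w (Inl v))"
  have main: "wp (?T - 2) (For vi vm ?b1 ;; For vi vn ?b2 ;; For vi vm ?b3 ;; For vi vn ?b4) ?Q s0"
  proof (rule wp_Seq_frame)
    show "wp (m * 6 + 3) (For vi vm ?b1) (?I1 m) s0"
    proof (rule wp_For_straight[where I = ?I1 and N = m])
      fix i s' assume i: "i < m" "nmem s' vi 0 = i" and sm: "same (insert vi (nwr ?b1)) (rwr ?b1) s0 s'" and I: "?I1 i s'"
      have e: "rmem s' rE i = w (Inr (ed i))"
        using s(2)[OF i(1)] by (simp add: same_rmem[OF sm] s0_def)
      show "?I1 (Suc i) (ex ?b1 s')"
      proof (cases "w (Inr (ed i)) = \<infinity>")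
        case True
        then show ?thesis using e i I wi[OF i(1) True] by simp
      next
        case False
        note wei = we[OF i(1) False]
        show ?thesis using i I by (simp add: e wei)
      qed
    qed (use r0 in \<open>auto simp: raw_def s0_def one_ereal_def\<close>)
    fix s1 assume I1: "?I1 m s1" and sm1: "same (nwr (For vi vm ?b1)) (rwr (For vi vm ?b1)) s0 s1"
    have r1: "raw s1" by (rule raw_same[OF r0 sm1]) auto
    show "wp (?T - 2 - (m * 6 + 3 + 1)) (For vi vn ?b2 ;; For vi vm ?b3 ;; For vi vn ?b4) ?Q s1"
    proof (rule wp_Seq_frame)
      show "wp (n * 6 + 3) (For vi vn ?b2) (?I2 n) s1"
      proof (rule wp_For_straight[where I = ?I2 and N = n])
        show "?I2 0 s1" using I1 by simp
      next
        fix i s' assume i: "i < n" "nmem s' vi 0 = i" and sm: "same (insert vi (nwr ?b2)) (rwr ?b2) s1 s'" and I: "?I2 i s'"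
        have r': "raw s'" by (rule raw_same[OF r1 sm]) auto
        have tm: "nmem s' aTm i = of_bool (i \<in> terminals G)" using r' i(1) by (simp add: raw_def)
        show "?I2 (Suc i) (ex ?b2 s')"
        proof (cases "i \<in> nonterminals G")
          case False
          then have "\<not> bval (BAnd (eqb (cell aTm vi) N0) (RLess (rcell rV vi) RInf)) s'"
            using tm i n_nonterminals by simp
          then have "ex ?b2 s' = s'" by (simp only: ex.simps if_False)
          with I False show ?thesis by simp
        next
          case True
          have e: "rmem s' rV i = w (Inl i)"
            using s(3)[OF True] by (simp add: same_rmem[OF sm] same_rmem[OF sm1] s0_def)
          have t0: "nmem s' aTm i = 0" using tm True n_nonterminals by simp
          show ?thesis
          proof (cases "w (Inl i) = \<infinity>")
            case inf: True
            then have "fin_weight (Inl i) = 0" by (simp add: fin_weight_def)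
            then show ?thesis using e i I inf by simp
          next
            case False
            then have wei: "w (Inl i) = ereal (fin_weight (Inl i))"
              using w_fin[OF nte[OF True]] by simp
            show ?thesis using i I t0 True by (simp add: e wei)
          qed
        qed
      qed (use r1 in \<open>auto simp: raw_def\<close>)
      fix s2 assume I2: "?I2 n s2" and sm2: "same (nwr (For vi vn ?b2)) (rwr (For vi vn ?b2)) s1 s2"
      have r2: "raw s2" by (rule raw_same[OF r1 sm2]) auto
      have M2: "rmem s2 rM 0 = ereal bound" using I2 by (simp add: bound_def)
      have E2: "rmem s2 rE = rmem s rE" "rmem s2 rV = rmem s rV"
        by (simp_all add: same_rmem[OF sm2] same_rmem[OF sm1] s0_def)
      show "wp (?T - 2 - (m * 6 + 3 + 1) - (n * 6 + 3 + 1)) (For vi vm ?b3 ;; For vi vn ?b4) ?Q s2"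
      proof (rule wp_Seq_frame)
        show "wp (m * 6 + 3) (For vi vm ?b3) (?I3 m) s2"
        proof (rule wp_For_straight[where I = ?I3 and N = m])
          fix i s' assume i: "i < m" "nmem s' vi 0 = i" and sm: "same (insert vi (nwr ?b3)) (rwr ?b3) s2 s'" and I: "?I3 i s'"
          have M: "rmem s' rM 0 = ereal bound" using M2 by (simp add: same_rmem[OF sm])
          have e: "rmem s' rE i = w (Inr (ed i))" using I i(1) by simp
          have up: "rmem (ex ?b3 s') rE = (rmem s' rE)(i := ereal (cap_weight (Inr (ed i))))"
          proof (cases "w (Inr (ed i)) = \<infinity>")
            case True
            then have "cap_weight (Inr (ed i)) = bound" by (simp add: cap_weight_def)
            then show ?thesis using True e i(2) M by simp
          next
            case False
            then have c: "w (Inr (ed i)) = ereal (cap_weight (Inr (ed i)))"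
              using cap_weight_fin[OF inner_elements[OF i(1)]] by blast
            then have "(rmem s' rE)(i := ereal (cap_weight (Inr (ed i)))) = rmem s' rE" using e by auto
            moreover have "ex ?b3 s' = s'" using False e i(2) by simp
            ultimately show ?thesis by simp
          qed
          show "?I3 (Suc i) (ex ?b3 s')"
            unfolding up using I by (auto simp: less_Suc_eq)
        qed (use r2 E2 s(2) in \<open>auto simp: raw_def\<close>)
        fix s3 assume I3: "?I3 m s3" and sm3: "same (nwr (For vi vm ?b3)) (rwr (For vi vm ?b3)) s2 s3"
        have r3: "raw s3" by (rule raw_same[OF r2 sm3]) auto
        have M3: "rmem s3 rM 0 = ereal bound" using M2 by (simp add: same_rmem[OF sm3])
        have E3: "rmem s3 rV = rmem s rV" using E2 by (simp add: same_rmem[OF sm3])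
        show "wp (?T - 2 - (m * 6 + 3 + 1) - (n * 6 + 3 + 1) - (m * 6 + 3 + 1)) (For vi vn ?b4) ?Q s3"
        proof (rule wp_post_frame)
          show "wp (n * 6 + 3) (For vi vn ?b4) (?I4 n) s3"
          proof (rule wp_For_straight[where I = ?I4 and N = n])
            fix i s' assume i: "i < n" "nmem s' vi 0 = i" and sm: "same (insert vi (nwr ?b4)) (rwr ?b4) s3 s'" and I: "?I4 i s'"
            have M: "rmem s' rM 0 = ereal bound" using M3 by (simp add: same_rmem[OF sm])
            have other: "rmem (ex ?b4 s') rV v = rmem s' rV v" if "v \<noteq> i" for v
              using i(2) that by auto
            have here: "rmem (ex ?b4 s') rV i = ereal (cap_weight (Inl i))" if nt: "i \<in> nonterminals G"
            proof -
              have e: "rmem s' rV i = w (Inl i)" using I nt by simp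
              show ?thesis
              proof (cases "w (Inl i) = \<infinity>")
                case True
                then have "cap_weight (Inl i) = bound" by (simp add: cap_weight_def)
                then show ?thesis using True e i(2) M by simp
              next
                case False
                then have "w (Inl i) = ereal (cap_weight (Inl i))"
                  using cap_weight_fin[OF nte[OF nt]] by blast
                moreover have "ex ?b4 s' = s'" using False e i(2) by simp
                ultimately show ?thesis using e by simp
              qed
            qed
            show "?I4 (Suc i) (ex ?b4 s')"
            proof
              fix v assume v: "v \<in> nonterminals G"
              show "rmem (ex ?b4 s') rV v = (if v < Suc i then ereal (cap_weight (Inl v)) else w (Inl v))"
              proof (cases "v = i")
                case True
                then show ?thesis using here v by simp
              next
                case False
                then show ?thesis using other[OF False] I v by (simp add: less_Suc_eq)
              qed
            qed
          qed (use r3 E3 s(3) in \<open>auto simp: raw_def\<close>)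
          fix s4 :: state
          assume "?I4 n s4" and sm4: "same (nwr (For vi vn ?b4)) (rwr (For vi vn ?b4)) s3 s4"
          then show "?Q s4"
            using I3 M3 n_nonterminals by (simp add: same_rmem[OF sm4])
        qed simp
      qed simp
    qed simp
  qed simp
  show "wp (?T - (tm (setr rM ROne) + 1)) (For vi vm ?b1 ;; For vi vn ?b2 ;; For vi vm ?b3 ;; For vi vn ?b4) ?Q
      (ex (setr rM ROne) s)"
    by (rule wp_time_mono[OF main[unfolded s0_def]]) simp
qed

lemma matrix_spec:
  assumes s: "raw s" "\<And>i. i < m \<Longrightarrow> rmem s rE i = ereal (cap_weight (Inr (ed i)))"
  shows "wp (5 * (n * n) + 12 * n + 7 * m + 20) matrix (\<lambda>s'.
     (\<forall>v<n. nmem s' aRow v = v * n) \<and>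
     (\<forall>u<n. \<forall>v<n. rmem s' rW (u * n + v) = (if {u, v} \<in> edges G then ereal (cap_weight (Inr {u, v})) else 0))) s"
    (is "wp ?T _ ?Q s")
  unfolding matrix_def
proof (rule wp_straight_Seq, simp, simp)
  let ?b0 = "RAssign rW (NAdd (cell aRow vi) (var vj)) RZero"
  let ?b1 = "NAssign aRow (var vi) (var vta) ;; setv vta (NAdd (var vta) (var vn)) ;; For vj vn ?b0"
  let ?b2 = "RAssign rW (NAdd (NCell aRow (cell aT vi)) (cell aH vi)) (rcell rE vi) ;;
        RAssign rW (NAdd (NCell aRow (cell aH vi)) (cell aT vi)) (rcell rE vi)"
  let ?I0 = "\<lambda>i j s'. (\<forall>u<i. \<forall>v<n. rmem s' rW (u * n + v) = 0) \<and> (\<forall>v<j. rmem s' rW (i * n + v) = 0)"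
  let ?I1 = "\<lambda>i s'. nmem s' vta 0 = i * n \<and> (\<forall>v<i. nmem s' aRow v = v * n) \<and>
     (\<forall>u<i. \<forall>v<n. rmem s' rW (u * n + v) = 0)"
  let ?I2 = "\<lambda>i s'. \<forall>u<n. \<forall>v<n. rmem s' rW (u * n + v) =
     (if \<exists>j<i. {u, v} = ed j then ereal (cap_weight (Inr {u, v})) else 0)"
  define s0 where "s0 = ex (setv vta N0) s"
  have r0: "raw s0" using s(1) by (simp add: s0_def raw_def)
  have main: "wp (?T - 2) (For vi vn ?b1 ;; For vi vm ?b2) ?Q s0"
  proof (rule wp_Seq_frame)
    show "wp (n * (n * 5 + 11) + 3) (For vi vn ?b1) (?I1 n) s0"
    proof (rule wp_For_const[where I = ?I1 and N = n and T = "n * 5 + 7"])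
      fix i s' assume i: "i < n" "nmem s' vi 0 = i" and sm: "same (insert vi (nwr ?b1)) (rwr ?b1) s0 s'" and I: "?I1 i s'"
      have r': "raw s'" by (rule raw_same[OF r0 sm]) auto
      have n': "nmem s' vn 0 = n" using r' by (simp add: raw_def)
      define s1 where "s1 = ex (setv vta (NAdd (var vta) (var vn))) (ex (NAssign aRow (var vi) (var vta)) s')"
      have 1: "nmem s1 vta 0 = Suc i * n" "nmem s1 aRow = (nmem s' aRow)(i := i * n)" "rmem s1 = rmem s'"
        "nmem s1 vn 0 = n" "nmem s1 vi 0 = i"
        using I i n' by (simp_all add: s1_def)
      have loop: "wp (n * 5 + 3) (For vj vn ?b0) (?I0 i n) s1"
      proof (rule wp_For_straight[where I = "?I0 i" and N = n])
        show "?I0 i 0 s1" using I 1 by simp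
      next
        fix j s'' assume j: "j < n" "nmem s'' vj 0 = j" and sm': "same (insert vj (nwr ?b0)) (rwr ?b0) s1 s''" and I': "?I0 i j s''"
        have "nmem s'' aRow i = i * n" "nmem s'' vi 0 = i"
          using 1 by (simp_all add: same_nmem[OF sm'])
        then have up: "rmem (ex ?b0 s'') rW = (rmem s'' rW)(i * n + j := 0)" using j by simp
        show "?I0 i (Suc j) (ex ?b0 s'')"
          unfolding up using I' j(1) by (auto simp: less_Suc_eq row_eq_iff)
      qed (use 1 in auto)
      have fin: "?I1 (Suc i) s''" if I0: "?I0 i n s''" and sm': "same (nwr (For vj vn ?b0)) (rwr (For vj vn ?b0)) s1 s''" for s'' :: state
      proof -
        have "nmem s'' vta 0 = Suc i * n" "nmem s'' aRow = (nmem s' aRow)(i := i * n)"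
          using 1 by (simp_all add: same_nmem[OF sm'])
        then show ?thesis using I I0 by (simp add: less_Suc_eq)
      qed
      have "wp (n * 5 + 3) (For vj vn ?b0) (?I1 (Suc i)) s1"
        by (rule wp_post_frame[OF loop _ fin]) simp_all
      note l = this[unfolded s1_def]
      show "wp (n * 5 + 7) ?b1 (?I1 (Suc i)) s'"
        by (rule wp_straight_Seq, simp, simp, rule wp_straight_Seq, simp, simp, rule wp_time_mono[OF l], simp)
    qed (use r0 in \<open>auto simp: raw_def s0_def\<close>)
    fix s1 assume I1: "?I1 n s1" and sm1: "same (nwr (For vi vn ?b1)) (rwr (For vi vn ?b1)) s0 s1"
    have r1: "raw s1" by (rule raw_same[OF r0 sm1]) auto
    have E1: "rmem s1 rE = rmem s rE" by (simp add: same_rmem[OF sm1] s0_def)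
    show "wp (?T - 2 - (n * (n * 5 + 11) + 3 + 1)) (For vi vm ?b2) ?Q s1"
    proof (rule wp_post_frame)
      show "wp (m * 7 + 3) (For vi vm ?b2) (?I2 m) s1"
      proof (rule wp_For_straight[where I = ?I2 and N = m])
        fix i s' assume i: "i < m" "nmem s' vi 0 = i" and sm: "same (insert vi (nwr ?b2)) (rwr ?b2) s1 s'" and I: "?I2 i s'"
        have r': "raw s'" by (rule raw_same[OF r1 sm]) auto
        have th: "nmem s' aT i = te i" "nmem s' aH i = he i" "te i < n" "he i < n"
          using r' i(1) ed_n[OF i(1)] by (simp_all add: raw_def)
        have rows: "nmem s' aRow v = v * n" if "v < n" for v using I1 that by (simp add: same_nmem[OF sm])
        have e: "rmem s' rE i = ereal (cap_weight (Inr (ed i)))"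
          using s(2)[OF i(1)] E1 by (simp add: same_rmem[OF sm])
        have up: "rmem (ex ?b2 s') rW = (rmem s' rW)(te i * n + he i := ereal (cap_weight (Inr (ed i))),
            he i * n + te i := ereal (cap_weight (Inr (ed i))))"
          using i(2) th rows e by simp
        show "?I2 (Suc i) (ex ?b2 s')"
        proof (intro allI impI)
          fix u v assume uv: "u < n" "v < n"
          have ex: "(\<exists>j<Suc i. {u, v} = ed j) \<longleftrightarrow> {u, v} = ed i \<or> (\<exists>j<i. {u, v} = ed j)"
            by (auto simp: less_Suc_eq)
          show "rmem (ex ?b2 s') rW (u * n + v) =
            (if \<exists>j<Suc i. {u, v} = ed j then ereal (cap_weight (Inr {u, v})) else 0)"
          proof (cases "{u, v} = ed i")
            case True
            then have "u = te i \<and> v = he i \<or> u = he i \<and> v = te i" by (auto simp: doubleton_eq_iff)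
            then have "rmem (ex ?b2 s') rW (u * n + v) = ereal (cap_weight (Inr (ed i)))"
              unfolding up by auto
            then show ?thesis unfolding ex using True by simp
          next
            case False
            then have ne: "u * n + v \<noteq> te i * n + he i" "u * n + v \<noteq> he i * n + te i"
              using row_eq_iff[OF uv(2) th(4), of u "te i"] row_eq_iff[OF uv(2) th(3), of u "he i"] by auto
            then have "rmem (ex ?b2 s') rW (u * n + v) = rmem s' rW (u * n + v)"
              unfolding up by simp
            then show ?thesis unfolding ex using False I uv by simp
          qed
        qed
      qed (use r1 I1 in \<open>auto simp: raw_def\<close>)
      fix s' :: state
      assume I2: "?I2 m s'" and sm: "same (nwr (For vi vm ?b2)) (rwr (For vi vm ?b2)) s1 s'"
      have "(\<exists>j<m. {u, v} = ed j) \<longleftrightarrow> {u, v} \<in> edges G" for u v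
        unfolding E by auto
      then show "?Q s'"
        using I1 I2 by (simp add: same_nmem[OF sm])
    qed (simp add: algebra_simps)
  qed (simp add: algebra_simps)
  show "wp (?T - (tm (setv vta N0) + 1)) (For vi vn ?b1 ;; For vi vm ?b2) ?Q (ex (setv vta N0) s)"
    by (rule wp_time_mono[OF main[unfolded s0_def]]) simp
qed

text \<open>The doubling loop ends with \<open>2 ^ l\<close> at least the size of \<open>R\<close>
  and \<open>2 ^ (l - 1)\<close> below it, which characterises the least exponent.\<close>

lemma depth_unique:
  assumes "card R \<le> 2 ^ l" "l = 0 \<or> 2 ^ (l - 1) < card R"
  shows "l = depth"
proof (rule antisym)
  show "depth \<le> l" unfolding depth_def using assms(1) by (rule Least_le)
  show "l \<le> depth"
  proof (rule ccontr)
    assume "\<not> l \<le> depth"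
    then have "2 ^ depth \<le> (2::nat) ^ (l - 1)" by (intro power_increasing) auto
    with depth have "card R \<le> 2 ^ (l - 1)" by (rule le_trans)
    with assms(2) \<open>\<not> l \<le> depth\<close> show False by auto
  qed
qed

lemma levels_spec:
  assumes s: "raw s"
  shows "wp (14 * n + 20) levels (\<lambda>s'. nmem s' vL 0 = depth \<and> nmem s' vLL 0 = Suc depth) s"
    (is "wp ?T _ ?Q s")
  unfolding levels_def
proof (rule wp_straight_Seq, simp, simp)
  let ?b1 = "setv vk (NAdd (var vk) (cell aR vi))"
  let ?b2 = "onlyif (NLess (var vpw) (var vk)) (setv vpw (NAdd (var vpw) (var vpw)) ;; setv vL (NAdd (var vL) N1))"
  define s0 where "s0 = ex (setv vk N0) s"
  have r0: "raw s0" using s by (simp add: s0_def raw_def)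
  let ?I1 = "\<lambda>i s'. nmem s' vk 0 = rank R i"
  let ?I2 = "\<lambda>i s'. \<exists>l. nmem s' vL 0 = l \<and> nmem s' vpw 0 = 2 ^ l \<and> (l = 0 \<or> 2 ^ (l - 1) < card R) \<and>
     (card R \<le> 2 ^ l \<or> l = i)"
  have rk: "rank R n = card R"
  proof -
    have "{u \<in> R. u < n} = R" using R_n by auto
    then show ?thesis by (simp add: rank_def)
  qed
  have main: "wp (?T - 2) (For vi vn ?b1 ;; setv vpw N1 ;; setv vL N0 ;; For vi vn ?b2 ;; setv vLL (NAdd (var vL) N1)) ?Q s0"
  proof (rule wp_Seq_frame)
    show "wp (n * 5 + 3) (For vi vn ?b1) (?I1 n) s0"
    proof (rule wp_For_straight[where I = ?I1 and N = n])
      fix i s' assume i: "i < n" "nmem s' vi 0 = i" and sm: "same (insert vi (nwr ?b1)) (rwr ?b1) s0 s'" and I: "?I1 i s'"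
      have r': "raw s'" by (rule raw_same[OF r0 sm]) auto
      then show "?I1 (Suc i) (ex ?b1 s')"
        using i I by (simp add: raw_def rank_Suc)
    qed (use r0 in \<open>auto simp: raw_def s0_def\<close>)
    fix s1 assume I1: "?I1 n s1" and sm1: "same (nwr (For vi vn ?b1)) (rwr (For vi vn ?b1)) s0 s1"
    define s2 where "s2 = ex (setv vL N0) (ex (setv vpw N1) s1)"
    have r1: "raw s1" by (rule raw_same[OF r0 sm1]) auto
    have 2: "nmem s2 vk 0 = card R" "nmem s2 vL 0 = 0" "nmem s2 vpw 0 = 1" "nmem s2 vn 0 = n"
      using I1 r1 rk by (simp_all add: s2_def raw_def)
    have loop: "wp (n * 9 + 7) (For vi vn ?b2 ;; setv vLL (NAdd (var vL) N1)) ?Q s2"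
    proof (rule wp_Seq_frame)
      show "wp (n * 8 + 3) (For vi vn ?b2) (?I2 n) s2"
      proof (rule wp_For_straight[where I = ?I2 and N = n])
        fix i s' assume i: "i < n" "nmem s' vi 0 = i" and sm: "same (insert vi (nwr ?b2)) (rwr ?b2) s2 s'" and I: "?I2 i s'"
        have k: "nmem s' vk 0 = card R" using 2 by (simp add: same_nmem[OF sm])
        obtain l where l: "nmem s' vL 0 = l" "nmem s' vpw 0 = 2 ^ l" "l = 0 \<or> 2 ^ (l - 1) < card R" "card R \<le> 2 ^ l \<or> l = i"
          using I by blast
        show "?I2 (Suc i) (ex ?b2 s')"
        proof (cases "2 ^ l < card R")
          case True
          then show ?thesis using k l by (intro exI[of _ "Suc l"]) auto
        next
          case False
          then show ?thesis using k l by (intro exI[of _ l]) auto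
        qed
      qed (use 2 in auto)
      fix s3 :: state
      assume "?I2 n s3"
      then obtain l where l: "nmem s3 vL 0 = l" "l = 0 \<or> 2 ^ (l - 1) < card R" "card R \<le> 2 ^ l \<or> l = n" by blast
      have "n < 2 ^ n" by (rule less_exp)
      then have "card R \<le> 2 ^ n" using card_R_le by linarith
      then have "card R \<le> 2 ^ l" using l(3) by blast
      then have "l = depth" using l(2) by (rule depth_unique)
      then show "wp (n * 9 + 7 - (n * 8 + 3 + 1)) (setv vLL (NAdd (var vL) N1)) ?Q s3"
        using l(1) by (intro wp_NAssign) auto
    qed simp
    note l = loop[unfolded s2_def]
    show "wp (?T - 2 - (n * 5 + 3 + 1)) (setv vpw N1 ;; setv vL N0 ;; For vi vn ?b2 ;; setv vLL (NAdd (var vL) N1)) ?Q s1"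
      by (rule wp_straight_Seq, simp, simp, rule wp_straight_Seq, simp, simp, rule wp_time_mono[OF l], simp)
  qed simp
  show "wp (?T - (tm (setv vk N0) + 1))
      (For vi vn ?b1 ;; setv vpw N1 ;; setv vL N0 ;; For vi vn ?b2 ;; setv vLL (NAdd (var vL) N1)) ?Q (ex (setv vk N0) s)"
    by (rule wp_time_mono[OF main[unfolded s0_def]]) simp
qed

lemma init_spec:
  "wp (5 * (n * n) + 47 * n + 28 * m + 75) init
     (\<lambda>s. base s \<and> rmem s rM 0 = ereal bound \<and> nmem s vLL 0 = Suc depth) s0"
    (is "wp ?T _ ?Q s0")
  unfolding init_def
proof (rule wp_Seq_frame[OF copy_in_spec])
  fix s1 :: state
  assume 1: "nmem s1 vn 0 = n \<and> nmem s1 vm 0 = m \<and>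
     (\<forall>i<m. nmem s1 aT i = te i \<and> nmem s1 aH i = he i \<and> rmem s1 rE i = w (Inr (ed i))) \<and>
     (\<forall>v<n. nmem s1 aTm v = of_bool (v \<in> terminals G) \<and> nmem s1 aR v = of_bool (v \<in> R)) \<and>
     (\<forall>v\<in>nonterminals G. rmem s1 rV v = w (Inl v))"
  have r1: "raw s1" unfolding raw_def using 1 by blast
  have e1: "rmem s1 rE i = w (Inr (ed i))" if "i < m" for i using 1 that by blast
  have v1: "rmem s1 rV v = w (Inl v)" if "v \<in> nonterminals G" for v using 1 that by blast
  show "wp (?T - (9 * n + 9 * m + 11 + 1)) (cap ;; matrix ;; levels) ?Q s1"
  proof (rule wp_Seq_frame[OF cap_spec[OF r1 e1 v1]])
    fix s2 :: state
    assume 2: "rmem s2 rM 0 = ereal bound \<and>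
     (\<forall>i<m. rmem s2 rE i = ereal (cap_weight (Inr (ed i)))) \<and>
     (\<forall>v\<in>nonterminals G. rmem s2 rV v = ereal (cap_weight (Inl v)))"
      and sm2: "same (nwr cap) (rwr cap) s1 s2"
    have r2: "raw s2" by (rule raw_same[OF r1 sm2]) auto
    have e2: "rmem s2 rE i = ereal (cap_weight (Inr (ed i)))" if "i < m" for i using 2 that by blast
    show "wp (?T - (9 * n + 9 * m + 11 + 1) - (12 * n + 12 * m + 20 + 1)) (matrix ;; levels) ?Q s2"
    proof (rule wp_Seq_frame[OF matrix_spec[OF r2 e2]])
      fix s3 :: state
      assume 3: "(\<forall>v<n. nmem s3 aRow v = v * n) \<and>
        (\<forall>u<n. \<forall>v<n. rmem s3 rW (u * n + v) = (if {u, v} \<in> edges G then ereal (cap_weight (Inr {u, v})) else 0))"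
        and sm3: "same (nwr matrix) (rwr matrix) s2 s3"
      have r3: "raw s3" by (rule raw_same[OF r2 sm3]) auto
      show "wp (?T - (9 * n + 9 * m + 11 + 1) - (12 * n + 12 * m + 20 + 1) - (5 * (n * n) + 12 * n + 7 * m + 20 + 1)) levels ?Q s3"
      proof (rule wp_post_frame[OF levels_spec[OF r3]])
        fix s4 :: state
        assume 4: "nmem s4 vL 0 = depth \<and> nmem s4 vLL 0 = Suc depth" and sm4: "same (nwr levels) (rwr levels) s3 s4"
        have "raw s4" by (rule raw_same[OF r3 sm4]) auto
        moreover have "rmem s4 = rmem s3" using sm4 by (auto simp: same_def)
        moreover have "rmem s3 rE = rmem s2 rE" "rmem s3 rV = rmem s2 rV" "rmem s3 rM = rmem s2 rM"
          by (simp_all add: same_rmem[OF sm3])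
        moreover have "nmem s4 aRow = nmem s3 aRow" by (simp add: same_nmem[OF sm4])
        ultimately show "?Q s4"
          using 2 3 4 by (simp add: base_def raw_def)
      qed simp
    qed (simp only: diff_diff_left, rule add_le_imp_le_diff, linarith)
  qed (assumption, assumption, linarith)
qed linarith

end

section \<open>Random sampling\<close>

lemma lexp_NAssign: "lexp 1 (NAssign a i e) f s = f (nwrite a (nval i s) (nval e s) s)"
  by (simp add: lexp_Suc[of 0, simplified] lexp_0)

lemma lexp_Cond: "lexp (Suc t) (Cond b c1 c2) f s = lexp t (if bval b s then c1 else c2) f s"
  by (simp add: lexp_Suc)

lemma lexp_straight: "straight c \<Longrightarrow> tm c \<le> t \<Longrightarrow> f (ex c s) \<le> lexp t c f s"
  by (rule lexp_ge_of_wp[OF wp_straight[where Q = "\<lambda>s'. s' = ex c s"]]) simp_all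

text \<open>\<open>f i\<close> plays the role of the conditional success probability after
  \<open>i\<close> iterations. If it never exceeds its expectation after one more iteration, its
  initial value bounds the expectation at the end.\<close>

lemma lexp_For:
  assumes fresh: "x \<notin> nwr body" "lm \<notin> nwr body" "x \<noteq> lm"
    and N: "nmem s0 lm 0 = N"
    and indep: "\<And>i s v. f i (nwrite x 0 v s) = f i s"
    and body: "\<And>i s. i < N \<Longrightarrow> nmem s x 0 = i \<Longrightarrow> same (insert x (nwr body)) (rwr body) s0 s
      \<Longrightarrow> f i s \<le> lexp T body (f (Suc i)) s"
  shows "f 0 s0 \<le> lexp (N * (T + 4) + 3) (For x lm body) (f N) s0"
proof -
  let ?inc = "setv x (NAdd (var x) (NConst 1))"
  let ?W = "While (NLess (var x) (var lm)) (Seq body ?inc)"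
  let ?same = "same (insert x (nwr body)) (rwr body)"
  have loop: "f i s \<le> lexp ((N - i) * (T + 4) + 1) ?W (f N) s"
    if "?same s0 s" "nmem s x 0 = i" "i \<le> N" for i s
    using that
  proof (induction "N - i" arbitrary: i s)
    case 0
    then have "i = N" by simp
    moreover have "nmem s lm = nmem s0 lm"
      using 0 fresh by (auto intro: same_nmem)
    ultimately show ?case
      using 0 N by (simp add: lexp_Suc[of 0, simplified])
  next
    case (Suc d)
    then have "i < N" by simp
    have lm: "nmem s lm = nmem s0 lm"
      using Suc.prems fresh by (auto intro: same_nmem)
    let ?t = "(N - Suc i) * (T + 4) + 1"
    have "f i s \<le> lexp T body (f (Suc i)) s"
      using body[OF \<open>i < N\<close>] Suc.prems by blast
    also have "\<dots> = lexp T body (\<lambda>s'. if same (nwr body) (rwr body) s s' then f (Suc i) s' else 0) s"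
      by (rule lexp_frame)
    also have "\<dots> \<le> lexp T body (\<lambda>s'. lexp 1 ?inc (\<lambda>s''. lexp ?t ?W (f N) s'') s') s"
    proof (rule lexp_mono)
      fix s'
      show "(if same (nwr body) (rwr body) s s' then f (Suc i) s' else 0)
        \<le> lexp 1 ?inc (\<lambda>s''. lexp ?t ?W (f N) s'') s'"
      proof (cases "same (nwr body) (rwr body) s s'")
        case True
        let ?s = "nwrite x 0 (Suc i) s'"
        have "nmem s' x = nmem s x" using fresh True by (auto intro: same_nmem)
        then have "lexp 1 ?inc (\<lambda>s''. lexp ?t ?W (f N) s'') s' = lexp ?t ?W (f N) ?s"
          unfolding lexp_NAssign using Suc.prems(2) by simp
        moreover have "?same s0 ?s" using Suc.prems(1) True by (auto simp: same_def)
        then have "f (Suc i) ?s \<le> lexp ?t ?W (f N) ?s"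
          using Suc.hyps(1)[of "Suc i" ?s] Suc.hyps(2) \<open>i < N\<close> by simp
        ultimately show ?thesis using indep True by simp
      qed simp
    qed
    also have "\<dots> \<le> lexp (Suc (T + 1)) (Seq body ?inc) (\<lambda>s''. lexp ?t ?W (f N) s'') s"
      by (rule lexp_Seq)
    also have "\<dots> \<le> lexp (Suc (Suc (T + 1) + ?t)) (Seq (Seq body ?inc) ?W) (f N) s"
      by (rule lexp_Seq)
    also have "\<dots> = lexp (Suc (Suc (Suc (T + 1) + ?t))) ?W (f N) s"
      unfolding lexp_Suc[of "Suc (Suc (T + 1) + ?t)" ?W] using lm N Suc.prems(2) \<open>i < N\<close> by simp
    also have "Suc (Suc (Suc (T + 1) + ?t)) = (N - i) * (T + 4) + 1"
    proof -
      have "N - i = Suc (N - Suc i)" using \<open>i < N\<close> by simp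
      then show ?thesis by simp
    qed
    finally show ?case .
  qed
  have "f 0 s0 = f 0 (nwrite x 0 0 s0)" by (simp add: indep)
  also have "\<dots> \<le> lexp (N * (T + 4) + 1) ?W (f N) (nwrite x 0 0 s0)"
    using loop[of "nwrite x 0 0 s0" 0] by (simp add: same_def)
  also have "\<dots> = lexp 1 (setv x (NConst 0)) (\<lambda>s. lexp (N * (T + 4) + 1) ?W (f N) s) s0"
    unfolding lexp_NAssign by simp
  also have "\<dots> \<le> lexp (Suc (1 + (N * (T + 4) + 1))) (For x lm body) (f N) s0"
    unfolding For_def by (rule lexp_Seq)
  also have "Suc (1 + (N * (T + 4) + 1)) = N * (T + 4) + 3" by simp
  finally show ?thesis .
qed

section \<open>Probabilities of a good sample\<close>

lemma ennreal_average: "0 \<le> x \<Longrightarrow> 0 \<le> y \<Longrightarrow> ennreal ((x + y) / 2) = (ennreal x + ennreal y) / 2"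
  by (simp add: divide_ennreal flip: ennreal_plus ennreal_numeral)

text \<open>Probabilities of the final outcome of an independent sampling with probability \<open>q\<close> while
  \<open>c\<close> elements remain and \<open>a\<close> have been picked: exactly one, respectively at least one, is picked.\<close>

definition prob_one :: "real \<Rightarrow> nat \<Rightarrow> nat \<Rightarrow> real" where
  "prob_one q a c = (if a = 0 then real c * q * (1 - q) ^ (c - 1) else if a = 1 then (1 - q) ^ c else 0)"

definition prob_some :: "real \<Rightarrow> nat \<Rightarrow> nat \<Rightarrow> real" where
  "prob_some q a c = (if a = 0 then 1 - (1 - q) ^ c else 1)"

text \<open>Conditioning on whether the next element is picked.\<close>

lemma prob_one_Suc: "prob_one q a (Suc c) = q * prob_one q (Suc a) c + (1 - q) * prob_one q a c"
  by (cases c) (auto simp: prob_one_def algebra_simps)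

lemma prob_some_Suc: "prob_some q a (Suc c) = q * prob_some q (Suc a) c + (1 - q) * prob_some q a c"
  by (auto simp: prob_some_def algebra_simps)

lemma prob_nonneg: "0 \<le> q \<Longrightarrow> q \<le> 1 \<Longrightarrow> 0 \<le> prob_one q a c" "0 \<le> q \<Longrightarrow> q \<le> 1 \<Longrightarrow> 0 \<le> prob_some q a c"
  by (auto simp: prob_one_def prob_some_def power_le_one)

text \<open>Exactly one of \<open>c\<close> is picked with probability at least 1/4 * 1/2, by
  Bernoulli's inequality and \<open>c * q \<le> 1/2\<close>; at least one of
  \<open>d \<ge> c\<close> is picked with probability at least 1/5. The product is 1/40.\<close>

lemma sampling_success:
  fixes c d :: nat and q :: real
  assumes c: "1 \<le> c" "c \<le> d" and q: "0 < q" "1 / 4 \<le> c * q" "c * q \<le> 1 / 2"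
  shows "1 / 40 \<le> prob_one q 0 c * prob_some q 0 d"
proof -
  have q1: "q \<le> 1"
  proof -
    have "1 * q \<le> c * q" using c q by (intro mult_right_mono) auto
    then show ?thesis using q by linarith
  qed
  have "1 / 2 \<le> 1 + real (c - 1) * (- q)"
    using c q by (simp add: of_nat_diff algebra_simps)
  also have "\<dots> \<le> (1 + (- q)) ^ (c - 1)"
    using q1 by (intro Bernoulli_inequality) simp
  finally have "1 / 2 \<le> (1 - q) ^ (c - 1)" by simp
  then have "(1 / 4) * (1 / 2) \<le> (c * q) * (1 - q) ^ (c - 1)"
    using q by (intro mult_mono) auto
  then have one: "1 / 8 \<le> prob_one q 0 c" by (simp add: prob_one_def)
  \<comment> \<open>An upper bound for \<open>(1 - q) ^ c\<close> without exponentials: its product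
    with \<open>(1 + q) ^ c\<close> is at most 1, and the latter factor is at least 5/4.\<close>
  have "5 / 4 \<le> 1 + real c * q" using q by simp
  also have "\<dots> \<le> (1 + q) ^ c" using q by (intro Bernoulli_inequality) simp
  finally have "(1 - q) ^ c * (5 / 4) \<le> (1 - q) ^ c * (1 + q) ^ c"
    using q1 by (intro mult_left_mono) auto
  also have "\<dots> = (1 - q\<^sup>2) ^ c" by (simp add: power_mult_distrib[symmetric] algebra_simps power2_eq_square)
  also have "\<dots> \<le> 1" using q q1 by (intro power_le_one) (auto simp: power2_eq_square mult_le_one)
  finally have "(1 - q) ^ c \<le> 4 / 5" by simp
  moreover have "(1 - q) ^ d \<le> (1 - q) ^ c" using c q q1 by (intro power_decreasing) auto
  ultimately have "1 / 5 \<le> prob_some q 0 d" by (simp add: prob_some_def)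
  with one have "(1 / 8) * (1 / 5) \<le> prob_one q 0 c * prob_some q 0 d"
    by (intro mult_mono) auto
  then show ?thesis by simp
qed

text \<open>The least \<open>j\<close> with \<open>2 * c \<le> 2 ^ j\<close> satisfies
  \<open>2 ^ j < 4 * c\<close> as well, since \<open>j - 1\<close> fails; it is not 0 because
  \<open>c \<ge> 1\<close>.\<close>

lemma sampling_level:
  fixes c L :: nat
  assumes "1 \<le> c" "2 * c \<le> 2 ^ L"
  obtains j where "j \<le> L" "1 / 4 \<le> real c * (1 / 2) ^ j" "real c * (1 / 2) ^ j \<le> 1 / 2"
proof -
  define j where "j = (LEAST j. 2 * c \<le> 2 ^ j)"
  have le: "2 * c \<le> 2 ^ j" unfolding j_def using assms(2) by (rule LeastI)
  have "j \<le> L" unfolding j_def using assms(2) by (rule Least_le)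
  have "j \<noteq> 0" using le assms(1) by (cases j) auto
  then obtain i where i: "j = Suc i" by (cases j) auto
  then have "\<not> 2 * c \<le> 2 ^ i" unfolding j_def by (metis lessI not_less_Least)
  then have "2 ^ j < 4 * c" using i by simp
  then have "real (2 ^ j) < real (4 * c)" by (simp only: of_nat_less_iff)
  moreover have "real (2 * c) \<le> real (2 ^ j)" using le by (rule of_nat_mono)
  ultimately show ?thesis
    using \<open>j \<le> L\<close> by (intro that[of j]) (auto simp: power_one_over field_simps)
qed

section \<open>The sampling pass\<close>

context cut_program
begin

text \<open>The level of a terminal is the number of successes before the first failure in
  \<open>L\<close> flips: flip \<open>vj\<close> can raise it only if it equals \<open>vj\<close>,
  that is, after nothing but successes. It is at least \<open>j\<close> with probability
  \<open>1/2^j\<close>.\<close>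

definition flip_level :: com where
  "flip_level = Flip vtb N0 ;;
     onlyif (BAnd (eqb (var vtb) N1) (eqb (cell aLev vi) (var vj)))
       (NAssign aLev (var vi) (NAdd (var vj) N1))"

definition sample_vertex :: com where
  "sample_vertex = NAssign aLev (var vi) N0 ;; onlyif (eqb (cell aR vi) N1) (For vj vL flip_level)"

definition sample :: com where
  "sample = For vi vn sample_vertex"

lemma frame_flip_level [simp]: "nwr flip_level = {vtb, aLev}" "rwr flip_level = {}"
  and frame_sample_vertex [simp]: "nwr sample_vertex = {aLev, vj, vtb}" "rwr sample_vertex = {}"
  and frame_sample [simp]: "nwr sample = {vi, aLev, vj, vtb}" "rwr sample = {}"
  by (auto simp: flip_level_def sample_vertex_def sample_def)

end

context graph_data
begin

definition picked :: "nat set \<Rightarrow> nat \<Rightarrow> nat \<Rightarrow> state \<Rightarrow> nat" where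
  "picked C j i s = card {v \<in> C. v < i \<and> j \<le> nmem s aLev v}"

definition pending :: "nat set \<Rightarrow> nat \<Rightarrow> nat" where
  "pending C i = card {v \<in> C. i \<le> v}"

lemma pending_Suc: "finite C \<Longrightarrow> pending C i = pending C (Suc i) + of_bool (i \<in> C)"
proof -
  assume "finite C"
  have "{v \<in> C. i \<le> v} = (if i \<in> C then insert i {v \<in> C. Suc i \<le> v} else {v \<in> C. Suc i \<le> v})"
    by (auto simp: Suc_le_eq le_less)
  with \<open>finite C\<close> show ?thesis by (simp add: pending_def)
qed

lemma picked_Suc:
  assumes "finite C" "nmem s' aLev = (nmem s aLev)(i := h)"
  shows "picked C j (Suc i) s' = picked C j i s + of_bool (i \<in> C \<and> j \<le> h)"
proof -
  have "{v \<in> C. v < Suc i \<and> j \<le> nmem s' aLev v} =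
      (if i \<in> C \<and> j \<le> h then insert i {v \<in> C. v < i \<and> j \<le> nmem s aLev v} else {v \<in> C. v < i \<and> j \<le> nmem s aLev v})"
    using assms(2) by (auto simp: less_Suc_eq)
  with assms(1) show ?thesis by (simp add: picked_def)
qed

text \<open>The probability, given \<open>a\<close> and \<open>b\<close> terminals picked so far,
  that finally exactly one from \<open>C\<close> and at least one from \<open>R - C\<close> is
  picked. It is a product because the two parts are sampled independently.\<close>

definition success :: "nat set \<Rightarrow> real \<Rightarrow> nat \<Rightarrow> nat \<Rightarrow> nat \<Rightarrow> real" where
  "success C q i a b = prob_one q a (pending C i) * prob_some q b (pending (R - C) i)"

lemma success_step:
  assumes "C \<subseteq> R" "i \<in> R"
  shows "success C q i a b = q * success C q (Suc i) (a + of_bool (i \<in> C)) (b + of_bool (i \<notin> C))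
     + (1 - q) * success C q (Suc i) a b"
proof -
  have fin: "finite C" "finite (R - C)" using assms(1) finite_R by (auto intro: finite_subset)
  note p = pending_Suc[OF fin(1), of i] pending_Suc[OF fin(2), of i]
  show ?thesis
  proof (cases "i \<in> C")
    case True
    then have pc: "pending C i = Suc (pending C (Suc i))" "pending (R - C) i = pending (R - C) (Suc i)"
      using p by simp_all
    show ?thesis
      unfolding success_def pc prob_one_Suc using True by (simp add: algebra_simps)
  next
    case False
    then have pc: "pending C i = pending C (Suc i)" "pending (R - C) i = Suc (pending (R - C) (Suc i))"
      using p assms(2) by simp_all
    show ?thesis
      unfolding success_def pc prob_some_Suc using False by (simp add: algebra_simps)
  qed
qed

lemma success_nonneg: "0 \<le> q \<Longrightarrow> q \<le> 1 \<Longrightarrow> 0 \<le> success C q i a b"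
  by (simp add: success_def prob_nonneg)

text \<open>The probability that the level of a vertex becomes at least \<open>j\<close> if it is \<open>h\<close> after \<open>l\<close> flips: the
  level grows only as long as all flips have succeeded.\<close>

definition reach_prob :: "nat \<Rightarrow> nat \<Rightarrow> nat \<Rightarrow> real" where
  "reach_prob j h l = (if j \<le> h then 1 else if h = l then (1 / 2) ^ (j - l) else 0)"

lemma reach_prob_step:
  assumes "h \<le> l"
  shows "reach_prob j h l = (reach_prob j (if h = l then Suc l else h) (Suc l) + reach_prob j h (Suc l)) / 2"
proof (cases "h = l")
  case True
  show ?thesis
  proof (cases "j \<le> Suc l")
    case False
    then have "j - l = Suc (j - Suc l)" by simp
    then show ?thesis using True False by (simp add: reach_prob_def)
  next
    case le: True
    show ?thesis
    proof (cases "j = Suc l")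
      case True
      then show ?thesis using \<open>h = l\<close> by (simp add: reach_prob_def)
    next
      case False
      then show ?thesis using \<open>h = l\<close> le by (simp add: reach_prob_def)
    qed
  qed
qed (use assms in \<open>auto simp: reach_prob_def\<close>)

lemma reach_prob_bounds: "0 \<le> reach_prob j h l" "reach_prob j h l \<le> 1"
  by (auto simp: reach_prob_def power_le_one)

text \<open>The flips for one terminal amount to a single coin of bias \<open>q\<close> that picks
  it. The inner loop tracks the probability that the level will reach \<open>j\<close>, which is
  \<open>q\<close> before the first flip and 0 or 1 after the last.\<close>

lemma sample_vertex_lexp:
  assumes C: "C \<subseteq> R" and j: "j \<le> L" and i: "i < n" "nmem s vi 0 = i" and s: "base s"
  defines "q \<equiv> (1 / 2 :: real) ^ j"
  shows "ennreal (success C q i (picked C j i s) (picked (R - C) j i s))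
    \<le> lexp (L * 8 + 6) sample_vertex (\<lambda>s'. ennreal (success C q (Suc i) (picked C j (Suc i) s') (picked (R - C) j (Suc i) s'))) s"
    (is "?lhs \<le> lexp _ _ ?f s")
proof -
  have q: "0 \<le> q" "q \<le> 1" by (auto simp: q_def power_le_one)
  have fin: "finite C" "finite (R - C)" using C finite_R by (auto intro: finite_subset)
  define a b where "a = picked C j i s" and "b = picked (R - C) j i s"
  have f: "?f s' = ennreal (success C q (Suc i) (a + of_bool (i \<in> C \<and> j \<le> h)) (b + of_bool (i \<in> R - C \<and> j \<le> h)))"
    if "nmem s' aLev = (nmem s aLev)(i := h)" for s' h
    unfolding picked_Suc[OF fin(1) that] picked_Suc[OF fin(2) that] a_def b_def ..
  define s1 where "s1 = nwrite aLev i 0 s"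
  have four: "L * 8 + 4 = Suc (L * 8 + 3)" by simp
  have 1: "nmem s1 vi 0 = i" "nmem s1 vL 0 = L" "nmem s1 aR i = of_bool (i \<in> R)"
    using s i by (simp_all add: s1_def base_def)
  have "?lhs \<le> lexp (L * 8 + 4) (onlyif (eqb (cell aR vi) N1) (For vj vL flip_level)) ?f s1"
  proof (cases "i \<in> R")
    case False
    then have "\<not> bval (eqb (cell aR vi) N1) s1" using 1 by simp
    moreover have "?lhs \<le> ?f s1"
    proof -
      have "i \<notin> C" using False C by auto
      then have "pending C i = pending C (Suc i)" "pending (R - C) i = pending (R - C) (Suc i)"
        using pending_Suc[OF fin(1), of i] pending_Suc[OF fin(2), of i] False by simp_all
      then have "success C q i a b = success C q (Suc i) a b" by (simp add: success_def)
      moreover have "?f s1 = ennreal (success C q (Suc i) a b)"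
        using f[of s1 0] False \<open>i \<notin> C\<close> by (simp add: s1_def)
      ultimately show ?thesis by (simp add: a_def b_def)
    qed
    moreover have "lexp (Suc (L * 8 + 3)) (onlyif (eqb (cell aR vi) N1) (For vj vL flip_level)) ?f s1 = ?f s1"
      unfolding lexp_Cond by (simp only: if_False lexp_Skip calculation(1))
    ultimately show ?thesis by (simp only: four)
  next
    case True
    let ?A = "success C q (Suc i) (a + of_bool (i \<in> C)) (b + of_bool (i \<notin> C))"
    let ?B = "success C q (Suc i) a b"
    \<comment> \<open>The overall success probability if the present terminal is going to be picked
      with probability \<open>p\<close>.\<close>
    let ?v = "\<lambda>p. p * ?A + (1 - p) * ?B"
    have v_nonneg: "0 \<le> ?v (reach_prob j h l)" for h l
      using success_nonneg[OF q] reach_prob_bounds[of j h l] by (intro add_nonneg_nonneg mult_nonneg_nonneg) auto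
    \<comment> \<open>States in which more than the level of \<open>i\<close> has changed get the
      value 0. This carries the loop invariant inside the integrand, since \<open>lexp_For\<close>
      has no separate one.\<close>
    define g where "g l s' = (if \<exists>h\<le>l. nmem s' aLev = (nmem s aLev)(i := h) then ennreal (?v (reach_prob j (nmem s' aLev i) l)) else 0)"
      for l and s' :: state
    have g: "g l s' = ennreal (?v (reach_prob j h l))" if "nmem s' aLev = (nmem s aLev)(i := h)" "h \<le> l" for l h s'
    proof -
      have "nmem s' aLev i = h" using that(1) by simp
      then show ?thesis using that by (auto simp: g_def)
    qed
    have g_0: "g l s' = 0" if "\<not> (\<exists>h\<le>l. nmem s' aLev = (nmem s aLev)(i := h))" for l s'
      unfolding g_def using that by (simp only: if_False)
    have loop: "g 0 s1 \<le> lexp (L * (4 + 4) + 3) (For vj vL flip_level) (g L) s1"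
    proof (rule lexp_For)
      show "g l (nwrite vj 0 v s') = g l s'" for l s' v
      proof -
        have "nmem (nwrite vj 0 v s') aLev = nmem s' aLev" by simp
        then show ?thesis unfolding g_def by (simp only:)
      qed
    next
      fix l s' assume l: "l < L" "nmem s' vj 0 = l" and sm: "same (insert vj (nwr flip_level)) (rwr flip_level) s1 s'"
      have vi': "nmem s' vi 0 = i" using 1 by (simp add: same_nmem[OF sm])
      let ?c = "onlyif (BAnd (eqb (var vtb) N1) (eqb (cell aLev vi) (var vj))) (NAssign aLev (var vi) (NAdd (var vj) N1))"
      show "g l s' \<le> lexp 4 flip_level (g (Suc l)) s'"
      proof (cases "\<exists>h\<le>l. nmem s' aLev = (nmem s aLev)(i := h)")
        case True
        then obtain h where h: "h \<le> l" "nmem s' aLev = (nmem s aLev)(i := h)" by blast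
        let ?h = "if h = l then Suc l else h"
        let ?s1 = "ex ?c (nwrite vtb 0 1 s')" and ?s0 = "ex ?c (nwrite vtb 0 0 s')"
        have m1: "nmem ?s1 aLev = (nmem s aLev)(i := ?h)" using h l vi' by auto
        have m0: "nmem ?s0 aLev = (nmem s aLev)(i := h)" using h l vi' by auto
        have "g l s' = ennreal (?v (reach_prob j h l))" by (rule g[OF h(2,1)])
        also have "?v (reach_prob j h l) = (?v (reach_prob j ?h (Suc l)) + ?v (reach_prob j h (Suc l))) / 2"
          unfolding reach_prob_step[OF h(1), of j] by (simp add: field_simps)
        also have "ennreal \<dots> = (ennreal (?v (reach_prob j ?h (Suc l))) + ennreal (?v (reach_prob j h (Suc l)))) / 2"
          by (rule ennreal_average) (rule v_nonneg)+
        also have "\<dots> = (g (Suc l) ?s1 + g (Suc l) ?s0) / 2"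
          using g[OF m1, of "Suc l"] g[OF m0, of "Suc l"] h(1) by simp
        also have "\<dots> \<le> (lexp 2 ?c (g (Suc l)) (nwrite vtb 0 1 s') + lexp 2 ?c (g (Suc l)) (nwrite vtb 0 0 s')) / 2"
          by (intro divide_right_mono_ennreal add_mono lexp_straight) simp_all
        also have "\<dots> \<le> lexp 1 (Flip vtb N0) (\<lambda>s. lexp 2 ?c (g (Suc l)) s) s'"
          using lexp_Flip[of 1 "\<lambda>s. lexp 2 ?c (g (Suc l)) s" vtb N0 s'] by simp
        also have "\<dots> \<le> lexp (Suc (1 + 2)) flip_level (g (Suc l)) s'"
          unfolding flip_level_def by (rule lexp_Seq)
        also have "Suc (1 + 2) = 4" by simp
        finally show ?thesis .
      qed (simp add: g_0)
    qed (use 1 in auto)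
    have start: "?lhs \<le> g 0 s1"
    proof -
      have "g 0 s1 = ennreal (?v (reach_prob j 0 0))"
        by (rule g) (simp_all add: s1_def)
      moreover have "reach_prob j 0 0 = q" by (simp add: reach_prob_def q_def)
      ultimately show ?thesis using success_step[OF C True, of q a b] by (simp add: a_def b_def)
    qed
    have stop: "lexp t c (g L) s1 \<le> lexp t c ?f s1" for t c
    proof (rule lexp_mono)
      fix s'
      show "g L s' \<le> ?f s'"
      proof (cases "\<exists>h\<le>L. nmem s' aLev = (nmem s aLev)(i := h)")
        case ex: True
        then obtain h where h: "h \<le> L" "nmem s' aLev = (nmem s aLev)(i := h)" by blast
        show ?thesis
        proof (cases "j \<le> h")
          case True
          then have "reach_prob j h L = 1" by (simp add: reach_prob_def)
          then show ?thesis unfolding g[OF h(2,1)] f[OF h(2)] using \<open>i \<in> R\<close> True by simp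
        next
          case False
          then have "reach_prob j h L = 0" using j by (simp add: reach_prob_def)
          then show ?thesis unfolding g[OF h(2,1)] f[OF h(2)] using False by simp
        qed
      qed (simp add: g_0)
    qed
    have c: "bval (eqb (cell aR vi) N1) s1" using 1 True by simp
    have "?lhs \<le> lexp (L * (4 + 4) + 3) (For vj vL flip_level) ?f s1"
      using start loop stop by (blast intro: order_trans)
    also have "\<dots> = lexp (Suc (L * (4 + 4) + 3)) (onlyif (eqb (cell aR vi) N1) (For vj vL flip_level)) ?f s1"
      unfolding lexp_Cond by (simp only: c if_True)
    also have "Suc (L * (4 + 4) + 3) = L * 8 + 4" by simp
    finally show ?thesis .
  qed
  also have "\<dots> = lexp 1 (NAssign aLev (var vi) N0) (\<lambda>s. lexp (L * 8 + 4) (onlyif (eqb (cell aR vi) N1) (For vj vL flip_level)) ?f s) s"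
    unfolding lexp_NAssign using i by (simp add: s1_def)
  also have "\<dots> \<le> lexp (Suc (1 + (L * 8 + 4))) sample_vertex ?f s"
    unfolding sample_vertex_def by (rule lexp_Seq)
  also have "Suc (1 + (L * 8 + 4)) = L * 8 + 6" by simp
  finally show ?thesis .
qed

lemma sample_lexp:
  assumes C: "C \<subseteq> R" and j: "j \<le> L" and s: "base s"
  defines "q \<equiv> (1 / 2 :: real) ^ j"
  shows "ennreal (prob_one q 0 (card C) * prob_some q 0 (card (R - C)))
    \<le> lexp (n * (L * 8 + 10) + 3) sample (\<lambda>s'. if picked C j n s' = 1 \<and> 1 \<le> picked (R - C) j n s' then 1 else 0) s"
proof -
  let ?f = "\<lambda>i s'. ennreal (success C q i (picked C j i s') (picked (R - C) j i s'))"
  have "?f 0 s \<le> lexp (n * (L * 8 + 6 + 4) + 3) sample (?f n) s"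
    unfolding sample_def
  proof (rule lexp_For)
    show "?f i (nwrite vi 0 v s') = ?f i s'" for i v s' by (simp add: picked_def)
    fix i s' assume i: "i < n" "nmem s' vi 0 = i" and sm: "same (insert vi (nwr sample_vertex)) (rwr sample_vertex) s s'"
    have "base s'" by (rule base_same[OF s sm]) auto
    then show "?f i s' \<le> lexp (L * 8 + 6) sample_vertex (?f (Suc i)) s'"
      unfolding q_def by (rule sample_vertex_lexp[OF C j i])
  qed (use s in \<open>auto simp: base_def\<close>)
  also have "\<dots> \<le> lexp (n * (L * 8 + 6 + 4) + 3) sample (\<lambda>s'. if picked C j n s' = 1 \<and> 1 \<le> picked (R - C) j n s' then 1 else 0) s"
  proof (rule lexp_mono)
    fix s'
    \<comment> \<open>With no terminal left, the conditional probability is the indicator of a good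
      sample.\<close>
    have "pending C n = 0" "pending (R - C) n = 0"
    proof -
      have e: "{v \<in> C. n \<le> v} = {}" "{v \<in> R - C. n \<le> v} = {}" using C R_n by fastforce+
      show "pending C n = 0" "pending (R - C) n = 0" unfolding pending_def e by simp_all
    qed
    then show "?f n s' \<le> (if picked C j n s' = 1 \<and> 1 \<le> picked (R - C) j n s' then 1 else 0)"
      by (auto simp: success_def prob_one_def prob_some_def)
  qed
  finally have le: "?f 0 s \<le> \<dots>" .
  have "picked C j 0 s = 0" "picked (R - C) j 0 s = 0" "pending C 0 = card C" "pending (R - C) 0 = card (R - C)"
    by (simp_all add: picked_def pending_def set_diff_eq)
  moreover have "L * 8 + 6 + 4 = L * 8 + 10" by simp
  ultimately show ?thesis using le by (simp only: success_def)
qed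

lemma sample_halts:
  assumes s: "base s"
  shows "wp (n * (L * 8 + 10) + 3) sample (\<lambda>_. True) s"
  unfolding sample_def
proof (rule wp_For_const[where I = "\<lambda>_ _. True" and N = n and T = "L * 8 + 6"])
  fix i s' assume sm: "same (insert vi (nwr sample_vertex)) (rwr sample_vertex) s s'"
  have b: "base s'" by (rule base_same[OF s sm]) auto
  let ?c = "For vj vL flip_level"
  have loop: "wp (L * 8 + 3) ?c (\<lambda>_. True) s1" if "nmem s1 vL 0 = L" for s1
  proof (rule wp_For_const[where I = "\<lambda>_ _. True" and N = L and T = 4])
    fix l s2
    show "wp 4 flip_level (\<lambda>_. True) s2"
      unfolding flip_level_def
      by (rule wp_Seq[where ?t1.0 = 1 and ?t2.0 = 2]) (auto intro!: wp_Flip wp_straight)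
  qed (use that in auto)
  show "wp (L * 8 + 6) sample_vertex (\<lambda>_. True) s'"
    unfolding sample_vertex_def
  proof (rule wp_straight_Seq)
    let ?s = "ex (NAssign aLev (var vi) N0) s'"
    have "nmem ?s vL 0 = L" using b by (simp add: base_def)
    from loop[OF this] have "wp (L * 8 + 3) (if bval (eqb (cell aR vi) N1) ?s then ?c else Skip) (\<lambda>_. True) ?s"
      by (cases "bval (eqb (cell aR vi) N1) ?s") (simp_all only: if_True if_False wp_Skip)
    then show "wp (L * 8 + 6 - (tm (NAssign aLev (var vi) N0) + 1)) (onlyif (eqb (cell aR vi) N1) ?c) (\<lambda>_. True) ?s"
      by (rule wp_Cond) simp
  qed simp_all
qed (use s in \<open>auto simp: base_def\<close>)

end

section \<open>Correctness and running time\<close>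

context cut_program
begin

text \<open>The last test undoes the capping: a value below the cap \<open>rM\<close> involves no
  infinite weight, and any other value stands for infinity.\<close>

definition search :: com where
  "search = setr rBest RInf ;; For vlev vLL level ;;
     Cond (RLess (rvar rBest) (rvar rM)) (RAssign aResult N0 (rvar rBest)) (RAssign aResult N0 RInf)"

definition algorithm :: com where
  "algorithm = init ;; sample ;; search"

end

context graph_data
begin

definition sampled :: "(nat \<Rightarrow> nat) \<Rightarrow> nat \<Rightarrow> nat set" where
  "sampled lev j = {v \<in> R. j \<le> lev v}"

lemma search_spec:
  assumes s: "base s" and M: "rmem s rM 0 = ereal c" and LL: "nmem s vLL 0 = Suc L"
  defines "lev \<equiv> nmem s aLev"
  shows "wp (Suc L * (L * (Tec m n + 30 * n + 15 * m + 45) + max_split_time Tec m n + 67 * (n * n) + 50 * m + 140 * n + 74) + 10)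
    search (\<lambda>s'. \<exists>best. attained best \<and>
      (\<forall>j\<le>L. 2 \<le> card (sampled lev j) \<longrightarrow> (\<forall>r\<in>sampled lev j. below (sampled lev j) r best)) \<and>
      rmem s' aResult 0 = (if best < ereal c then best else \<infinity>)) s"
    (is "wp ?T _ ?Q s")
  unfolding search_def
proof (rule wp_straight_Seq, simp, simp)
  let ?TL = "L * (Tec m n + 30 * n + 15 * m + 45) + max_split_time Tec m n + 67 * (n * n) + 50 * m + 140 * n + 70"
  define s0 where "s0 = ex (setr rBest RInf) s"
  have 0: "base s0" "rmem s0 rM 0 = ereal c" "nmem s0 vLL 0 = Suc L" "nmem s0 aLev = lev" "rmem s0 rBest 0 = \<infinity>"
    using s M LL by (simp_all add: s0_def base_def lev_def)
  let ?I = "\<lambda>i s'. attained (rmem s' rBest 0) \<and>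
      (\<forall>j<i. 2 \<le> card (sampled lev j) \<longrightarrow> (\<forall>r\<in>sampled lev j. below (sampled lev j) r (rmem s' rBest 0)))"
  let ?c = "Cond (RLess (rvar rBest) (rvar rM)) (RAssign aResult N0 (rvar rBest)) (RAssign aResult N0 RInf)"
  have main: "wp (Suc L * (?TL + 4) + 8) (For vlev vLL level ;; ?c) ?Q s0"
  proof (rule wp_Seq_frame)
    show "wp (Suc L * (?TL + 4) + 3) (For vlev vLL level) (?I (Suc L)) s0"
    proof (rule wp_For_const[where I = ?I and N = "Suc L" and T = ?TL])
      show "?I 0 s0" using 0 by (simp add: attained_def)
    next
      fix i s' assume i: "nmem s' vlev 0 = i" and sm: "same (insert vlev (nwr level)) (rwr level) s0 s'" and I: "?I i s'"
      have b: "base s'" by (rule base_same[OF 0(1) sm]) auto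
      have lv: "nmem s' aLev v = lev v" for v using 0 by (simp add: same_nmem[OF sm])
      show "wp ?TL level (?I (Suc i)) s'"
      proof (rule wp_conseq[OF level_spec[OF b lv i conjunct1[OF I]], folded sampled_def])
        fix s'' :: state
        assume q: "attained (rmem s'' rBest 0) \<and> rmem s'' rBest 0 \<le> rmem s' rBest 0 \<and>
          (2 \<le> card (sampled lev i) \<longrightarrow> (\<forall>r\<in>sampled lev i. below (sampled lev i) r (rmem s'' rBest 0)))"
        have "below (sampled lev j) r (rmem s'' rBest 0)"
          if j: "j < Suc i" "2 \<le> card (sampled lev j)" "r \<in> sampled lev j" for j r
        proof (cases "j = i")
          case False
          then have "below (sampled lev j) r (rmem s' rBest 0)" using I j by auto
          then show ?thesis using q by (blast intro: below_mono)
        qed (use q j in blast)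
        with q show "?I (Suc i) s''" by blast
      qed
    qed (use 0 in simp_all)
    fix s1 :: state
    assume I: "?I (Suc L) s1" and sm: "same (nwr (For vlev vLL level)) (rwr (For vlev vLL level)) s0 s1"
    have "rmem s1 rM 0 = ereal c" using 0 by (simp add: same_rmem[OF sm])
    moreover have "\<forall>j\<le>L. 2 \<le> card (sampled lev j) \<longrightarrow> (\<forall>r\<in>sampled lev j. below (sampled lev j) r (rmem s1 rBest 0))"
      using I by (simp add: less_Suc_eq_le)
    ultimately show "wp (Suc L * (?TL + 4) + 8 - (Suc L * (?TL + 4) + 3 + 1)) ?c ?Q s1"
      using I by (intro wp_straight) (auto intro!: exI[of _ "rmem s1 rBest 0"])
  qed simp
  show "wp (?T - (tm (setr rBest RInf) + 1)) (For vlev vLL level ;; ?c) ?Q (ex (setr rBest RInf) s)"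
    by (rule wp_time_mono[OF main[unfolded s0_def]]) simp
qed

end

section \<open>From the best capped value to the element connectivity of \<open>R\<close>\<close>

context element_instance
begin

lemma finite_kappas: "finite {kappa G w s t | s t. s \<in> R \<and> t \<in> R \<and> s \<noteq> t}"
  by (rule finite_subset[of _ "(\<lambda>(s, t). kappa G w s t) ` (R \<times> R)"]) (use finite_R in auto)

lemma kappa_set_le:
  assumes "s \<in> R" "t \<in> R" "s \<noteq> t" "element_cut G {s} {t} X"
  shows "kappa_set G w R \<le> sum w X"
proof -
  have "kappa_set G w R \<le> kappa G w s t"
    unfolding kappa_set_def using assms by (intro Min_le finite_kappas) blast
  also have "\<dots> \<le> sum w X"
    unfolding kappa_def using assms(4) by (intro Min_le finite_element_cut_weights[OF G]) blast
  finally show ?thesis .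
qed

lemma kappa_set_attained:
  obtains s t X where "s \<in> R" "t \<in> R" "s \<noteq> t" "element_cut G {s} {t} X" "kappa_set G w R = sum w X"
proof -
  obtain a b where "a \<in> R" "b \<in> R" "a \<noteq> b"
    using R2 by (metis card_le_Suc0_iff_eq finite_R not_less_eq_eq numeral_2_eq_2)
  then have "{kappa G w s t | s t. s \<in> R \<and> t \<in> R \<and> s \<noteq> t} \<noteq> {}" by blast
  then have "kappa_set G w R \<in> {kappa G w s t | s t. s \<in> R \<and> t \<in> R \<and> s \<noteq> t}"
    unfolding kappa_set_def by (intro Min_in finite_kappas)
  then obtain s t where st: "s \<in> R" "t \<in> R" "s \<noteq> t" "kappa_set G w R = kappa G w s t" by blast
  have "{sum w X | X. element_cut G {s} {t} X} \<noteq> {}"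
    using element_cut_all_edges[of "{s}" "{t}" G] st(3) by blast
  then have "kappa G w s t \<in> {sum w X | X. element_cut G {s} {t} X}"
    unfolding kappa_def by (intro Min_in finite_element_cut_weights[OF G])
  with st that show ?thesis by auto
qed

text \<open>A value below the cap is the true weight of a cut, hence not below the optimum. A value
  not below the cap excludes a finite optimum, which would be smaller than \<open>bound\<close> and
  an upper bound for \<open>best\<close>.\<close>

lemma result_correct:
  assumes att: "attained best" and le: "kappa_set G w R \<noteq> \<infinity> \<Longrightarrow> best \<le> kappa_set G w R"
  shows "(if best < ereal bound then best else \<infinity>) = kappa_set G w R"
proof (cases "best < ereal bound")
  case True
  then obtain r b X where X: "r \<in> R" "b \<in> R" "r \<noteq> b" "element_cut G {r} {b} X" "best = ereal (sum cap_weight X)"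
    using att by (auto simp: attained_def)
  then have "sum w X = best"
    using True cap_sum_less[of X] by (simp add: element_cut_def)
  then have k: "kappa_set G w R \<le> best" using kappa_set_le[OF X(1-4)] by simp
  then have "kappa_set G w R \<noteq> \<infinity>" using X(5) by auto
  with le k True show ?thesis by simp
next
  case False
  have "kappa_set G w R = \<infinity>"
  proof (rule ccontr)
    assume fin: "kappa_set G w R \<noteq> \<infinity>"
    obtain s t X where X: "element_cut G {s} {t} X" "kappa_set G w R = sum w X"
      using kappa_set_attained by metis
    then have "X \<subseteq> elements G" by (simp add: element_cut_def)
    from cap_sum_finite[OF this] X(2) fin have "kappa_set G w R < ereal bound" by simp
    with le[OF fin] False show False by simp
  qed
  with False show ?thesis by simp
qed

text \<open>The complementary biset has the same boundary, so the side with fewer terminals of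
  \<open>R\<close> may be taken.\<close>

lemma optimal_side:
  assumes "kappa_set G w R \<noteq> \<infinity>"
  obtains S T where "biset G S T" "1 \<le> card (R \<inter> S)" "card (R \<inter> S) \<le> card (R - S)"
    "ereal (sum cap_weight (boundary G S T)) \<le> kappa_set G w R"
proof -
  obtain s t X where st: "s \<in> R" "t \<in> R" "s \<noteq> t" "element_cut G {s} {t} X" "kappa_set G w R = sum w X"
    by (rule kappa_set_attained)
  have Xel: "X \<subseteq> elements G" using st(4) by (simp add: element_cut_def)
  obtain S T where ST: "biset G S T" "boundary G S T \<subseteq> X" "{s} \<subseteq> S" "{t} \<inter> T = {}"
    using element_cut_biset[OF G st(4)] st R by blast
  have "sum cap_weight (boundary G S T) \<le> sum cap_weight X"
    using ST(2) Xel finite_elements[OF G] cap_weight_pos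
    by (intro sum_mono2) (auto intro: finite_subset less_imp_le)
  then have le: "ereal (sum cap_weight (boundary G S T)) \<le> kappa_set G w R"
    using cap_sum_finite(1)[OF Xel] st(5) assms by simp
  \<comment> \<open>\<open>T - S\<close> consists of nonterminals, so for terminals lying outside
    \<open>T\<close> and lying outside \<open>S\<close> are the same.\<close>
  have R_T: "R \<inter> (verts G - T) = R - S"
    using ST(1) R R_n V by (auto simp: biset_def nonterminals_def)
  have R_T': "R - (verts G - T) = R \<inter> S"
    using ST(1) R R_n V by (auto simp: biset_def nonterminals_def)
  have "s \<in> R \<inter> S" "t \<in> R - S" using st ST by (auto simp: biset_def)
  then have pos: "1 \<le> card (R \<inter> S)" "1 \<le> card (R - S)"
    using finite_R by (auto simp: Suc_le_eq card_gt_0_iff)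
  show ?thesis
  proof (cases "card (R \<inter> S) \<le> card (R - S)")
    case True
    with ST(1) pos le show ?thesis by (intro that[of S T])
  next
    case False
    then show ?thesis
      using biset_compl[OF ST(1)] boundary_compl[OF G ST(1)] le pos
      by (intro that[of "verts G - T" "verts G - S"]) (simp_all add: R_T R_T')
  qed
qed

text \<open>If the sample meets \<open>C\<close> in \<open>r\<close> alone, the optimal biset
  isolates \<open>r\<close> within the sample and \<open>best\<close> cannot exceed its weight. If
  the optimum is infinite, soundness alone settles the claim.\<close>

lemma algorithm_correct:
  assumes j: "j \<le> depth" and one: "picked C j n s = 1" and some: "1 \<le> picked (R - C) j n s"
    and C: "kappa_set G w R \<noteq> \<infinity> \<Longrightarrow> \<exists>S T. biset G S T \<and> R \<inter> S = C \<and>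
      ereal (sum cap_weight (boundary G S T)) \<le> kappa_set G w R" and CR: "C \<subseteq> R"
    and best: "attained best" "\<forall>j\<le>depth. 2 \<le> card (sampled (nmem s aLev) j) \<longrightarrow>
      (\<forall>r\<in>sampled (nmem s aLev) j. below (sampled (nmem s aLev) j) r best)"
  shows "(if best < ereal bound then best else \<infinity>) = kappa_set G w R"
proof (rule result_correct[OF best(1)])
  assume "kappa_set G w R \<noteq> \<infinity>"
  then obtain S T where ST: "biset G S T" "R \<inter> S = C" "ereal (sum cap_weight (boundary G S T)) \<le> kappa_set G w R"
    using C by blast
  let ?S = "sampled (nmem s aLev) j"
  have pC: "{v \<in> C. v < n \<and> j \<le> nmem s aLev v} = C \<inter> ?S"
    and pD: "{v \<in> R - C. v < n \<and> j \<le> nmem s aLev v} = (R - C) \<inter> ?S"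
    using CR R_n by (auto simp: sampled_def)
  have "card (C \<inter> ?S) = 1" using one by (simp add: picked_def pC)
  then obtain r where r: "C \<inter> ?S = {r}" by (auto simp: card_1_singleton_iff)
  have "card ((R - C) \<inter> ?S) \<noteq> 0" using some unfolding picked_def pD by simp
  moreover have SR: "?S \<subseteq> R" by (auto simp: sampled_def)
  then have fin: "finite ?S" using finite_R by (rule finite_subset)
  have split: "(C \<inter> ?S) \<union> ((R - C) \<inter> ?S) = ?S" using SR by blast
  have "card ((C \<inter> ?S) \<union> ((R - C) \<inter> ?S)) = card (C \<inter> ?S) + card ((R - C) \<inter> ?S)"
    using fin by (intro card_Un_disjoint) auto
  then have "card ?S = card (C \<inter> ?S) + card ((R - C) \<inter> ?S)" unfolding split .
  ultimately have "2 \<le> card ?S" using r by simp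
  moreover have "r \<in> ?S" using r by blast
  ultimately have "below ?S r best" using best(2) j by blast
  moreover have "S \<inter> ?S = {r}" using r ST(2) SR by blast
  ultimately have "best \<le> ereal (sum cap_weight (boundary G S T))"
    using ST(1) by (simp add: below_def)
  with ST(3) show "best \<le> kappa_set G w R" by (rule order_trans[rotated])
qed

text \<open>Preparation, sampling and search, with 2 steps for the two compositions.\<close>

definition run_time :: nat where
  "run_time = (5 * (n * n) + 47 * n + 28 * m + 75) + (n * (depth * 8 + 10) + 3) +
     (Suc depth * (depth * (Tec m n + 30 * n + 15 * m + 45) + max_split_time Tec m n + 67 * (n * n) + 50 * m + 140 * n + 74) + 10) + 2"

lemma algorithm_halts: "wp run_time algorithm (\<lambda>_. True) s0"
  unfolding algorithm_def
proof (rule wp_Seq_frame[OF init_spec])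
  fix s1 :: state
  assume 1: "base s1 \<and> rmem s1 rM 0 = ereal bound \<and> nmem s1 vLL 0 = Suc depth"
  show "wp (run_time - (5 * (n * n) + 47 * n + 28 * m + 75 + 1)) (sample ;; search) (\<lambda>_. True) s1"
  proof (rule wp_Seq_frame[OF sample_halts])
    show "base s1" using 1 by blast
    fix s2 assume sm: "same (nwr sample) (rwr sample) s1 s2"
    have "base s2" by (rule base_same[OF _ sm]) (use 1 in auto)
    moreover have "rmem s2 rM 0 = ereal bound" "nmem s2 vLL 0 = Suc depth"
      using 1 by (simp_all add: same_nmem[OF sm] same_rmem[OF sm])
    ultimately show "wp (run_time - (5 * (n * n) + 47 * n + 28 * m + 75 + 1) - (n * (depth * 8 + 10) + 3 + 1)) search (\<lambda>_. True) s2"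
      by (intro wp_weaken[OF search_spec]) (simp_all add: run_time_def)
  qed (simp add: run_time_def)
qed (simp add: run_time_def)

lemma algorithm_success:
  "1 / 40 \<le> measure_pmf.prob (run run_time algorithm s0) {(c', s'). rmem s' aResult 0 = kappa_set G w R}"
proof -
  let ?good = "\<lambda>s'. rmem s' aResult 0 = kappa_set G w R"
  let ?f = "\<lambda>s'. if ?good s' then 1 else 0 :: ennreal"
  obtain C where C: "C \<subseteq> R" "1 \<le> card C" "card C \<le> card (R - C)"
    "kappa_set G w R \<noteq> \<infinity> \<Longrightarrow> \<exists>S T. biset G S T \<and> R \<inter> S = C \<and> ereal (sum cap_weight (boundary G S T)) \<le> kappa_set G w R"
  proof (cases "kappa_set G w R = \<infinity>")
    case True
    \<comment> \<open>The condition on \<open>C\<close> is vacuous here; any set of the right size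
      will do for the probability bound.\<close>
    obtain a where "a \<in> R" using R2 by (metis card.empty all_not_in_conv not_numeral_le_zero)
    then show ?thesis using True R2 finite_R by (intro that[of "{a}"]) (auto simp: card_Diff_singleton)
  next
    case False
    obtain S T where "biset G S T" "1 \<le> card (R \<inter> S)" "card (R \<inter> S) \<le> card (R - S)"
      "ereal (sum cap_weight (boundary G S T)) \<le> kappa_set G w R"
      using optimal_side[OF False] .
    moreover have "R - R \<inter> S = R - S" by blast
    ultimately show ?thesis by (intro that[of "R \<inter> S"]) auto
  qed
  have "2 * card C \<le> card R"
  proof -
    have "card R = card C + card (R - C)"
      using C(1) finite_R by (metis card_Diff_subset card_mono finite_subset le_add_diff_inverse)
    with C(3) show ?thesis by simp
  qed
  then have "2 * card C \<le> 2 ^ depth" using depth by (rule le_trans)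
  with C(2) obtain j where j: "j \<le> depth" "1 / 4 \<le> real (card C) * (1 / 2) ^ j" "real (card C) * (1 / 2) ^ j \<le> 1 / 2"
    by (rule sampling_level)
  let ?ev = "\<lambda>s'. if picked C j n s' = 1 \<and> 1 \<le> picked (R - C) j n s' then 1 else 0 :: ennreal"
  define t1 where "t1 = 5 * (n * n) + 47 * n + 28 * m + 75"
  define t2 where "t2 = n * (depth * 8 + 10) + 3"
  define t3 where "t3 = Suc depth * (depth * (Tec m n + 30 * n + 15 * m + 45) + max_split_time Tec m n + 67 * (n * n) + 50 * m + 140 * n + 74) + 10"
  have third: "?ev s2 \<le> lexp t3 search ?f s2"
    if s2: "base s2" "rmem s2 rM 0 = ereal bound" "nmem s2 vLL 0 = Suc depth" for s2
  proof (cases "picked C j n s2 = 1 \<and> 1 \<le> picked (R - C) j n s2")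
    case True
    show ?thesis
    proof (rule lexp_ge_of_wp[OF search_spec[OF s2], folded t3_def])
      fix s' :: state
      assume "\<exists>best. attained best \<and>
        (\<forall>j\<le>depth. 2 \<le> card (sampled (nmem s2 aLev) j) \<longrightarrow>
          (\<forall>r\<in>sampled (nmem s2 aLev) j. below (sampled (nmem s2 aLev) j) r best)) \<and>
        rmem s' aResult 0 = (if best < ereal bound then best else \<infinity>)"
      then obtain best where b: "attained best" "\<forall>j\<le>depth. 2 \<le> card (sampled (nmem s2 aLev) j) \<longrightarrow>
          (\<forall>r\<in>sampled (nmem s2 aLev) j. below (sampled (nmem s2 aLev) j) r best)"
        "rmem s' aResult 0 = (if best < ereal bound then best else \<infinity>)" by blast
      have "?good s'"
        unfolding b(3) using True by (intro algorithm_correct[OF j(1) _ _ C(4,1) b(1,2)]) auto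
      then show "?ev s2 \<le> ?f s'" by simp
    qed
  next
    case False
    show ?thesis unfolding if_not_P[OF False] by simp
  qed
  have second: "ennreal (1 / 40) \<le> lexp (Suc (t2 + t3)) (sample ;; search) ?f s1"
    if s1: "base s1" "rmem s1 rM 0 = ereal bound" "nmem s1 vLL 0 = Suc depth" for s1
  proof -
    have "1 / 40 \<le> prob_one ((1 / 2) ^ j) 0 (card C) * prob_some ((1 / 2) ^ j) 0 (card (R - C))"
      using C j by (intro sampling_success) auto
    then have "ennreal (1 / 40) \<le> ennreal (prob_one ((1 / 2) ^ j) 0 (card C) * prob_some ((1 / 2) ^ j) 0 (card (R - C)))"
      by (rule ennreal_leI)
    also have "\<dots> \<le> lexp t2 sample ?ev s1"
      unfolding t2_def by (rule sample_lexp[OF C(1) j(1) s1(1)])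
    also have "\<dots> = lexp t2 sample (\<lambda>s'. if same (nwr sample) (rwr sample) s1 s' then ?ev s' else 0) s1"
      by (rule lexp_frame)
    also have "\<dots> \<le> lexp t2 sample (\<lambda>s2. lexp t3 search ?f s2) s1"
    proof (rule lexp_mono)
      fix s2
      show "(if same (nwr sample) (rwr sample) s1 s2 then ?ev s2 else 0) \<le> lexp t3 search ?f s2"
      proof (cases "same (nwr sample) (rwr sample) s1 s2")
        case True
        have "base s2" by (rule base_same[OF s1(1) True]) auto
        moreover have "rmem s2 rM 0 = ereal bound" "nmem s2 vLL 0 = Suc depth"
          using s1 by (simp_all add: same_nmem[OF True] same_rmem[OF True])
        ultimately have "?ev s2 \<le> lexp t3 search ?f s2" by (rule third)
        then show ?thesis by (simp only: True if_True)
      qed simp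
    qed
    also have "\<dots> \<le> lexp (Suc (t2 + t3)) (sample ;; search) ?f s1"
      by (rule lexp_Seq)
    finally show ?thesis .
  qed
  have "ennreal (1 / 40) \<le> lexp t1 init (\<lambda>s1. lexp (Suc (t2 + t3)) (sample ;; search) ?f s1) s0"
    by (rule lexp_ge_of_wp[OF init_spec, folded t1_def]) (use second in blast)
  also have "\<dots> \<le> lexp (Suc (t1 + Suc (t2 + t3))) algorithm ?f s0"
    unfolding algorithm_def by (rule lexp_Seq)
  also have "Suc (t1 + Suc (t2 + t3)) = run_time"
    by (simp add: run_time_def t1_def t2_def t3_def)
  also have "lexp run_time algorithm ?f s0
      \<le> (\<integral>\<^sup>+ x. indicator {(c', s'). ?good s'} x \<partial>measure_pmf (run run_time algorithm s0))"
    unfolding lexp_def by (intro nn_integral_mono) (auto split: split_indicator)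
  also have "\<dots> = ennreal (measure_pmf.prob (run run_time algorithm s0) {(c', s'). ?good s'})"
    by (simp add: measure_pmf.emeasure_eq_measure)
  finally show ?thesis
    by (simp add: ennreal_le_iff)
qed

lemma edges_le_square: "m \<le> n * n"
proof -
  have "edges G \<subseteq> (\<lambda>(u, v). {u, v}) ` ({..<n} \<times> {..<n})"
    unfolding E using ed_n by auto
  then have "card (edges G) \<le> card ((\<lambda>(u, v). {u, v}) ` ({..<n} \<times> {..<n}))"
    by (intro card_mono) auto
  also have "\<dots> \<le> card ({..<n} \<times> {..<n})"
    by (rule card_image_le) simp
  finally show ?thesis using cE by simp
qed

text \<open>The lower bound is proved for unit weights, so the real memory of the input is replaced;
  graph and terminals remain.\<close>

lemma Tec_ge: "m + n \<le> Tec m n"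
proof -
  obtain a b where ab: "a \<in> R" "b \<in> R" "a \<noteq> b"
    using kappa_set_attained by metis
  define s where "s = s0\<lparr>rmem := (\<lambda>_ _. 1)\<rparr>"
  have ed: "edge_at s = edge_at s0" by (rule ext) (simp add: edge_at_def s_def)
  have mems: "nmem s = nmem s0" "rmem s = (\<lambda>_ _. 1)" by (simp_all add: s_def)
  have "graph_input G (\<lambda>_. 1) s"
    unfolding graph_input_def ed mems using inp unfolding graph_input_def by blast
  from solver_time_lower_bound[OF solver G _ _ ab(3) this] ab R show ?thesis
    unfolding m_def n_def by blast
qed

text \<open>There are \<open>depth + 1\<close> levels with at most \<open>depth\<close> rounds each,
  and the rest of a level costs a constant multiple of the split maximum. Both counts are of order
  log k; for the levels this is weakened to log n.\<close>

lemma run_time_le: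
  defines "k \<equiv> card R"
  shows "real run_time \<le> 2000 * ((real (Tec m n) * log 2 (real k) + real (max_split_time Tec m n)) * log 2 (real n))"
proof -
  define T M where "T = real (Tec m n)" and "M = real (max_split_time Tec m n)"
  define a b where "a = log 2 (real k)" and "b = log 2 (real n)"
  have kn: "2 \<le> k" "k \<le> n" using R2 card_R_le by (simp_all add: k_def)
  have a1: "1 \<le> a" using kn by (simp add: a_def le_log_iff)
  have ab: "a \<le> b" using kn by (simp add: a_def b_def)
  \<comment> \<open>Minimality of \<open>depth\<close> gives \<open>depth - 1 < a\<close>, and the
    excess of 1 is absorbed by \<open>a\<close>, which is at least 1.\<close>
  have d: "real depth \<le> 2 * a"
  proof (cases depth)
    case (Suc l)
    then have "2 ^ l < k" using depth_less[of l] by (simp add: k_def)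
    then have "real (2 ^ l) < real k" by (simp only: of_nat_less_iff)
    then have "real l < a" using kn by (simp add: a_def less_log_iff powr_realpow)
    then show ?thesis using Suc a1 by simp
  qed (use a1 in simp)
  have n2: "2 \<le> n" using kn by simp
  have nn: "n \<le> n * n" "1 \<le> n * n" using n2 by auto
  have M_nn: "n * n \<le> max_split_time Tec m n" by (rule max_split_time_ge_square[OF solver n2])
  let ?M = "max_split_time Tec m n"
  have part1: "5 * (n * n) + 47 * n + 28 * m + 75 + 15 \<le> 170 * ?M"
    \<comment> \<open>The graph is simple, so \<open>m\<close> is at most \<open>n * n\<close> and
      terms linear in \<open>m\<close> are absorbed by the split maximum as well.\<close>
    using M_nn nn edges_le_square by linarith
  have part2: "n * (depth * 8 + 10) \<le> ?M * (depth * 8 + 10)"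
    using M_nn nn by (intro mult_right_mono) linarith+
  have inner: "Tec m n + 30 * n + 15 * m + 45 \<le> 54 * Tec m n"
    using Tec_ge n2 by linarith
  have outer: "?M + 67 * (n * n) + 50 * m + 140 * n + 74 \<le> 332 * ?M"
    using M_nn nn edges_le_square by linarith
  have part3: "Suc depth * (depth * (Tec m n + 30 * n + 15 * m + 45) + ?M + 67 * (n * n) + 50 * m + 140 * n + 74)
      \<le> Suc depth * (depth * (54 * Tec m n) + 332 * ?M)"
  proof (rule mult_le_mono2)
    show "depth * (Tec m n + 30 * n + 15 * m + 45) + ?M + 67 * (n * n) + 50 * m + 140 * n + 74
        \<le> depth * (54 * Tec m n) + 332 * ?M"
      using outer mult_le_mono2[OF inner, of depth] by linarith
  qed
  have "run_time \<le> 170 * ?M + ?M * (depth * 8 + 10) + Suc depth * (depth * (54 * Tec m n) + 332 * ?M)"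
    unfolding run_time_def using part1 part2 part3 by linarith
  then have "real run_time \<le> real (170 * ?M + ?M * (depth * 8 + 10) + Suc depth * (depth * (54 * Tec m n) + 332 * ?M))"
    by (simp only: of_nat_le_iff)
  also have "\<dots> = 170 * M + M * (real depth * 8 + 10) + (real depth + 1) * (real depth * (54 * T) + 332 * M)"
    by (simp add: T_def M_def algebra_simps)
  also have "\<dots> \<le> 170 * M * b + M * (26 * b) + (3 * b) * ((2 * a) * (54 * T) + 332 * M)"
  proof -
    have TM: "0 \<le> T" "0 \<le> M" by (simp_all add: T_def M_def)
    have "M * 1 \<le> M * b" using TM a1 ab by (intro mult_left_mono) auto
    moreover have "M * (real depth * 8 + 10) \<le> M * (26 * b)"
      using TM d a1 ab by (intro mult_left_mono) auto
    moreover have "real depth * (54 * T) \<le> (2 * a) * (54 * T)"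
      using TM d by (intro mult_right_mono) auto
    then have "(real depth + 1) * (real depth * (54 * T) + 332 * M) \<le> (3 * b) * ((2 * a) * (54 * T) + 332 * M)"
      using TM d a1 ab by (intro mult_mono) auto
    ultimately show ?thesis by linarith
  qed
  also have "\<dots> = 324 * (T * a * b) + 1192 * (M * b)"
    by (simp add: algebra_simps)
  also have "\<dots> \<le> 2000 * (T * a * b) + 2000 * (M * b)"
  proof -
    have "0 \<le> T * a * b" "0 \<le> M * b" using a1 ab by (simp_all add: T_def M_def)
    then show ?thesis by linarith
  qed
  also have "\<dots> = 2000 * ((T * a + M) * b)" by (simp add: algebra_simps)
  finally show ?thesis by (simp add: T_def M_def a_def b_def)
qed

end

theorem theorem3p2:
  shows "\<exists>(p::real) > 0. \<exists>(C::real) > 0. \<forall>P Tec. element_cut_solver P Tec \<longrightarrow>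
    (\<exists>Q. \<forall>G w R s m n k.
       egraph G \<and> positive_weights G w \<and> R \<subseteq> terminals G \<and> 2 \<le> card R \<and>
       graph_input G w s \<and> subset_input G R s \<and>
       m = card (edges G) \<and> n = card (verts G) \<and> k = card R \<longrightarrow>
       (\<exists>t. real t \<le> C * ((real (Tec m n) * log 2 (real k) + real (max_split_time Tec m n))
                          * log 2 (real n)) \<and>
            halts_within t Q s \<and>
            p \<le> measure_pmf.prob (run t Q s)
                  {(c', s'). rmem s' aResult 0 = kappa_set G w R}))"
proof (rule exI[of _ "1 / 40"], rule conjI, simp, rule exI[of _ 2000], rule conjI, simp, intro allI impI)
  fix P Tec assume solver: "element_cut_solver P Tec"
  \<comment> \<open>A program text names finitely many arrays, so a safe place for private data
    exists. It depends on \<open>P\<close> alone, which keeps \<open>algorithm\<close> independent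
    of the instance.\<close>
  obtain K where K: "nwr P \<union> rwr P \<subseteq> {..<K}"
    using finite_nat_bounded[of "nwr P \<union> rwr P"] finite_nwr finite_rwr by auto
  \<comment> \<open>The shift by 7 also keeps the private arrays clear of the seven interface
    arrays.\<close>
  interpret cut_program P "K + 7"
    by unfold_locales (use K in auto)
  show "\<exists>Q. \<forall>G w R s m n k.
       egraph G \<and> positive_weights G w \<and> R \<subseteq> terminals G \<and> 2 \<le> card R \<and>
       graph_input G w s \<and> subset_input G R s \<and>
       m = card (edges G) \<and> n = card (verts G) \<and> k = card R \<longrightarrow>
       (\<exists>t. real t \<le> 2000 * ((real (Tec m n) * log 2 (real k) + real (max_split_time Tec m n))
                          * log 2 (real n)) \<and>
            halts_within t Q s \<and>
            1 / 40 \<le> measure_pmf.prob (run t Q s)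
                  {(c', s'). rmem s' aResult 0 = kappa_set G w R})"
  proof (rule exI[of _ algorithm], intro allI impI, elim conjE)
    fix G :: "nat egraph" and w R s m n k
    assume a: "egraph G" "positive_weights G w" "R \<subseteq> terminals G" "2 \<le> card R"
      "graph_input G w s" "subset_input G R s"
      and mnk: "m = card (edges G)" "n = card (verts G)" "k = card R"
    interpret i: element_instance P "K + 7" Tec G w R s
      by unfold_locales (fact solver a)+
    show "\<exists>t. real t \<le> 2000 * ((real (Tec m n) * log 2 (real k) + real (max_split_time Tec m n))
                          * log 2 (real n)) \<and>
            halts_within t algorithm s \<and>
            1 / 40 \<le> measure_pmf.prob (run t algorithm s)
                  {(c', s'). rmem s' aResult 0 = kappa_set G w R}"
    proof (intro exI[of _ i.run_time] conjI)
      show "real i.run_time \<le> 2000 * ((real (Tec m n) * log 2 (real k) + real (max_split_time Tec m n))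
                          * log 2 (real n))"
        unfolding mnk by (rule i.run_time_le[unfolded i.m_def i.n_def])
      show "halts_within i.run_time algorithm s"
        using i.algorithm_halts by (auto simp: wp_def halts_within_def)
      show "1 / 40 \<le> measure_pmf.prob (run i.run_time algorithm s)
                  {(c', s'). rmem s' aResult 0 = kappa_set G w R}"
        by (rule i.algorithm_success)
    qed
  qed
qed

end
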